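(* Let $0<\alpha<n$, $1<p<\frac{n}{\alpha}$, $\frac1q=\frac1p-\frac{\alpha}{n}$, let $\Pi\subset\mathbb{R}^n$ be an arbitrary subset, and let $w\in A_{p,q}$, $\varphi\in\mathfrak{B}(w^p)$ and $\psi\in\mathfrak{B}(w^q)$. Suppose that $$c_\delta:=\int_\delta^\infty \sup_{x\in\Pi}\frac{\varphi^{\frac1p}(x,t)}{\|w\|_{L^q(B(x,t))}}\,\frac{dt}{t}<\infty\qquad\text{for every }\delta>0,$$ and that there is a constant $c_0$, not depending on $x\in\Pi$ and $r>0$, such that $$\int_r^\infty \frac{\varphi^{\frac1p}(x,t)}{\|w\|_{L^q(B(x,t))}}\,\frac{dt}{t}\le c_0\,\frac{\psi^{\frac1q}(x,r)}{\|w\|_{L^q(B(x,r))}}\qquad\text{for all }x\in\Pi,\ r>0.$$ Then the operators $M_\alpha$ and $I_\alpha$ are bounded from the vanishing generalized weighted Morrey space $VL_\Pi^{p,\varphi}(\mathbb{R}^n;w^p)$ to the vanishing generalized weighted Morrey space $VL_\Pi^{q,\psi}(\mathbb{R}^n;w^q)$.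
   Context: A weight is a measurable function $v$ on $\mathbb{R}^n$ with $v(x)>0$ for almost every $x$. $B(x,r)$ is the open ball centered at $x$ of radius $r$. For $1\le s<\infty$, a weight $v$ and $\Omega\subset\mathbb{R}^n$, $\|f\|_{L^{s,v}(\Omega)}=\left(\int_\Omega|f(y)|^s v(y)\,dy\right)^{1/s}$, and $L^{s,v}_{loc}(\mathbb{R}^n)$ is the corresponding local space. $L^s$ without a weight is the usual Lebesgue space. Fractional integral operator: $I_\alpha f(x)=\int_{\mathbb{R}^n}\frac{f(y)}{|x-y|^{n-\alpha}}\,dy$. Fractional maximal operator: $M_\alpha f(x)=\sup_{r>0}\frac{1}{r^{n-\alpha}}\int_{B(x,r)}|f(y)|\,dy$. Class $A_{p,q}$ ($1<p<q<\infty$, $\frac1p+\frac1{p'}=1$): a weight $w$ belongs to $A_{p,q}$ if there is a constant $c_{p,q}>1$ such that for every ball $B\subset\mathbb{R}^n$, $\|w\|_{L^q(B)}\|w^{-1}\|_{L^{p'}(B)}\le c_{p,q}|B|^{1+\frac1q-\frac1p}$. Class $\mathfrak{B}(v)$ (for a weight $v$ and the set $\Pi\subset\mathbb{R}^n$): $\varphi\in\mathfrak{B}(v)$ if $\varphi$ is a nonnegative measurable function on $\Pi\times[0,\infty)$, positive on $\Pi\times(0,\infty)$, with $$\lim_{r\to0}\sup_{x\in\Pi}\frac{\|v\|_{L^1(B(x,r))}}{\varphi(x,r)}=0\quad\text{and}\quad\inf_{r>1}\sup_{x\in\Pi}\varphi(x,r)>0.$$ Vanishing generalized weighted Morrey space: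 for $1\le s<\infty$ and a weight $v$, $VL_\Pi^{s,\varphi}(\mathbb{R}^n;v)$ is the space of all $f\in L^{s,v}_{loc}(\mathbb{R}^n)$ with $$\|f\|_{VL_\Pi^{s,\varphi}(v)}=\sup_{x\in\Pi,\,r>0}\frac{1}{\varphi^{\frac1s}(x,r)}\|f\|_{L^{s,v}(B(x,r))}<\infty\quad\text{and}\quad\lim_{r\to0}\sup_{x\in\Pi}\frac{1}{\varphi^{\frac1s}(x,r)}\|f\|_{L^{s,v}(B(x,r))}=0.$$ An operator $T$ is bounded from $VL_\Pi^{p,\varphi}(\mathbb{R}^n;w^p)$ to $VL_\Pi^{q,\psi}(\mathbb{R}^n;w^q)$ if for every $f$ in the first space, $Tf$ belongs to the second space (including the vanishing condition), and $\|Tf\|_{VL_\Pi^{q,\psi}(w^q)}\le C\|f\|_{VL_\Pi^{p,\varphi}(w^p)}$ with $C$ independent of $f$. *)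

theory Defs
  imports "HOL-Analysis.Analysis"
begin

text \<open>Norms and suprema are taken in \<^typ>\<open>ennreal\<close>, so that they exist unconditionally;
  "measurable" means Lebesgue measurable.\<close>

text \<open>Only used for \<open>a > 0\<close>.\<close>

definition ennreal_powr :: "ennreal \<Rightarrow> real \<Rightarrow> ennreal" where
  "ennreal_powr x a = (if x = \<infinity> then \<infinity> else ennreal (enn2real x powr a))"

definition weight :: "(real ^ 'n \<Rightarrow> real) \<Rightarrow> bool" where
  "weight v \<longleftrightarrow> v \<in> borel_measurable lebesgue \<and> (AE x in lebesgue. v x > 0)"

definition wnorm :: "real \<Rightarrow> (real ^ 'n \<Rightarrow> real) \<Rightarrow> (real ^ 'n) set \<Rightarrow> (real ^ 'n \<Rightarrow> real) \<Rightarrow> ennreal" where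
  "wnorm s v \<Omega> f = ennreal_powr (\<integral>\<^sup>+y\<in>\<Omega>. ennreal (\<bar>f y\<bar> powr s * v y) \<partial>lebesgue) (1 / s)"

abbreviation Lnorm :: "real \<Rightarrow> (real ^ 'n) set \<Rightarrow> (real ^ 'n \<Rightarrow> real) \<Rightarrow> ennreal" where
  "Lnorm s \<equiv> wnorm s (\<lambda>_. 1)"

definition L_loc :: "real \<Rightarrow> (real ^ 'n \<Rightarrow> real) \<Rightarrow> (real ^ 'n \<Rightarrow> real) set" where
  "L_loc s v = {f \<in> borel_measurable lebesgue. \<forall>K. compact K \<longrightarrow> wnorm s v K f < \<infinity>}"

text \<open>At \<open>y = x\<close> the integrand takes the junk value 0, and the integral is 0 when it does not
  converge absolutely. Convergence is therefore tracked by a separate predicate, here and for the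
  maximal operator.\<close>

definition frac_integral :: "real \<Rightarrow> (real ^ 'n \<Rightarrow> real) \<Rightarrow> real ^ 'n \<Rightarrow> real" where
  "frac_integral \<alpha> f x =
     (\<integral>y. f y / norm (x - y) powr (real CARD('n) - \<alpha>) \<partial>lebesgue)"

definition frac_integral_converges :: "real \<Rightarrow> (real ^ 'n \<Rightarrow> real) \<Rightarrow> real ^ 'n \<Rightarrow> bool" where
  "frac_integral_converges \<alpha> f x \<longleftrightarrow>
     integrable lebesgue (\<lambda>y. f y / norm (x - y) powr (real CARD('n) - \<alpha>))"

definition frac_maximal_ennreal :: "real \<Rightarrow> (real ^ 'n \<Rightarrow> real) \<Rightarrow> real ^ 'n \<Rightarrow> ennreal" where
  "frac_maximal_ennreal \<alpha> f x =
     (SUP r\<in>{0<..}. ennreal (1 / r powr (real CARD('n) - \<alpha>)) *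
        (\<integral>\<^sup>+y\<in>ball x r. ennreal \<bar>f y\<bar> \<partial>lebesgue))"

definition frac_maximal :: "real \<Rightarrow> (real ^ 'n \<Rightarrow> real) \<Rightarrow> real ^ 'n \<Rightarrow> real" where
  "frac_maximal \<alpha> f x = enn2real (frac_maximal_ennreal \<alpha> f x)"

definition frac_maximal_finite :: "real \<Rightarrow> (real ^ 'n \<Rightarrow> real) \<Rightarrow> real ^ 'n \<Rightarrow> bool" where
  "frac_maximal_finite \<alpha> f x \<longleftrightarrow> frac_maximal_ennreal \<alpha> f x < \<infinity>"

text \<open>The conjugate exponent of \<open>p\<close> is \<open>p / (p - 1)\<close>.\<close>

definition A_class :: "real \<Rightarrow> real \<Rightarrow> (real ^ 'n \<Rightarrow> real) set" where
  "A_class p q = {w. weight w \<and>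
     (\<exists>c>1. \<forall>x r. r > 0 \<longrightarrow>
        Lnorm q (ball x r) w * Lnorm (p / (p - 1)) (ball x r) (\<lambda>y. inverse (w y))
          \<le> ennreal (c * measure lebesgue (ball x r) powr (1 + 1 / q - 1 / p)))}"

text \<open>Since \<open>P\<close> is an arbitrary set, measurability on \<open>P \<times> [0,\<infinity>)\<close> refers to the trace
  \<open>\<sigma>\<close>-algebra. The supremum of the empty set in \<^typ>\<open>ennreal\<close> is 0, so the class is empty for
  \<open>P = {}\<close>.\<close>

definition B_class :: "(real ^ 'n) set \<Rightarrow> (real ^ 'n \<Rightarrow> real) \<Rightarrow> (real ^ 'n \<Rightarrow> real \<Rightarrow> real) set" where
  "B_class P v = {\<phi>.
     (\<lambda>(x, r). \<phi> x r) \<in> borel_measurable (restrict_space lebesgue (P \<times> {0..})) \<and>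
     (\<forall>x\<in>P. \<forall>r\<ge>0. \<phi> x r \<ge> 0) \<and>
     (\<forall>x\<in>P. \<forall>r>0. \<phi> x r > 0) \<and>
     ((\<lambda>r. SUP x\<in>P. Lnorm 1 (ball x r) v / ennreal (\<phi> x r)) \<longlongrightarrow> 0) (at_right 0) \<and>
     (INF r\<in>{1<..}. SUP x\<in>P. ennreal (\<phi> x r)) > 0}"

definition morrey_quot ::
  "real \<Rightarrow> (real ^ 'n \<Rightarrow> real \<Rightarrow> real) \<Rightarrow> (real ^ 'n \<Rightarrow> real) \<Rightarrow> (real ^ 'n \<Rightarrow> real)
    \<Rightarrow> real ^ 'n \<Rightarrow> real \<Rightarrow> ennreal" where
  "morrey_quot s \<phi> v f x r = wnorm s v (ball x r) f / ennreal (\<phi> x r powr (1 / s))"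

definition morrey_norm ::
  "(real ^ 'n) set \<Rightarrow> real \<Rightarrow> (real ^ 'n \<Rightarrow> real \<Rightarrow> real) \<Rightarrow> (real ^ 'n \<Rightarrow> real)
    \<Rightarrow> (real ^ 'n \<Rightarrow> real) \<Rightarrow> ennreal" where
  "morrey_norm P s \<phi> v f = (SUP x\<in>P. SUP r\<in>{0<..}. morrey_quot s \<phi> v f x r)"

definition vanishing_morrey ::
  "(real ^ 'n) set \<Rightarrow> real \<Rightarrow> (real ^ 'n \<Rightarrow> real \<Rightarrow> real) \<Rightarrow> (real ^ 'n \<Rightarrow> real)
    \<Rightarrow> (real ^ 'n \<Rightarrow> real) set" where
  "vanishing_morrey P s \<phi> v = {f \<in> L_loc s v.
     morrey_norm P s \<phi> v f < \<infinity> \<and>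
     ((\<lambda>r. SUP x\<in>P. morrey_quot s \<phi> v f x r) \<longlongrightarrow> 0) (at_right 0)}"

text \<open>\<open>D f x\<close> says that the expression defining \<open>T f x\<close> is meaningful and finite; this has to hold
  for almost every \<open>x\<close> for \<open>T f\<close> to be an element of the target space.\<close>

definition bounded_vanishing_morrey ::
  "((real ^ 'n \<Rightarrow> real) \<Rightarrow> real ^ 'n \<Rightarrow> bool) \<Rightarrow> ((real ^ 'n \<Rightarrow> real) \<Rightarrow> real ^ 'n \<Rightarrow> real)
    \<Rightarrow> (real ^ 'n) set
    \<Rightarrow> real \<Rightarrow> (real ^ 'n \<Rightarrow> real \<Rightarrow> real) \<Rightarrow> (real ^ 'n \<Rightarrow> real)
    \<Rightarrow> real \<Rightarrow> (real ^ 'n \<Rightarrow> real \<Rightarrow> real) \<Rightarrow> (real ^ 'n \<Rightarrow> real) \<Rightarrow> bool" where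
  "bounded_vanishing_morrey D T P p \<phi> u q \<psi> v \<longleftrightarrow>
     (\<exists>C::real. \<forall>f\<in>vanishing_morrey P p \<phi> u.
        (AE x in lebesgue. D f x) \<and>
        T f \<in> vanishing_morrey P q \<psi> v \<and>
        morrey_norm P q \<psi> v (T f) \<le> ennreal C * morrey_norm P p \<phi> u f)"

end

theory Submission
  imports Defs
begin

text \<open>Both operators are dominated by the Riesz potential \<open>J f\<close> of \<open>\<bar>f\<bar>\<close>, so the heart of the matter is
  the Muckenhoupt--Wheeden inequality for \<open>J\<close>, from \<open>L\<^sup>p(w\<^sup>p)\<close> to \<open>L\<^sup>q(w\<^sup>q)\<close>. Put
  \<open>\<sigma> = w powr (- p / (p - 1))\<close>, \<open>u = w powr q\<close>. Bounding the kernel by a sum over dyadic scales, the form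
  \<open>\<integral> J f \<cdot> h \<cdot> u\<close> is at most a sum over pairs of neighbouring dyadic cubes \<open>Q'\<close>, \<open>Q\<close>, and the \<open>A\<close> condition
  splits each term into
  \<open>(\<sigma>(Q') powr (1/p - 1) * \<integral>\<^bsub>Q'\<^esub> \<bar>f\<bar>) * (u(Q) powr (1/q' - 1) * \<integral>\<^bsub>Q\<^esub> h u)\<close>. Because \<open>p < q\<close> there is an
  exponent \<open>s\<close> strictly between, and the \<open>l\<^sup>s\<close> norm of the first and the dual \<open>l\<close> norm of the second factors
  can be summed over all cubes: \<open>\<sigma>(Q)\<close> and \<open>u(Q)\<close> grow geometrically along every chain of dyadic
  cubes. No maximal theorem is needed.

  For the Morrey spaces split \<open>f\<close> at \<open>B(x, 2r)\<close>; the weighted inequality handles the near part and dyadic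
  annuli the far part, so that the norm of \<open>J f\<close> on \<open>B(x, r)\<close> is controlled by a dyadic sum of the quotients
  of \<open>\<parallel>f\<parallel>\<close> and \<open>\<parallel>w\<parallel>\<close> over growing balls. By doubling this sum lies below the integral of the hypotheses; cutting that
  integral at a small \<open>\<delta>\<close> gives the vanishing property.\<close>

section \<open>Powers and integrals of extended nonnegative reals\<close>

text \<open>Why masses grow along chains: with \<open>\<beta> = (n - \<alpha>)/n\<close>, the
  \<open>A\<close> condition raised to \<open>1/\<beta>\<close> reads
  \<open>\<sigma>(B)^\<theta> u(B)^(1-\<theta>) <= K r^n\<close>, while
  \<open>\<sigma>^\<theta> u^(1-\<theta>) = 1\<close> and Hoelder's inequality give the reverse
  estimate on every measurable set. Hence a fixed share of the volume carries a fixed share of the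
  mass, for both weights; a parent cube minus one child has such a share. Why growth replaces a
  maximal theorem: at a point where \<open>2 g = t\<close>, a cube of mass \<open>m\<close>
  contributes at most \<open>t^p\<close> times the minimum of a positive and a negative power of
  \<open>m t^p\<close>. Along the chain of cubes both tails are geometric, so all scales together
  cost a constant. The positive power requires \<open>s > p\<close>, its dual counterpart
  \<open>s' > q'\<close>, that is \<open>s < q\<close>. The obstacle to vanishing: scales beyond
  \<open>\<delta>\<close> do not see that \<open>f\<close> is small near the centre. Their
  contribution is at most a constant depending on \<open>\<delta>\<close> times
  \<open>\<parallel>w\<parallel> / \<psi>^(1/q)\<close>, which tends to 0 uniformly because
  \<open>\<psi>\<close> lies in its class; only scales below \<open>\<delta>\<close> use the
  vanishing of \<open>f\<close> and the second integral hypothesis.\<close>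

lemma ennreal_powr_zero [simp]: "ennreal_powr 0 a = 0"
  by (simp add: ennreal_powr_def)

lemma ennreal_powr_top [simp]: "ennreal_powr top a = top"
  by (simp add: ennreal_powr_def)

lemma ennreal_powr_ennreal: "0 \<le> r \<Longrightarrow> ennreal_powr (ennreal r) a = ennreal (r powr a)"
  by (simp add: ennreal_powr_def)

lemma ennreal_powr_one [simp]: "ennreal_powr x 1 = x"
  by (cases x) (auto simp: ennreal_powr_ennreal)

lemma ennreal_powr_base_one [simp]: "ennreal_powr 1 a = 1"
  by (simp add: ennreal_powr_def)

lemma ennreal_powr_mono: "0 \<le> a \<Longrightarrow> x \<le> y \<Longrightarrow> ennreal_powr x a \<le> ennreal_powr y a"
  by (cases x; cases y) (auto simp: ennreal_powr_ennreal top_unique intro!: ennreal_leI powr_mono2)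

lemma ennreal_powr_mult: "ennreal_powr (x * y) a = ennreal_powr x a * ennreal_powr y a"
proof (cases x)
  case (real r)
  show ?thesis
  proof (cases y)
    case (real s)
    then show ?thesis using \<open>x = ennreal r\<close> \<open>0 \<le> r\<close>
      by (simp add: ennreal_powr_ennreal ennreal_mult[symmetric] powr_mult)
  next
    case top
    then show ?thesis using real
      by (cases "r = 0") (auto simp: ennreal_mult_top ennreal_powr_ennreal)
  qed
next
  case top
  show ?thesis
    by (cases y) (auto simp: top ennreal_powr_ennreal ennreal_top_mult)
qed

lemma ennreal_powr_powr: "ennreal_powr (ennreal_powr x a) b = ennreal_powr x (a * b)"
  by (cases x) (auto simp: ennreal_powr_ennreal powr_powr)

lemma ennreal_powr_eq_0_iff [simp]: "ennreal_powr x a = 0 \<longleftrightarrow> x = 0"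
  by (cases x) (auto simp: ennreal_powr_ennreal ennreal_eq_0_iff)

lemma ennreal_powr_eq_top_iff [simp]: "ennreal_powr x a = top \<longleftrightarrow> x = top"
  by (cases x) (auto simp: ennreal_powr_ennreal)

lemma ennreal_powr_less_top_iff [simp]: "ennreal_powr x a < top \<longleftrightarrow> x < top"
  by (simp add: less_top[symmetric])

lemma ennreal_powr_measurable [measurable]: "(\<lambda>x. ennreal_powr x a) \<in> borel_measurable borel"
  unfolding ennreal_powr_def by measurable

lemma ennreal_powr_le_iff:
  assumes "0 < a" shows "ennreal_powr x a \<le> ennreal_powr y a \<longleftrightarrow> x \<le> y"
proof
  assume "ennreal_powr x a \<le> ennreal_powr y a"
  then have "ennreal_powr (ennreal_powr x a) (1 / a) \<le> ennreal_powr (ennreal_powr y a) (1 / a)"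
    using assms by (simp add: ennreal_powr_mono[where a = "1 / a"])
  then show "x \<le> y" using assms by (auto simp: ennreal_powr_powr)
qed (use assms in \<open>auto intro: ennreal_powr_mono\<close>)

lemma ennreal_powr_add_le:
  assumes "0 < a"
  shows "ennreal_powr (x + y) a \<le> ennreal (2 powr a) * (ennreal_powr x a + ennreal_powr y a)"
proof -
  have "x + y \<le> 2 * max x y"
    by (metis add_mono max.cobounded1 max.cobounded2 mult_2)
  then have "ennreal_powr (x + y) a \<le> ennreal_powr (2 * max x y) a"
    using assms by (intro ennreal_powr_mono) auto
  also have "\<dots> = ennreal (2 powr a) * ennreal_powr (max x y) a"
    using ennreal_powr_ennreal[of 2 a] by (simp add: ennreal_powr_mult)
  also have "\<dots> \<le> ennreal (2 powr a) * (ennreal_powr x a + ennreal_powr y a)"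
    by (intro mult_left_mono) (auto simp: max_def)
  finally show ?thesis .
qed

lemma ennreal_powr_SUP:
  fixes f :: "nat \<Rightarrow> ennreal"
  assumes "0 < a" "incseq f"
  shows "ennreal_powr (SUP n. f n) a = (SUP n. ennreal_powr (f n) a)"
proof (rule antisym)
  have "(SUP n. f n) \<le> ennreal_powr (SUP n. ennreal_powr (f n) a) (1 / a)"
  proof (rule SUP_least)
    fix n
    have "f n = ennreal_powr (ennreal_powr (f n) a) (1 / a)"
      using assms by (simp add: ennreal_powr_powr)
    also have "\<dots> \<le> ennreal_powr (SUP n. ennreal_powr (f n) a) (1 / a)"
      using assms by (intro ennreal_powr_mono SUP_upper) auto
    finally show "f n \<le> \<dots>" .
  qed
  then have "ennreal_powr (SUP n. f n) a \<le> ennreal_powr (ennreal_powr (SUP n. ennreal_powr (f n) a) (1 / a)) a"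
    using assms by (intro ennreal_powr_mono) auto
  then show "ennreal_powr (SUP n. f n) a \<le> (SUP n. ennreal_powr (f n) a)"
    using assms by (simp add: ennreal_powr_powr)
qed (use assms in \<open>auto intro!: SUP_least ennreal_powr_mono SUP_upper\<close>)

lemma Young_ennreal:
  assumes "0 < t" "t < 1"
  shows "ennreal_powr x t * ennreal_powr y (1 - t) \<le> ennreal t * x + ennreal (1 - t) * y"
proof (cases x)
  case (real a)
  show ?thesis
  proof (cases y)
    case (real b)
    have "a powr t * b powr (1 - t) \<le> t * a + (1 - t) * b"
    proof (cases "a = 0 \<or> b = 0")
      case True
      then show ?thesis using assms real \<open>0 \<le> a\<close> by auto
    next
      case False
      then show ?thesis using assms real \<open>0 \<le> a\<close> by (intro Youngs_inequality_0) auto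
    qed
    then show ?thesis using real \<open>x = ennreal a\<close> \<open>0 \<le> a\<close> assms
      by (simp add: ennreal_powr_ennreal ennreal_mult[symmetric] ennreal_plus[symmetric] ennreal_leI
            del: ennreal_plus)
  next
    case top
    then show ?thesis using assms by (simp add: ennreal_mult_top)
  qed
next
  case top
  then show ?thesis using assms by (simp add: ennreal_mult_top)
qed

text \<open>Normalising both integrals to 1 reduces the claim to \<open>Young_ennreal\<close>. With
  the exponents \<open>t\<close> and \<open>1 - t\<close> outside, \<open>f\<close> and
  \<open>g\<close> can be the weighted densities themselves. As \<open>0 * top = 0\<close>, a
  vanishing integral has to be separated from an infinite one.\<close>

lemma Hoelder_nn_integral:
  assumes [measurable]: "f \<in> borel_measurable M" "g \<in> borel_measurable M"
    and t: "0 < t" "t < 1"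
  shows "(\<integral>\<^sup>+x. ennreal_powr (f x) t * ennreal_powr (g x) (1 - t) \<partial>M)
    \<le> ennreal_powr (\<integral>\<^sup>+x. f x \<partial>M) t * ennreal_powr (\<integral>\<^sup>+x. g x \<partial>M) (1 - t)"
    (is "?L \<le> ennreal_powr ?F t * ennreal_powr ?G (1 - t)")
proof -
  consider (0) "?F = 0 \<or> ?G = 0" | (top) "?F \<noteq> 0" "?G \<noteq> 0" "?F = top \<or> ?G = top"
    | (fin) "?F \<noteq> 0" "?G \<noteq> 0" "?F < top" "?G < top"
    using less_top by blast
  then show ?thesis
  proof cases
    case 0
    then have "AE x in M. ennreal_powr (f x) t * ennreal_powr (g x) (1 - t) = 0"
      by (auto simp: nn_integral_0_iff_AE elim!: eventually_mono)
    then have "?L = 0" by (subst nn_integral_0_iff_AE) auto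
    then show ?thesis by simp
  next
    case top
    then have "ennreal_powr ?F t * ennreal_powr ?G (1 - t) = top"
      by (auto simp: ennreal_top_mult ennreal_mult_top)
    then show ?thesis by simp
  next
    case fin
    obtain a where a: "?F = ennreal a" "0 < a"
      using fin(1,3) by (cases ?F) (auto simp: less_le)
    obtain b where b: "?G = ennreal b" "0 < b"
      using fin(2,4) by (cases ?G) (auto simp: less_le)
    define c where "c = ennreal (a powr t * b powr (1 - t))"
    have eq: "ennreal_powr (f x) t * ennreal_powr (g x) (1 - t)
      = c * (ennreal_powr (f x * ennreal (1 / a)) t * ennreal_powr (g x * ennreal (1 / b)) (1 - t))" for x
    proof -
      have "c * (ennreal_powr (f x * ennreal (1 / a)) t * ennreal_powr (g x * ennreal (1 / b)) (1 - t))
       = ennreal_powr (f x) t * ennreal_powr (g x) (1 - t) *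
         (c * ennreal ((1 / a) powr t * (1 / b) powr (1 - t)))"
        using a b by (simp add: ennreal_powr_mult ennreal_powr_ennreal ennreal_mult mult_ac)
      also have "c * ennreal ((1 / a) powr t * (1 / b) powr (1 - t)) = 1"
        using a b unfolding c_def by (simp add: ennreal_mult[symmetric] powr_divide)
      finally show ?thesis by simp
    qed
    have "?L = c * (\<integral>\<^sup>+x. ennreal_powr (f x * ennreal (1 / a)) t
        * ennreal_powr (g x * ennreal (1 / b)) (1 - t) \<partial>M)"
      unfolding eq by (rule nn_integral_cmult) measurable
    also have "\<dots> \<le> c * (\<integral>\<^sup>+x. ennreal t * (f x * ennreal (1 / a))
        + ennreal (1 - t) * (g x * ennreal (1 / b)) \<partial>M)"
      using t by (intro mult_left_mono nn_integral_mono Young_ennreal) auto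
    also have "\<dots> = c * (ennreal t * (?F * ennreal (1 / a)) + ennreal (1 - t) * (?G * ennreal (1 / b)))"
      by (simp add: nn_integral_add nn_integral_cmult nn_integral_multc)
    also have "\<dots> = c"
      using a b t by (simp add: ennreal_mult[symmetric] ennreal_plus[symmetric] del: ennreal_plus)
    also have "\<dots> = ennreal_powr ?F t * ennreal_powr ?G (1 - t)"
      using a b by (simp add: c_def ennreal_powr_ennreal ennreal_mult)
    finally show ?thesis .
  qed
qed

text \<open>For a fixed centre the growth function \<open>\<phi>\<close> need not be measurable in the radius, so \<open>h\<close> must be
  allowed to be arbitrary.\<close>

lemma nn_integral_le_cmult_nonmeasurable:
  assumes [measurable]: "s \<in> borel_measurable M" and "0 \<le> c"
    and le: "\<And>x. x \<in> space M \<Longrightarrow> s x \<le> ennreal c * h x"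
  shows "(\<integral>\<^sup>+x. s x \<partial>M) \<le> ennreal c * (\<integral>\<^sup>+x. h x \<partial>M)"
proof (cases "c = 0")
  case True
  then have "(\<integral>\<^sup>+x. s x \<partial>M) = (\<integral>\<^sup>+x. 0 \<partial>M)"
    using le by (intro nn_integral_cong) auto
  then show ?thesis by simp
next
  case False
  then have c: "0 < c" using \<open>0 \<le> c\<close> by simp
  have inv: "ennreal c * ennreal (1 / c) = 1"
    using c by (simp add: ennreal_mult[symmetric])
  have "(\<integral>\<^sup>+x. s x \<partial>M) = ennreal c * (\<integral>\<^sup>+x. ennreal (1 / c) * s x \<partial>M)"
    using inv by (simp add: nn_integral_cmult mult.assoc[symmetric])
  also have "\<dots> \<le> ennreal c * (\<integral>\<^sup>+x. h x \<partial>M)"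
  proof (intro mult_left_mono nn_integral_mono)
    fix x assume "x \<in> space M"
    then have "ennreal (1 / c) * s x \<le> ennreal (1 / c) * (ennreal c * h x)"
      by (intro mult_left_mono le) auto
    also have "\<dots> = h x" using inv by (metis mult.assoc mult.commute mult_1)
    finally show "ennreal (1 / c) * s x \<le> h x" .
  qed simp
  finally show ?thesis .
qed

section \<open>Embedding over dyadic cubes\<close>

text \<open>A geometrically increasing sequence passes the level 1 once. Counting indices from the
  last one at or below it makes all later bounds independent of the size of
  \<open>\<theta>\<close>.\<close>

lemma lacunary_crossing:
  fixes \<theta> :: "int \<Rightarrow> real"
  assumes eta: "\<eta> < 1" and pos: "\<And>k. 0 < \<theta> k" and lac: "\<And>k. \<theta> k \<le> \<eta> * \<theta> (k + 1)"
  obtains k0 where "\<And>j. \<theta> (k0 - int j) \<le> \<eta> ^ j" "\<And>j. 1 \<le> \<eta> ^ j * \<theta> (k0 + 1 + int j)"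
proof -
  have eta0: "0 < \<eta>"
  proof -
    have "0 < \<eta> * \<theta> 1" using pos[of 0] lac[of 0] by simp
    then show ?thesis using pos[of 1] by (simp add: zero_less_mult_iff)
  qed
  have iter: "\<theta> k \<le> \<eta> ^ j * \<theta> (k + int j)" for k j
  proof (induction j)
    case (Suc j)
    have "\<theta> k \<le> \<eta> ^ j * \<theta> (k + int j)" by (rule Suc)
    also have "\<dots> \<le> \<eta> ^ j * (\<eta> * \<theta> (k + int j + 1))"
      using eta0 by (intro mult_left_mono lac) auto
    finally show ?case by (simp add: algebra_simps)
  qed simp
  obtain j1 where j1: "\<eta> ^ j1 < 1 / \<theta> 0"
    using real_arch_pow_inv[of "1 / \<theta> 0" \<eta>] pos[of 0] eta by auto
  have low: "\<theta> (- int j1) \<le> 1"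
  proof -
    have "\<theta> (- int j1) \<le> \<eta> ^ j1 * \<theta> 0" using iter[of "- int j1" j1] by simp
    also have "\<dots> \<le> 1" using j1 pos[of 0] by (simp add: field_simps)
    finally show ?thesis .
  qed
  obtain j2 where j2: "\<eta> ^ j2 < \<theta> (- int j1)"
    using real_arch_pow_inv[of "\<theta> (- int j1)" \<eta>] pos[of "- int j1"] eta by auto
  have ex: "1 < \<theta> (- int j1 + int j2)"
  proof -
    have "\<eta> ^ j2 < \<eta> ^ j2 * \<theta> (- int j1 + int j2)"
      using iter[of "- int j1" j2] j2 by simp
    then show ?thesis using eta0 by simp
  qed
  define N where "N = (LEAST j. 1 < \<theta> (- int j1 + int j))"
  have N: "1 < \<theta> (- int j1 + int N)" unfolding N_def by (rule LeastI[of _ j2]) (rule ex)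
  have "N \<noteq> 0" using N low by (intro notI) simp
  then obtain n where n: "N = Suc n" by (cases N) auto
  have nle: "\<theta> (- int j1 + int n) \<le> 1"
    using not_less_Least[of n "\<lambda>j. 1 < \<theta> (- int j1 + int j)"] n N_def by auto
  show ?thesis
  proof (rule that[of "- int j1 + int n"])
    fix j
    have "\<theta> (- int j1 + int n - int j) \<le> \<eta> ^ j * \<theta> (- int j1 + int n)"
      using iter[of "- int j1 + int n - int j" j] by simp
    also have "\<dots> \<le> \<eta> ^ j * 1" using nle eta0 by (intro mult_left_mono) auto
    finally show "\<theta> (- int j1 + int n - int j) \<le> \<eta> ^ j" by simp
    have "1 < \<theta> (- int j1 + int n + 1)" using N n by (simp add: algebra_simps)
    then show "1 \<le> \<eta> ^ j * \<theta> (- int j1 + int n + 1 + int j)"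
      using iter[of "- int j1 + int n + 1" j] by simp
  qed
qed

text \<open>Sums over scales and cubes are kept as integrals against counting measure, so that they
  can be exchanged with integrals over the space. They become series only here, for the geometric
  bounds.\<close>

lemma nn_integral_count_space_int_split:
  fixes f :: "int \<Rightarrow> ennreal"
  shows "(\<integral>\<^sup>+k. f k \<partial>count_space UNIV) = (\<Sum>j. f (k0 - int j)) + (\<Sum>j. f (k0 + 1 + int j))"
proof -
  have b1: "bij_betw (\<lambda>j. k0 - int j) UNIV {..k0}"
    by (rule bij_betwI[where g = "\<lambda>k. nat (k0 - k)"]) auto
  have b2: "bij_betw (\<lambda>j. k0 + 1 + int j) UNIV {k0<..}"
    by (rule bij_betwI[where g = "\<lambda>k. nat (k - k0 - 1)"]) auto
  have "(\<integral>\<^sup>+k. f k \<partial>count_space UNIV)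
      = (\<integral>\<^sup>+k. f k * indicator {..k0} k + f k * indicator {k0<..} k \<partial>count_space UNIV)"
    by (intro nn_integral_cong) (auto split: split_indicator)
  also have "\<dots> = (\<integral>\<^sup>+k. f k * indicator {..k0} k \<partial>count_space UNIV)
      + (\<integral>\<^sup>+k. f k * indicator {k0<..} k \<partial>count_space UNIV)"
    by (rule nn_integral_add) auto
  also have "\<dots> = (\<integral>\<^sup>+k. f k \<partial>count_space {..k0}) + (\<integral>\<^sup>+k. f k \<partial>count_space {k0<..})"
    by (simp add: nn_integral_count_space_indicator)
  also have "\<dots> = (\<Sum>j. f (k0 - int j)) + (\<Sum>j. f (k0 + 1 + int j))"
    by (simp add: nn_integral_bij_count_space[OF b1, symmetric]
        nn_integral_bij_count_space[OF b2, symmetric] nn_integral_count_space_nat)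
  finally show ?thesis .
qed

lemma borel_measurable_nn_integral_count_space [measurable]:
  fixes f :: "'b :: countable \<Rightarrow> 'a \<Rightarrow> ennreal"
  assumes [measurable]: "\<And>i. f i \<in> borel_measurable M"
  shows "(\<lambda>x. \<integral>\<^sup>+i. f i x \<partial>count_space UNIV) \<in> borel_measurable M"
proof -
  interpret sigma_finite_measure "count_space (UNIV :: 'b set)"
    by (rule sigma_finite_measure_count_space)
  have "(\<lambda>z. f (snd z) (fst z)) \<in> borel_measurable (M \<Otimes>\<^sub>M count_space UNIV)"
    by (rule measurable_compose_countable[where f = "\<lambda>i z. f i (fst z)"]) measurable
  then show ?thesis
    by (intro borel_measurable_nn_integral) (simp add: case_prod_beta')
qed

lemma suminf_le_geometric:
  fixes f :: "nat \<Rightarrow> ennreal"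
  assumes "\<And>j. f j \<le> ennreal (c * x ^ j)" "0 \<le> c" "0 \<le> x" "x < 1"
  shows "(\<Sum>j. f j) \<le> ennreal (c / (1 - x))"
proof -
  have "(\<Sum>j. f j) \<le> (\<Sum>j. ennreal (c * x ^ j))"
    by (intro suminf_le assms) auto
  also have "\<dots> = ennreal (\<Sum>j. c * x ^ j)"
    using assms by (intro suminf_ennreal2 summable_mult summable_geometric) auto
  also have "(\<Sum>j. c * x ^ j) = c / (1 - x)"
    using assms by (simp add: suminf_mult suminf_geometric summable_geometric)
  finally show ?thesis .
qed

text \<open>Below the crossing of level 1 the first power is dominated by a geometric sequence,
  above it the second.\<close>

lemma lacunary_sum:
  fixes \<theta> :: "int \<Rightarrow> real"
  assumes eta: "\<eta> < 1" and pos: "\<And>k. 0 < \<theta> k" and lac: "\<And>k. \<theta> k \<le> \<eta> * \<theta> (k + 1)"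
    and ab: "0 < a" "0 < b"
  shows "(\<integral>\<^sup>+k. ennreal (min (\<theta> k powr a) (\<theta> k powr (- b))) \<partial>count_space UNIV)
    \<le> ennreal (1 / (1 - \<eta> powr a) + 1 / (1 - \<eta> powr b))"
proof -
  obtain k0 where k0: "\<And>j. \<theta> (k0 - int j) \<le> \<eta> ^ j" "\<And>j. 1 \<le> \<eta> ^ j * \<theta> (k0 + 1 + int j)"
    using lacunary_crossing[of \<eta> \<theta>] eta pos lac by metis
  have eta0: "0 < \<eta>"
  proof -
    have "0 < \<eta> * \<theta> 1" using pos[of 0] lac[of 0] by simp
    then show ?thesis using pos[of 1] by (simp add: zero_less_mult_iff)
  qed
  have l1: "\<eta> powr a < 1" "\<eta> powr b < 1"
    using powr_less_mono2[of a \<eta> 1] powr_less_mono2[of b \<eta> 1] eta eta0 ab by auto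
  let ?f = "\<lambda>k. ennreal (min (\<theta> k powr a) (\<theta> k powr (- b)))"
  have "(\<Sum>j. ?f (k0 - int j)) \<le> ennreal (1 / (1 - \<eta> powr a))"
  proof (rule suminf_le_geometric)
    fix j
    have "\<theta> (k0 - int j) powr a \<le> (\<eta> ^ j) powr a"
      using k0(1)[of j] pos ab by (intro powr_mono2) (auto simp: less_imp_le)
    also have "\<dots> = (\<eta> powr a) ^ j"
      using eta0 by (simp add: powr_realpow[symmetric] powr_powr mult.commute)
    finally show "?f (k0 - int j) \<le> ennreal (1 * (\<eta> powr a) ^ j)"
      by (intro ennreal_leI) auto
  qed (use l1 in auto)
  moreover have "(\<Sum>j. ?f (k0 + 1 + int j)) \<le> ennreal (1 / (1 - \<eta> powr b))"
  proof (rule suminf_le_geometric)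
    fix j
    have "(1 / \<eta> ^ j) powr b \<le> \<theta> (k0 + 1 + int j) powr b"
      using k0(2)[of j] eta0 ab by (intro powr_mono2) (auto simp: field_simps)
    then have "\<theta> (k0 + 1 + int j) powr (- b) \<le> (\<eta> ^ j) powr b"
      using pos[of "k0 + 1 + int j"] eta0 by (simp add: powr_minus powr_divide field_simps)
    also have "\<dots> = (\<eta> powr b) ^ j"
      using eta0 by (simp add: powr_realpow[symmetric] powr_powr mult.commute)
    finally show "?f (k0 + 1 + int j) \<le> ennreal (1 * (\<eta> powr b) ^ j)"
      by (intro ennreal_leI) auto
  qed (use l1 in auto)
  ultimately have "(\<integral>\<^sup>+k. ?f k \<partial>count_space UNIV)
      \<le> ennreal (1 / (1 - \<eta> powr a)) + ennreal (1 / (1 - \<eta> powr b))"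
    unfolding nn_integral_count_space_int_split[of ?f k0] by (rule add_mono)
  also have "\<dots> = ennreal (1 / (1 - \<eta> powr a) + 1 / (1 - \<eta> powr b))"
    using l1 by (intro ennreal_plus[symmetric]) auto
  finally show ?thesis .
qed

text \<open>The point of the bound is that, \<open>p\<close> being smaller than \<open>s\<close>, it can be summed over all scales
  without passing through a maximal function.\<close>

lemma cube_average_le:
  fixes M :: "'a measure" and g :: "'a \<Rightarrow> real"
  assumes [measurable]: "g \<in> borel_measurable M" "Q \<in> sets M"
    and g: "\<And>y. 0 \<le> g y" "(\<integral>\<^sup>+y. ennreal (g y powr p) \<partial>M) \<le> 1"
    and p: "1 < p" "p < s"
    and Q: "emeasure M Q < \<infinity>" "0 < measure M Q"
  shows "ennreal_powr (\<integral>\<^sup>+y. ennreal (g y) * indicator Q y \<partial>M) s * ennreal (measure M Q powr (s / p - s))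
    \<le> (\<integral>\<^sup>+y. ennreal (2 * g y * (2 * g y) powr (p - 1)) * (indicator Q y *
         ennreal (min ((measure M Q * (2 * g y) powr p) powr (s / p - 1))
           ((measure M Q * (2 * g y) powr p) powr (- (1 - 1 / p))))) \<partial>M)"
proof -
  define m where "m = measure M Q"
  have m: "0 < m" "emeasure M Q = ennreal m"
    using Q emeasure_eq_ennreal_measure[of M Q] by (auto simp: m_def)
  let ?F = "\<integral>\<^sup>+y. ennreal (g y) * indicator Q y \<partial>M"
  \<comment> \<open>Hoelder's inequality against the indicator of \<open>Q\<close>; it will give
    \<open>A \<le> m powr (- (1 / p))\<close> for the average \<open>A\<close>.\<close>
  have "?F = (\<integral>\<^sup>+y. ennreal_powr (ennreal (g y powr p)) (1 / p) * ennreal_powr (indicator Q y) (1 - 1 / p) \<partial>M)"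
    using p g(1) by (intro nn_integral_cong) (auto split: split_indicator simp: ennreal_powr_ennreal powr_powr)
  also have "\<dots> \<le> ennreal_powr (\<integral>\<^sup>+y. ennreal (g y powr p) \<partial>M) (1 / p)
      * ennreal_powr (\<integral>\<^sup>+y. indicator Q y \<partial>M) (1 - 1 / p)"
    using p by (intro Hoelder_nn_integral) auto
  also have "\<dots> \<le> ennreal_powr 1 (1 / p) * ennreal_powr (ennreal m) (1 - 1 / p)"
    using p g(2) m(2) by (intro mult_mono ennreal_powr_mono) auto
  finally have F: "?F \<le> ennreal (m powr (1 - 1 / p))"
    using m by (simp add: ennreal_powr_ennreal)
  then have "?F < top" by (rule le_less_trans) simp
  then obtain G where G: "?F = ennreal G" "0 \<le> G" by (cases ?F) auto
  have Gle: "G \<le> m powr (1 - 1 / p)" using F G by simp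
  define A where "A = G / m"
  have A: "0 \<le> A" "A \<le> m powr (- (1 / p))"
    using G Gle m by (auto simp: A_def field_simps powr_diff powr_minus)
  let ?X = "\<integral>\<^sup>+y. ennreal (g y) * indicator (Q \<inter> {y\<in>space M. A < 2 * g y}) y \<partial>M"
  \<comment> \<open>Where \<open>g\<close> is at most half its average it contributes at most
    \<open>G / 2\<close>. So at least half of the integral comes from \<open>A < 2 * g y\<close>,
    which explains the doubled \<open>g\<close> in the statement.\<close>
  have "?F \<le> (\<integral>\<^sup>+y. ennreal (g y) * indicator (Q \<inter> {y\<in>space M. A < 2 * g y}) y
      + ennreal (A / 2) * indicator Q y \<partial>M)"
    using sets.sets_into_space[OF assms(2)]
    by (intro nn_integral_mono) (auto split: split_indicator intro!: ennreal_leI)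
  also have "\<dots> = ?X + ennreal (G / 2)"
    using m A G by (subst nn_integral_add) (auto simp: nn_integral_cmult ennreal_mult[symmetric] A_def)
  finally have half: "ennreal G \<le> ?X + ennreal (G / 2)" using G by simp
  have two: "ennreal G \<le> 2 * ?X"
  proof (cases ?X)
    case (real x)
    then have "G \<le> x + G / 2" using half G by (simp add: ennreal_plus[symmetric] del: ennreal_plus)
    then have "ennreal G \<le> ennreal (2 * x)" by (intro ennreal_leI) simp
    then show ?thesis using real by (simp add: ennreal_mult)
  qed (simp add: ennreal_mult_top)
  have "ennreal_powr ?F s * ennreal (m powr (s / p - s)) = ennreal (G * (A powr (s - 1) * m powr (s / p - 1)))"
  proof (cases "G = 0")
    case False
    have "G powr s * m powr (s / p - s) = G * (A powr (s - 1) * m powr (s / p - 1))"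
      using m G False by (simp add: A_def powr_divide powr_diff field_simps)
    then show ?thesis using G by (simp add: ennreal_powr_ennreal ennreal_mult[symmetric])
  qed (use G in simp)
  also have "\<dots> = ennreal G * ennreal (A powr (s - 1) * m powr (s / p - 1))"
    using G by (intro ennreal_mult) auto
  also have "\<dots> \<le> (2 * ?X) * ennreal (A powr (s - 1) * m powr (s / p - 1))"
    by (intro mult_right_mono two) auto
  also have "\<dots> = (\<integral>\<^sup>+y. ennreal (2 * g y * (A powr (s - 1) * m powr (s / p - 1)))
      * indicator (Q \<inter> {y\<in>space M. A < 2 * g y}) y \<partial>M)"
  proof -
    have "(2 * ?X) * ennreal (A powr (s - 1) * m powr (s / p - 1))
      = (\<integral>\<^sup>+y. 2 * ennreal (A powr (s - 1) * m powr (s / p - 1)) *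
         (ennreal (g y) * indicator (Q \<inter> {y\<in>space M. A < 2 * g y}) y) \<partial>M)"
      by (subst nn_integral_cmult) (auto simp: mult_ac)
    also have "\<dots> = (\<integral>\<^sup>+y. ennreal (2 * g y * (A powr (s - 1) * m powr (s / p - 1)))
      * indicator (Q \<inter> {y\<in>space M. A < 2 * g y}) y \<partial>M)"
      using g(1) by (intro nn_integral_cong)
        (auto split: split_indicator simp: ennreal_mult mult_ac)
    finally show ?thesis .
  qed
  also have "\<dots> \<le> (\<integral>\<^sup>+y. ennreal (2 * g y * (2 * g y) powr (p - 1)) * (indicator Q y *
         ennreal (min ((m * (2 * g y) powr p) powr (s / p - 1))
           ((m * (2 * g y) powr p) powr (- (1 - 1 / p))))) \<partial>M)"
  proof (intro nn_integral_mono)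
    fix y
    \<comment> \<open>The average has two bounds: \<open>A < 2 * g y\<close>, useful when
      \<open>m * (2 * g y) powr p\<close> is small, and \<open>A \<le> m powr (- (1 / p))\<close>,
      useful when it is large. Together they produce the minimum.\<close>
    have main: "2 * g y * (A powr (s - 1) * m powr (s / p - 1)) \<le> 2 * g y * (2 * g y) powr (p - 1) *
       min ((m * (2 * g y) powr p) powr (s / p - 1)) ((m * (2 * g y) powr p) powr (- (1 - 1 / p)))"
      if "A < 2 * g y"
    proof -
      define t where "t = 2 * g y"
      have t: "0 < t" "A < t" using A that by (auto simp: t_def)
      have "A powr (s - 1) * m powr (s / p - 1) \<le> t powr (s - 1) * m powr (s / p - 1)"
        using A t p by (intro mult_right_mono powr_mono2) auto
      also have "\<dots> = t powr (p - 1) * (m * t powr p) powr (s / p - 1)"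
      proof -
        have "p * (s / p - 1) = s - p" using p by (simp add: field_simps)
        then have "(m * t powr p) powr (s / p - 1) = m powr (s / p - 1) * t powr (s - p)"
          using m t by (simp add: powr_mult powr_powr)
        then show ?thesis using t by (simp add: powr_add[symmetric] mult_ac)
      qed
      finally have 1: "A powr (s - 1) * m powr (s / p - 1) \<le> t powr (p - 1) * (m * t powr p) powr (s / p - 1)" .
      have "A powr (s - 1) * m powr (s / p - 1) \<le> (m powr (- (1 / p))) powr (s - 1) * m powr (s / p - 1)"
        using A t p by (intro mult_right_mono powr_mono2) auto
      also have "\<dots> = m powr (- (1 - 1 / p))"
        using m by (simp add: powr_powr powr_add[symmetric]) (simp add: algebra_simps diff_divide_distrib)
      also have "\<dots> = t powr (p - 1) * (m * t powr p) powr (- (1 - 1 / p))"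
      proof -
        have "p * (- (1 - 1 / p)) = - (p - 1)" using p by (simp add: field_simps)
        then have "(m * t powr p) powr (- (1 - 1 / p)) = m powr (- (1 - 1 / p)) * t powr (- (p - 1))"
          using m t by (simp only: powr_mult powr_powr)
        moreover have "t powr (p - 1) * t powr (- (p - 1)) = 1"
          using t by (simp only: powr_add[symmetric]) simp
        ultimately show ?thesis by (simp add: mult_ac)
      qed
      finally have 2: "A powr (s - 1) * m powr (s / p - 1) \<le> t powr (p - 1) * (m * t powr p) powr (- (1 - 1 / p))" .
      have "A powr (s - 1) * m powr (s / p - 1) \<le> t powr (p - 1) *
         min ((m * t powr p) powr (s / p - 1)) ((m * t powr p) powr (- (1 - 1 / p)))"
        using 1 2 by (auto simp: min_def)
      then have "t * (A powr (s - 1) * m powr (s / p - 1)) \<le> t * (t powr (p - 1) *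
         min ((m * t powr p) powr (s / p - 1)) ((m * t powr p) powr (- (1 - 1 / p))))"
        using t by (intro mult_left_mono) auto
      then show ?thesis unfolding t_def by (simp only: mult.assoc)
    qed
    show "ennreal (2 * g y * (A powr (s - 1) * m powr (s / p - 1)))
      * indicator (Q \<inter> {y\<in>space M. A < 2 * g y}) y
      \<le> ennreal (2 * g y * (2 * g y) powr (p - 1)) * (indicator Q y *
         ennreal (min ((m * (2 * g y) powr p) powr (s / p - 1))
           ((m * (2 * g y) powr p) powr (- (1 - 1 / p)))))"
      using main g(1)[of y] by (auto split: split_indicator simp: ennreal_mult[symmetric] intro!: ennreal_leI)
  qed
  finally show ?thesis unfolding m_def .
qed

text \<open>After exchanging sums and integral, each point sees one cube per scale, a chain of
  geometrically growing masses. By \<open>lacunary_sum\<close> the minima along it add up to a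
  constant whatever \<open>g y\<close> is, and only the integral of \<open>g y powr p\<close>
  remains.\<close>

lemma cube_embedding:
  fixes M :: "'a measure" and g :: "'a \<Rightarrow> real" and idx :: "int \<Rightarrow> 'a \<Rightarrow> 'b :: countable"
  assumes sp: "space M = UNIV" and [measurable]: "\<And>k i. {y. idx k y = i} \<in> sets M"
    and fin: "\<And>k i. emeasure M {y. idx k y = i} < \<infinity>"
    and pos: "\<And>k i. 0 < measure M {y. idx k y = i}"
    and lac: "\<And>k y. measure M {z. idx k z = idx k y} \<le> \<eta> * measure M {z. idx (k + 1) z = idx (k + 1) y}"
    and eta: "\<eta> < 1"
    and g [measurable]: "g \<in> borel_measurable M"
    and g0: "\<And>y. 0 \<le> g y" and g1: "(\<integral>\<^sup>+y. ennreal (g y powr p) \<partial>M) \<le> 1"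
    and p: "1 < p" "p < s"
  shows "(\<integral>\<^sup>+k. \<integral>\<^sup>+i. ennreal_powr (\<integral>\<^sup>+y. ennreal (g y) * indicator {y. idx k y = i} y \<partial>M) s
      * ennreal (measure M {y. idx k y = i} powr (s / p - s)) \<partial>count_space UNIV \<partial>count_space UNIV)
    \<le> ennreal (2 powr p * (1 / (1 - \<eta> powr (s / p - 1)) + 1 / (1 - \<eta> powr (1 - 1 / p))))"
proof -
  define S where "S = 1 / (1 - \<eta> powr (s / p - 1)) + 1 / (1 - \<eta> powr (1 - 1 / p))"
  define T where "T = (\<lambda>k i y. ennreal (min ((measure M {y. idx k y = i} * (2 * g y) powr p) powr (s / p - 1))
           ((measure M {y. idx k y = i} * (2 * g y) powr p) powr (- (1 - 1 / p)))))"
  have [measurable]: "T k i \<in> borel_measurable M" for k i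
    unfolding T_def by measurable
  have "(\<integral>\<^sup>+k. \<integral>\<^sup>+i. ennreal_powr (\<integral>\<^sup>+y. ennreal (g y) * indicator {y. idx k y = i} y \<partial>M) s
      * ennreal (measure M {y. idx k y = i} powr (s / p - s)) \<partial>count_space UNIV \<partial>count_space UNIV)
    \<le> (\<integral>\<^sup>+k. \<integral>\<^sup>+i. (\<integral>\<^sup>+y. ennreal (2 * g y * (2 * g y) powr (p - 1)) * (indicator {y. idx k y = i} y * T k i y) \<partial>M)
       \<partial>count_space UNIV \<partial>count_space UNIV)"
    unfolding T_def using g0 g1 p fin pos by (intro nn_integral_mono cube_average_le) auto
  also have "\<dots> = (\<integral>\<^sup>+y. (\<integral>\<^sup>+k. \<integral>\<^sup>+i. ennreal (2 * g y * (2 * g y) powr (p - 1)) * (indicator {y. idx k y = i} y * T k i y)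
       \<partial>count_space UNIV \<partial>count_space UNIV) \<partial>M)"
  proof -
    have "(\<integral>\<^sup>+i. \<integral>\<^sup>+y. ennreal (2 * g y * (2 * g y) powr (p - 1)) * (indicator {y. idx k y = i} y * T k i y) \<partial>M \<partial>count_space UNIV)
      = (\<integral>\<^sup>+y. \<integral>\<^sup>+i. ennreal (2 * g y * (2 * g y) powr (p - 1)) * (indicator {y. idx k y = i} y * T k i y) \<partial>count_space UNIV \<partial>M)" for k
      by (rule nn_integral_count_space_nn_integral[symmetric]) auto
    then show ?thesis
      by (simp only:) (rule nn_integral_count_space_nn_integral[symmetric], auto)
  qed
  also have "\<dots> = (\<integral>\<^sup>+y. ennreal (2 * g y * (2 * g y) powr (p - 1)) * (\<integral>\<^sup>+k. T k (idx k y) y \<partial>count_space UNIV) \<partial>M)"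
  proof (intro nn_integral_cong)
    fix y
    have "(\<integral>\<^sup>+i. indicator {y. idx k y = i} y * T k i y \<partial>count_space UNIV) = T k (idx k y) y" for k
      by (subst nn_integral_count_space'[of "{idx k y}"]) auto
    then show "(\<integral>\<^sup>+k. \<integral>\<^sup>+i. ennreal (2 * g y * (2 * g y) powr (p - 1)) * (indicator {y. idx k y = i} y * T k i y)
       \<partial>count_space UNIV \<partial>count_space UNIV)
      = ennreal (2 * g y * (2 * g y) powr (p - 1)) * (\<integral>\<^sup>+k. T k (idx k y) y \<partial>count_space UNIV)"
      by (simp add: nn_integral_cmult)
  qed
  also have "\<dots> \<le> (\<integral>\<^sup>+y. ennreal (2 powr p * S) * ennreal (g y powr p) \<partial>M)"
  proof (intro nn_integral_mono)
    fix y
    show "ennreal (2 * g y * (2 * g y) powr (p - 1)) * (\<integral>\<^sup>+k. T k (idx k y) y \<partial>count_space UNIV)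
      \<le> ennreal (2 powr p * S) * ennreal (g y powr p)"
    proof (cases "g y = 0")
      case False
      then have gy: "0 < g y" using g0[of y] by simp
      have "(\<integral>\<^sup>+k. T k (idx k y) y \<partial>count_space UNIV) \<le> ennreal S"
        unfolding T_def S_def
      proof (rule lacunary_sum[OF eta])
        fix k
        show "0 < measure M {z. idx k z = idx k y} * (2 * g y) powr p" using pos gy by simp
        show "measure M {z. idx k z = idx k y} * (2 * g y) powr p
          \<le> \<eta> * (measure M {z. idx (k + 1) z = idx (k + 1) y} * (2 * g y) powr p)"
          using lac[of k y] mult_right_mono[OF lac, of "(2 * g y) powr p" k y] by (simp add: mult_ac)
      qed (use p in \<open>auto simp: field_simps\<close>)
      then have "ennreal (2 * g y * (2 * g y) powr (p - 1)) * (\<integral>\<^sup>+k. T k (idx k y) y \<partial>count_space UNIV)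
         \<le> ennreal (2 * g y * (2 * g y) powr (p - 1)) * ennreal S"
        by (intro mult_left_mono) auto
      also have "\<dots> = ennreal (2 powr p * S) * ennreal (g y powr p)"
      proof -
        have "2 * g y * (2 * g y) powr (p - 1) = 2 powr p * g y powr p"
          using gy by (simp add: powr_mult powr_diff)
        then show ?thesis by (simp add: ennreal_mult' ennreal_mult'' mult_ac)
      qed
      finally show ?thesis .
    qed simp
  qed
  also have "\<dots> = ennreal (2 powr p * S) * (\<integral>\<^sup>+y. ennreal (g y powr p) \<partial>M)"
    by (rule nn_integral_cmult) measurable
  also have "\<dots> \<le> ennreal (2 powr p * S) * 1"
    by (intro mult_left_mono g1) auto
  finally show ?thesis unfolding S_def by simp
qed

text \<open>What the embedding uses of dyadic cubes under a weight. The indices form a group so that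
  a neighbouring cube can be addressed as \<open>i + d\<close>.\<close>

locale lacunary_cubes =
  fixes M :: "'a measure" and idx :: "int \<Rightarrow> 'a \<Rightarrow> 'b :: {countable, ab_group_add}" and \<eta> :: real
  assumes space_UNIV: "space M = UNIV"
    and cube_sets [measurable]: "{y. idx k y = i} \<in> sets M"
    and cube_finite: "emeasure M {y. idx k y = i} < \<infinity>"
    and cube_pos: "0 < measure M {y. idx k y = i}"
    and lacunary: "measure M {z. idx k z = idx k y} \<le> \<eta> * measure M {z. idx (k + 1) z = idx (k + 1) y}"
    and eta_less_1: "\<eta> < 1"
begin

abbreviation cube_meas :: "int \<Rightarrow> 'b \<Rightarrow> real" where
  "cube_meas k i \<equiv> measure M {y. idx k y = i}"

definition cube_int :: "('a \<Rightarrow> real) \<Rightarrow> int \<Rightarrow> 'b \<Rightarrow> ennreal" where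
  "cube_int g k i = (\<integral>\<^sup>+y. ennreal (g y) * indicator {y. idx k y = i} y \<partial>M)"

definition embedding_const :: "real \<Rightarrow> real \<Rightarrow> real" where
  "embedding_const p s = 2 powr p * (1 / (1 - \<eta> powr (s / p - 1)) + 1 / (1 - \<eta> powr (1 - 1 / p)))"

lemma embedding:
  assumes "g \<in> borel_measurable M" "\<And>y. 0 \<le> g y" "(\<integral>\<^sup>+y. ennreal (g y powr p) \<partial>M) \<le> 1"
    and "1 < p" "p < s"
  shows "(\<integral>\<^sup>+k. \<integral>\<^sup>+i. ennreal_powr (cube_int g k (i + d)) s
      * ennreal (cube_meas k (i + d) powr (s / p - s)) \<partial>count_space UNIV \<partial>count_space UNIV)
    \<le> ennreal (embedding_const p s)"
proof -
  have bij: "bij_betw (\<lambda>i. i + d) UNIV UNIV"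
    by (rule bij_betwI[where g = "\<lambda>i. i - d"]) auto
  have "(\<integral>\<^sup>+i. ennreal_powr (cube_int g k (i + d)) s
      * ennreal (cube_meas k (i + d) powr (s / p - s)) \<partial>count_space UNIV)
    = (\<integral>\<^sup>+i. ennreal_powr (cube_int g k i) s
      * ennreal (cube_meas k i powr (s / p - s)) \<partial>count_space UNIV)" for k
    by (rule nn_integral_bij_count_space[OF bij])
  then show ?thesis
    using cube_embedding[of M idx \<eta> g p s, OF space_UNIV cube_sets cube_finite cube_pos lacunary eta_less_1 assms]
    unfolding cube_int_def embedding_const_def by simp
qed

end

section \<open>Bilinear form over pairs of neighbouring cubes\<close>

locale lacunary_cubes_pair = S: lacunary_cubes S idx \<eta> + U: lacunary_cubes U idx \<eta>'
  for S U :: "'a measure" and idx :: "int \<Rightarrow> 'a \<Rightarrow> 'b :: {countable, ab_group_add}" and \<eta> \<eta>'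
begin

text \<open>The bound on \<open>K\<close> turns each term into \<open>a^(1/s) b^(1/s')\<close> up to
  the constant \<open>C0\<close>. Young's inequality separates the two factors, and each sum is an
  instance of \<open>embedding\<close>. The \<open>max 0\<close> makes the constants nonnegative
  without an appeal to the sign of \<open>\<eta>\<close>.\<close>

lemma bilinear_shift:
  assumes g: "g \<in> borel_measurable S" "\<And>y. 0 \<le> g y" "(\<integral>\<^sup>+y. ennreal (g y powr p) \<partial>S) \<le> 1"
    and h: "h \<in> borel_measurable U" "\<And>y. 0 \<le> h y" "(\<integral>\<^sup>+y. ennreal (h y powr q') \<partial>U) \<le> 1"
    and p: "1 < p" "p < s" and q: "1 < q'" "q' < s'" and s: "1 / s + 1 / s' = 1"
    and K: "\<And>k i. K k \<le> C0 * (S.cube_meas k (i + d) powr (1 / p - 1) * U.cube_meas k i powr (1 / q' - 1))"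
    and C0: "0 \<le> C0"
  shows "(\<integral>\<^sup>+k. \<integral>\<^sup>+i. ennreal (K k) * (S.cube_int g k (i + d) * U.cube_int h k i) \<partial>count_space UNIV \<partial>count_space UNIV)
    \<le> ennreal (C0 * (max 0 (S.embedding_const p s) + max 0 (U.embedding_const q' s')))"
proof -
  define a where "a = (\<lambda>k i. ennreal_powr (S.cube_int g k (i + d)) s
      * ennreal (S.cube_meas k (i + d) powr (s / p - s)))"
  define b where "b = (\<lambda>k i. ennreal_powr (U.cube_int h k i) s'
      * ennreal (U.cube_meas k i powr (s' / q' - s')))"
  have pt: "ennreal (K k) * (S.cube_int g k (i + d) * U.cube_int h k i) \<le> ennreal C0 * (a k i + b k i)" for k i
  proof -
    have s1: "0 < 1 / s" "1 / s < 1" "1 - 1 / s = 1 / s'" using p q s by (auto simp: field_simps)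
    have "ennreal (K k) * (S.cube_int g k (i + d) * U.cube_int h k i)
      \<le> ennreal (C0 * (S.cube_meas k (i + d) powr (1 / p - 1) * U.cube_meas k i powr (1 / q' - 1)))
        * (S.cube_int g k (i + d) * U.cube_int h k i)"
      by (intro mult_right_mono ennreal_leI K) auto
    also have "\<dots> = ennreal C0 * ((S.cube_int g k (i + d) * ennreal (S.cube_meas k (i + d) powr (1 / p - 1)))
        * (U.cube_int h k i * ennreal (U.cube_meas k i powr (1 / q' - 1))))"
      using C0 by (simp add: ennreal_mult mult_ac)
    also have "S.cube_int g k (i + d) * ennreal (S.cube_meas k (i + d) powr (1 / p - 1)) = ennreal_powr (a k i) (1 / s)"
    proof -
      have "(s / p - s) * (1 / s) = 1 / p - 1" using p by (simp add: field_simps)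
      then show ?thesis using p
        by (simp only: a_def ennreal_powr_mult ennreal_powr_powr ennreal_powr_ennreal powr_ge_zero powr_powr) simp
    qed
    also have "U.cube_int h k i * ennreal (U.cube_meas k i powr (1 / q' - 1)) = ennreal_powr (b k i) (1 - 1 / s)"
    proof -
      have "(s' / q' - s') * (1 / s') = 1 / q' - 1" using q by (simp add: field_simps)
      then show ?thesis using q unfolding s1(3)
        by (simp only: b_def ennreal_powr_mult ennreal_powr_powr ennreal_powr_ennreal powr_ge_zero powr_powr) simp
    qed
    also have "ennreal C0 * (ennreal_powr (a k i) (1 / s) * ennreal_powr (b k i) (1 - 1 / s))
       \<le> ennreal C0 * (ennreal (1 / s) * a k i + ennreal (1 - 1 / s) * b k i)"
      by (intro mult_left_mono Young_ennreal s1) auto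
    also have "\<dots> \<le> ennreal C0 * (1 * a k i + 1 * b k i)"
    proof -
      have "ennreal (1 / s) \<le> 1" "ennreal (1 - 1 / s) \<le> 1" using s1(1,2) by (auto simp del: ennreal_le_1 simp add: ennreal_le_1)
      then show ?thesis by (intro mult_left_mono add_mono mult_right_mono) auto
    qed
    finally show ?thesis by simp
  qed
  have "(\<integral>\<^sup>+k. \<integral>\<^sup>+i. ennreal (K k) * (S.cube_int g k (i + d) * U.cube_int h k i) \<partial>count_space UNIV \<partial>count_space UNIV)
    \<le> (\<integral>\<^sup>+k. \<integral>\<^sup>+i. ennreal C0 * (a k i + b k i) \<partial>count_space UNIV \<partial>count_space UNIV)"
    by (intro nn_integral_mono pt)
  also have "\<dots> = ennreal C0 * ((\<integral>\<^sup>+k. \<integral>\<^sup>+i. a k i \<partial>count_space UNIV \<partial>count_space UNIV)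
      + (\<integral>\<^sup>+k. \<integral>\<^sup>+i. b k i \<partial>count_space UNIV \<partial>count_space UNIV))"
    by (simp add: nn_integral_cmult nn_integral_add)
  also have "\<dots> \<le> ennreal C0 * (ennreal (max 0 (S.embedding_const p s)) + ennreal (max 0 (U.embedding_const q' s')))"
  proof (intro mult_left_mono add_mono)
    show "(\<integral>\<^sup>+k. \<integral>\<^sup>+i. a k i \<partial>count_space UNIV \<partial>count_space UNIV) \<le> ennreal (max 0 (S.embedding_const p s))"
      unfolding a_def by (rule order_trans[OF S.embedding[OF g p, of d]]) (simp add: ennreal_leI)
    show "(\<integral>\<^sup>+k. \<integral>\<^sup>+i. b k i \<partial>count_space UNIV \<partial>count_space UNIV) \<le> ennreal (max 0 (U.embedding_const q' s'))"
      unfolding b_def using order_trans[OF U.embedding[OF h q, of 0] ennreal_leI[OF max.cobounded2]] by simp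
  qed simp
  also have "\<dots> = ennreal (C0 * (max 0 (S.embedding_const p s) + max 0 (U.embedding_const q' s')))"
    using C0 by (simp add: ennreal_plus[symmetric] ennreal_mult[symmetric] del: ennreal_plus)
  finally show ?thesis .
qed

text \<open>Integrating cell by cell turns the operator, whose value at \<open>x\<close> depends
  only on the cell \<open>idx k x\<close> at each scale, into the double sum of
  \<open>bilinear_shift\<close>. Each shift costs the same, whence \<open>card D\<close>.\<close>

lemma bilinear:
  assumes g: "g \<in> borel_measurable S" "\<And>y. 0 \<le> g y" "(\<integral>\<^sup>+y. ennreal (g y powr p) \<partial>S) \<le> 1"
    and h [measurable]: "h \<in> borel_measurable U" and h': "\<And>y. 0 \<le> h y" "(\<integral>\<^sup>+y. ennreal (h y powr q') \<partial>U) \<le> 1"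
    and p: "1 < p" "p < s" and q: "1 < q'" "q' < s'" and s: "1 / s + 1 / s' = 1"
    and K: "\<And>k i d. d \<in> D \<Longrightarrow> K k \<le> C0 * (S.cube_meas k (i + d) powr (1 / p - 1) * U.cube_meas k i powr (1 / q' - 1))"
    and C0: "0 \<le> C0" and D: "finite D"
  shows "(\<integral>\<^sup>+x. ennreal (h x) * (\<Sum>d\<in>D. \<integral>\<^sup>+k. ennreal (K k) * S.cube_int g k (idx k x + d) \<partial>count_space UNIV) \<partial>U)
    \<le> ennreal (real (card D) * (C0 * (max 0 (S.embedding_const p s) + max 0 (U.embedding_const q' s'))))"
    (is "?L \<le> ennreal (real (card D) * ?C)")
proof -
  have [measurable]: "(\<lambda>x. S.cube_int g k (idx k x + d)) \<in> borel_measurable U" for k d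
  proof -
    have "idx k \<in> measurable U (count_space UNIV)"
      by (subst measurable_count_space_eq_countable) (auto simp: U.space_UNIV vimage_def)
    then show ?thesis by (rule measurable_compose) simp
  qed
  have each: "(\<integral>\<^sup>+x. ennreal (h x) * (\<integral>\<^sup>+k. ennreal (K k) * S.cube_int g k (idx k x + d) \<partial>count_space UNIV) \<partial>U) \<le> ennreal ?C"
    if d: "d \<in> D" for d
  proof -
    have one: "(\<integral>\<^sup>+x. ennreal (h x) * S.cube_int g k (idx k x + d) \<partial>U)
      = (\<integral>\<^sup>+i. S.cube_int g k (i + d) * U.cube_int h k i \<partial>count_space UNIV)" for k
    proof -
      have "(\<integral>\<^sup>+x. ennreal (h x) * S.cube_int g k (idx k x + d) \<partial>U)
        = (\<integral>\<^sup>+x. \<integral>\<^sup>+i. S.cube_int g k (i + d) * (ennreal (h x) * indicator {y. idx k y = i} x) \<partial>count_space UNIV \<partial>U)"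
      proof (intro nn_integral_cong)
        fix x
        show "ennreal (h x) * S.cube_int g k (idx k x + d)
          = (\<integral>\<^sup>+i. S.cube_int g k (i + d) * (ennreal (h x) * indicator {y. idx k y = i} x) \<partial>count_space UNIV)"
          by (subst nn_integral_count_space'[of "{idx k x}"]) (auto simp: mult.commute)
      qed
      also have "\<dots> = (\<integral>\<^sup>+i. \<integral>\<^sup>+x. S.cube_int g k (i + d) * (ennreal (h x) * indicator {y. idx k y = i} x) \<partial>U \<partial>count_space UNIV)"
        by (rule nn_integral_count_space_nn_integral) auto
      also have "\<dots> = (\<integral>\<^sup>+i. S.cube_int g k (i + d) * U.cube_int h k i \<partial>count_space UNIV)"
        by (intro nn_integral_cong) (simp add: nn_integral_cmult U.cube_int_def)
      finally show ?thesis .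
    qed
    have "(\<integral>\<^sup>+x. ennreal (h x) * (\<integral>\<^sup>+k. ennreal (K k) * S.cube_int g k (idx k x + d) \<partial>count_space UNIV) \<partial>U)
      = (\<integral>\<^sup>+x. \<integral>\<^sup>+k. ennreal (K k) * (ennreal (h x) * S.cube_int g k (idx k x + d)) \<partial>count_space UNIV \<partial>U)"
      by (intro nn_integral_cong) (simp add: nn_integral_cmult[symmetric] mult_ac)
    also have "\<dots> = (\<integral>\<^sup>+k. \<integral>\<^sup>+x. ennreal (K k) * (ennreal (h x) * S.cube_int g k (idx k x + d)) \<partial>U \<partial>count_space UNIV)"
      by (rule nn_integral_count_space_nn_integral) auto
    also have "\<dots> = (\<integral>\<^sup>+k. \<integral>\<^sup>+i. ennreal (K k) * (S.cube_int g k (i + d) * U.cube_int h k i) \<partial>count_space UNIV \<partial>count_space UNIV)"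
      by (intro nn_integral_cong) (simp add: nn_integral_cmult one)
    also have "\<dots> \<le> ennreal ?C"
      by (intro bilinear_shift g h h' p q s K d C0)
    finally show ?thesis .
  qed
  have "?L = (\<Sum>d\<in>D. \<integral>\<^sup>+x. ennreal (h x) * (\<integral>\<^sup>+k. ennreal (K k) * S.cube_int g k (idx k x + d) \<partial>count_space UNIV) \<partial>U)"
    by (simp add: sum_distrib_left nn_integral_sum)
  also have "\<dots> \<le> of_nat (card D) * ennreal ?C"
    by (rule sum_bounded_above) (rule each)
  also have "\<dots> = ennreal (real (card D) * ?C)"
    using C0 by (simp add: ennreal_of_nat_eq_real_of_nat ennreal_mult[symmetric])
  finally show ?thesis .
qed

end

section \<open>Converse of Hoelder's inequality\<close>

lemma ennreal_truncation_SUP: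
  fixes c :: ennreal
  shows "(SUP N. min c (of_nat N) * indicator {n..} N) = c"
proof (rule antisym)
  have "min c (of_nat N) \<le> (SUP N. min c (of_nat N) * indicator {n..} N)" for N
  proof (rule SUP_upper2[of "max n N"])
    show "min c (of_nat N) \<le> min c (of_nat (max n N)) * indicator {n..} (max n N)"
      by (auto simp: min_le_iff_disj)
  qed simp
  moreover have "c \<le> (SUP N. min c (of_nat N))"
  proof (cases c)
    case (real r)
    obtain N :: nat where "r \<le> real N" using real_arch_simple by blast
    then have "c \<le> of_nat N" using real by (simp add: ennreal_of_nat_eq_real_of_nat ennreal_leI)
    then show ?thesis by (intro SUP_upper2[of N]) auto
  next
    case top
    then show ?thesis by (simp add: ennreal_SUP_of_nat_eq_top)
  qed
  ultimately show "c \<le> (SUP N. min c (of_nat N) * indicator {n..} N)"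
    by (meson SUP_least order_trans)
qed (auto intro!: SUP_least split: split_indicator)

text \<open>\<open>J\<close> may be infinite or fail to be in \<open>L^q\<close>, so the extremal
  test function is built from truncations \<open>F N\<close>, bounded and supported on sets of
  finite measure. Their \<open>q\<close>-th powers have finite integral, and monotone convergence
  restores \<open>J\<close>.\<close>

lemma nn_integral_powr_le_by_duality:
  fixes J :: "'a \<Rightarrow> ennreal" and E :: "nat \<Rightarrow> 'a set"
  assumes [measurable]: "J \<in> borel_measurable M" "\<And>n. E n \<in> sets M"
    and E: "incseq E" "(\<Union>n. E n) = space M" "\<And>n. emeasure M (E n) < \<infinity>"
    and q: "1 < q" "1 / q + 1 / q' = 1" and C: "0 \<le> C"
    and test: "\<And>h. h \<in> borel_measurable M \<Longrightarrow> (\<And>x. 0 \<le> h x) \<Longrightarrow>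
      (\<integral>\<^sup>+x. ennreal (h x powr q') \<partial>M) \<le> 1 \<Longrightarrow> (\<integral>\<^sup>+x. ennreal (h x) * J x \<partial>M) \<le> ennreal C"
  shows "(\<integral>\<^sup>+x. ennreal_powr (J x) q \<partial>M) \<le> ennreal (C powr q)"
proof -
  have "1 / q' = (q - 1) / q" using q by (simp add: field_simps)
  then have q': "q' = q / (q - 1)" by (metis divide_divide_eq_right div_by_1 mult_1)
  define F where "F = (\<lambda>N x. min (J x) (of_nat N) * indicator (E N) x)"
  have [measurable]: "F N \<in> borel_measurable M" for N unfolding F_def by measurable
  have bound: "(\<integral>\<^sup>+x. ennreal_powr (F N x) q \<partial>M) \<le> ennreal (C powr q)" for N
  proof -
    define f where "f = (\<lambda>x. enn2real (F N x))"
    have [measurable]: "f \<in> borel_measurable M" unfolding f_def by measurable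
    have "F N x < top" for x
      by (rule le_less_trans[of _ "of_nat N"]) (auto simp: F_def of_nat_less_top split: split_indicator)
    then have Ff: "F N x = ennreal (f x)" and f0: "0 \<le> f x" for x unfolding f_def by auto
    have fJ: "ennreal (f x) \<le> J x" for x unfolding Ff[symmetric] F_def by (auto split: split_indicator)
    let ?X = "\<integral>\<^sup>+x. ennreal (f x powr q) \<partial>M"
    have "?X \<le> (\<integral>\<^sup>+x. ennreal (real N powr q) * indicator (E N) x \<partial>M)"
    proof (intro nn_integral_mono)
      fix x
      have "ennreal (f x) \<le> ennreal (real N) * indicator (E N) x"
        unfolding Ff[symmetric] F_def by (auto split: split_indicator simp: ennreal_of_nat_eq_real_of_nat)
      then have "f x \<le> real N * indicator (E N) x"
        by (auto split: split_indicator_asm simp: ennreal_eq_0_iff)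
      then show "ennreal (f x powr q) \<le> ennreal (real N powr q) * indicator (E N) x"
        using f0[of x] q by (auto split: split_indicator split_indicator_asm intro!: ennreal_leI powr_mono2)
    qed
    also have "\<dots> < top" using E(3)[of N] by (simp add: nn_integral_cmult ennreal_mult_less_top)
    finally obtain X where X: "?X = ennreal X" "0 \<le> X" by (cases ?X) auto
    have "X \<le> C powr q"
    proof (cases "X = 0")
      case False
      then have X0: "0 < X" using X by simp
      \<comment> \<open>The equality case of Hoelder's inequality, scaled so that the
        \<open>q'\<close>-th power integrates to 1.\<close>
      define h where "h = (\<lambda>x. f x powr (q - 1) * X powr (- (1 / q')))"
      have "(\<integral>\<^sup>+x. ennreal (h x powr q') \<partial>M) = (\<integral>\<^sup>+x. ennreal (f x powr q) * ennreal (1 / X) \<partial>M)"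
      proof (intro nn_integral_cong)
        fix x
        have "h x powr q' = f x powr q * (1 / X)"
        proof -
          have "(q - 1) * q' = q" "- (1 / q') * q' = -1" using q by (auto simp: q' field_simps)
          then show ?thesis
            using X0 f0[of x] unfolding h_def by (simp only: powr_mult powr_powr powr_ge_zero) (simp add: powr_minus_divide)
        qed
        then show "ennreal (h x powr q') = ennreal (f x powr q) * ennreal (1 / X)"
          using X0 by (simp add: ennreal_mult'[symmetric])
      qed
      also have "\<dots> = ennreal X * ennreal (1 / X)"
        by (subst nn_integral_multc) (auto simp: X)
      also have "\<dots> = 1" using X0 by (simp add: ennreal_mult[symmetric])
      finally have h1: "(\<integral>\<^sup>+x. ennreal (h x powr q') \<partial>M) \<le> 1" by simp
      have "ennreal (X powr (1 / q)) = ennreal X * ennreal (X powr (- (1 / q')))"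
      proof -
        have "1 / q = 1 + - (1 / q')" using q by simp
        then have "X powr (1 / q) = X * X powr (- (1 / q'))"
          using X0 by (simp only: powr_add) simp
        then show ?thesis using X0 by (simp add: ennreal_mult)
      qed
      also have "\<dots> = (\<integral>\<^sup>+x. ennreal (f x powr q) * ennreal (X powr (- (1 / q'))) \<partial>M)"
        by (subst nn_integral_multc) (auto simp: X)
      also have "\<dots> = (\<integral>\<^sup>+x. ennreal (h x) * ennreal (f x) \<partial>M)"
      proof (intro nn_integral_cong)
        fix x
        have "f x powr q * X powr (- (1 / q')) = h x * f x"
          using f0[of x] by (cases "f x = 0") (auto simp: h_def powr_diff field_simps)
        then show "ennreal (f x powr q) * ennreal (X powr (- (1 / q'))) = ennreal (h x) * ennreal (f x)"
          using f0[of x] by (simp add: ennreal_mult'[symmetric] ennreal_mult''[symmetric])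
      qed
      also have "\<dots> \<le> (\<integral>\<^sup>+x. ennreal (h x) * J x \<partial>M)"
        by (intro nn_integral_mono mult_left_mono fJ) auto
      also have "\<dots> \<le> ennreal C"
        by (rule test) (use h1 in \<open>auto simp: h_def\<close>)
      finally have "X powr (1 / q) \<le> C" using C by simp
      then have "(X powr (1 / q)) powr q \<le> C powr q" using q by (intro powr_mono2) auto
      then show ?thesis using q X0 by (simp add: powr_powr)
    qed simp
    then show ?thesis using X f0 by (simp add: Ff ennreal_powr_ennreal ennreal_leI)
  qed
  have inc: "incseq (\<lambda>N. F N x)" for x
    unfolding F_def
  proof (intro incseq_SucI mult_mono)
    fix N
    show "indicator (E N) x \<le> (indicator (E (Suc N)) x :: ennreal)"
      using incseqD[OF E(1), of N "Suc N"] by (auto split: split_indicator)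
    show "min (J x) (of_nat N) \<le> min (J x) (of_nat (Suc N))"
      by (intro min.mono of_nat_mono) auto
  qed auto
  have "(\<integral>\<^sup>+x. ennreal_powr (J x) q \<partial>M) = (\<integral>\<^sup>+x. (SUP N. ennreal_powr (F N x) q) \<partial>M)"
  proof (intro nn_integral_cong)
    fix x assume "x \<in> space M"
    then obtain n where n: "x \<in> E n" using E(2) by auto
    have "J x = (SUP N. min (J x) (of_nat N) * indicator {n..} N)"
      by (rule ennreal_truncation_SUP[symmetric])
    also have "\<dots> \<le> (SUP N. F N x)"
      unfolding F_def using n incseqD[OF E(1)] by (intro SUP_mono' mult_left_mono) (auto split: split_indicator)
    finally have "(SUP N. F N x) = J x"
      by (intro antisym SUP_least) (auto simp: F_def split: split_indicator)
    then show "ennreal_powr (J x) q = (SUP N. ennreal_powr (F N x) q)"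
      using ennreal_powr_SUP[OF _ inc, of q x] q by simp
  qed
  also have "\<dots> = (SUP N. \<integral>\<^sup>+x. ennreal_powr (F N x) q \<partial>M)"
  proof (rule nn_integral_monotone_convergence_SUP)
    show "incseq (\<lambda>N x. ennreal_powr (F N x) q)"
      using inc q by (auto simp: incseq_def le_fun_def intro!: ennreal_powr_mono)
  qed measurable
  also have "\<dots> \<le> ennreal (C powr q)" by (intro SUP_least bound)
  finally show ?thesis .
qed

section \<open>Dyadic cubes and the weighted inequality\<close>

text \<open>Larger \<open>k\<close> means larger cubes, of side \<open>2 powr k\<close>. The floor
  makes them half-open, so that each scale is a partition.\<close>

definition dyadic_index :: "int \<Rightarrow> real ^ 'n \<Rightarrow> int ^ 'n" where
  "dyadic_index k y = (\<chi> i. \<lfloor>y $ i / 2 powr real_of_int k\<rfloor>)"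

lemma dyadic_index_eq_iff:
  "dyadic_index k y = m \<longleftrightarrow>
    (\<forall>i. 2 powr real_of_int k * real_of_int (m $ i) \<le> y $ i \<and> y $ i < 2 powr real_of_int k * (real_of_int (m $ i) + 1))"
  by (simp add: dyadic_index_def vec_eq_iff floor_eq_iff field_simps)

lemma dyadic_cube_sets_borel: "{y. dyadic_index k y = m} \<in> sets borel"
  unfolding dyadic_index_eq_iff by measurable

lemma dyadic_cube_sets [measurable]: "{y. dyadic_index k y = m} \<in> sets lebesgue"
  using dyadic_cube_sets_borel by (rule sets_completionI_sets[of _ lborel, simplified])

lemma emeasure_dyadic_cube:
  "emeasure lebesgue {y :: real ^ 'n. dyadic_index k y = m} = ennreal ((2 powr real_of_int k) ^ CARD('n))"
proof -
  define a :: "real ^ 'n" where "a = (\<chi> i. 2 powr real_of_int k * real_of_int (m $ i))"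
  define b :: "real ^ 'n" where "b = (\<chi> i. 2 powr real_of_int k * (real_of_int (m $ i) + 1))"
  have sub: "box a b \<subseteq> {y. dyadic_index k y = m}" "{y. dyadic_index k y = m} \<subseteq> cbox a b"
    by (auto simp: dyadic_index_eq_iff mem_box_cart a_def b_def less_imp_le)
  have prod: "(\<Prod>j\<in>Basis. (b - a) \<bullet> j) = (2 powr real_of_int k) ^ CARD('n)"
  proof -
    have "(\<Prod>j\<in>Basis. (b - a) \<bullet> j) = (\<Prod>j\<in>(Basis :: (real ^ 'n) set). 2 powr real_of_int k)"
      by (intro prod.cong) (auto simp: Basis_vec_def inner_axis a_def b_def algebra_simps)
    then show ?thesis by simp
  qed
  have le: "\<And>j. j \<in> Basis \<Longrightarrow> a \<bullet> j \<le> b \<bullet> j"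
    by (auto simp: Basis_vec_def inner_axis a_def b_def)
  have "emeasure lborel (box a b) \<le> emeasure lborel {y. dyadic_index k y = m}"
    using sub dyadic_cube_sets_borel by (intro emeasure_mono) auto
  moreover have "emeasure lborel {y. dyadic_index k y = m} \<le> emeasure lborel (cbox a b)"
    using sub by (intro emeasure_mono) auto
  ultimately show ?thesis
    using dyadic_cube_sets_borel[of k m] by (simp add: le prod)
qed

lemma dyadic_index_parent: "dyadic_index (k + 1) y = (\<chi> i. dyadic_index k y $ i div 2)"
proof -
  have "\<lfloor>y $ i / 2 powr real_of_int (k + 1)\<rfloor> = \<lfloor>y $ i / 2 powr real_of_int k\<rfloor> div 2" for i
  proof -
    have "y $ i / 2 powr real_of_int (k + 1) = (y $ i / 2 powr real_of_int k) / real_of_int 2"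
      by (simp add: powr_add)
    then show ?thesis by (simp only: floor_divide_real_eq_div)
  qed
  then show ?thesis by (simp add: dyadic_index_def vec_eq_iff)
qed

lemma dyadic_index_scale_Suc: "dyadic_index k z = dyadic_index k y \<Longrightarrow> dyadic_index (k + 1) z = dyadic_index (k + 1) y"
  by (simp add: dyadic_index_parent)

definition unit_shifts :: "(int ^ 'n) set" where
  "unit_shifts = {d. \<forall>i. d $ i \<in> {-1, 0, 1}}"

lemma finite_unit_shifts: "finite (unit_shifts :: (int ^ 'n) set)"
proof -
  have "unit_shifts \<subseteq> vec_lambda ` (PiE (UNIV :: 'n set) (\<lambda>_. {-1, 0, 1 :: int}))"
  proof
    fix d :: "int ^ 'n" assume d: "d \<in> unit_shifts"
    then have "(\<lambda>i. d $ i) \<in> PiE (UNIV :: 'n set) (\<lambda>_. {-1, 0, 1 :: int})"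
      by (auto simp: unit_shifts_def)
    then show "d \<in> vec_lambda ` (PiE (UNIV :: 'n set) (\<lambda>_. {-1, 0, 1 :: int}))"
      by (intro image_eqI[of _ _ "\<lambda>i. d $ i"]) auto
  qed
  then show ?thesis by (rule finite_subset) (intro finite_imageI finite_PiE, auto)
qed

lemma zero_in_unit_shifts: "0 \<in> unit_shifts"
  by (simp add: unit_shifts_def)

lemma dyadic_index_diff_unit:
  assumes "norm (x - y) \<le> 2 powr real_of_int k"
  shows "dyadic_index k y - dyadic_index k x \<in> unit_shifts"
proof -
  have "\<lfloor>y $ i / 2 powr real_of_int k\<rfloor> - \<lfloor>x $ i / 2 powr real_of_int k\<rfloor> \<in> {-1, 0, 1}" for i
  proof -
    have "\<bar>x $ i - y $ i\<bar> \<le> 2 powr real_of_int k"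
      using component_le_norm_cart[of "x - y" i] assms by simp
    then have 1: "y $ i / 2 powr real_of_int k \<le> x $ i / 2 powr real_of_int k + 1"
      "x $ i / 2 powr real_of_int k \<le> y $ i / 2 powr real_of_int k + 1"
      by (auto simp: field_simps)
    have "\<lfloor>y $ i / 2 powr real_of_int k\<rfloor> \<le> \<lfloor>x $ i / 2 powr real_of_int k\<rfloor> + 1"
      "\<lfloor>x $ i / 2 powr real_of_int k\<rfloor> \<le> \<lfloor>y $ i / 2 powr real_of_int k\<rfloor> + 1"
      using floor_mono[OF 1(1)] floor_mono[OF 1(2)] by simp_all
    then show ?thesis by auto
  qed
  then show ?thesis by (simp add: unit_shifts_def dyadic_index_def)
qed

lemma dyadic_neighbour_subset_ball:
  fixes y z :: "real ^ 'n"
  assumes "dyadic_index k z - dyadic_index k y \<in> unit_shifts"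
  shows "z \<in> ball y (3 * real CARD('n) * 2 powr real_of_int k)"
proof -
  have "\<bar>(y - z) $ i\<bar> \<le> 2 * 2 powr real_of_int k" for i
  proof -
    have "\<lfloor>z $ i / 2 powr real_of_int k\<rfloor> - \<lfloor>y $ i / 2 powr real_of_int k\<rfloor> \<in> {-1, 0, 1}"
      using assms by (simp add: unit_shifts_def dyadic_index_def)
    then have "z $ i / 2 powr real_of_int k \<le> y $ i / 2 powr real_of_int k + 2"
      "y $ i / 2 powr real_of_int k \<le> z $ i / 2 powr real_of_int k + 2"
      by (simp; linarith)+
    then show ?thesis by (simp add: field_simps abs_le_iff)
  qed
  \<comment> \<open>Summing over coordinates gives \<open>2 * n\<close> side lengths; the 3 in the
    radius leaves room for the strict inequality of an open ball.\<close>
  then have "norm (y - z) \<le> (\<Sum>i\<in>(UNIV :: 'n set). 2 * 2 powr real_of_int k)"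
    by (intro order_trans[OF norm_le_l1_cart] sum_mono) auto
  also have "\<dots> < 3 * real CARD('n) * 2 powr real_of_int k" by simp
  finally show ?thesis by (simp add: dist_norm)
qed

section \<open>Riesz potential and its dyadic majorant\<close>

definition riesz_potential :: "real \<Rightarrow> (real ^ 'n \<Rightarrow> real) \<Rightarrow> real ^ 'n \<Rightarrow> ennreal" where
  "riesz_potential \<alpha> f x = (\<integral>\<^sup>+y. ennreal (\<bar>f y\<bar> / norm (x - y) powr (real CARD('n) - \<alpha>)) \<partial>lebesgue)"

lemma lebesgue_measurable_convolution_kernel [measurable]:
  fixes f :: "real ^ 'n \<Rightarrow> real"
  assumes [measurable]: "f \<in> borel_measurable lebesgue"
  shows "(\<lambda>y. f y / norm (x - y) powr a) \<in> borel_measurable lebesgue"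
proof -
  have "(\<lambda>y. norm (x - y) powr a) \<in> borel_measurable lborel" by measurable
  then have [measurable]: "(\<lambda>y. norm (x - y) powr a) \<in> borel_measurable lebesgue"
    by (rule measurable_completion)
  show ?thesis by measurable
qed

text \<open>Altering \<open>f\<close> on a null set changes no value of the potential, so a Borel
  representative may be taken, and with it the integrand is jointly Borel.\<close>

lemma riesz_potential_measurable [measurable]:
  fixes f :: "real ^ 'n \<Rightarrow> real"
  assumes f: "f \<in> borel_measurable lebesgue"
  shows "riesz_potential \<alpha> f \<in> borel_measurable lebesgue"
proof -
  obtain f' where [measurable]: "f' \<in> borel_measurable lborel" and ff': "AE x in lborel. f x = f' x"
    using completion_ex_borel_measurable_real[OF f] by blast
  have "riesz_potential \<alpha> f = (\<lambda>x. \<integral>\<^sup>+y. ennreal (\<bar>f' y\<bar> / norm (x - y) powr (real CARD('n) - \<alpha>)) \<partial>lborel)"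
  proof
    fix x
    show "riesz_potential \<alpha> f x = (\<integral>\<^sup>+y. ennreal (\<bar>f' y\<bar> / norm (x - y) powr (real CARD('n) - \<alpha>)) \<partial>lborel)"
      unfolding riesz_potential_def nn_integral_completion
      using ff' by (intro nn_integral_cong_AE) (auto elim: eventually_mono)
  qed
  also have "\<dots> \<in> borel_measurable lborel" by measurable
  finally show ?thesis by (rule measurable_completion)
qed

lemma dyadic_scale_exists:
  fixes t :: real
  assumes "0 < t"
  obtains k :: int where "2 powr (real_of_int k - 1) < t" "t \<le> 2 powr real_of_int k"
proof
  show "t \<le> 2 powr real_of_int \<lceil>log 2 t\<rceil>"
    using assms by (simp add: log_le_iff[symmetric])
  show "2 powr (real_of_int \<lceil>log 2 t\<rceil> - 1) < t"
    using assms by (simp add: less_log_iff[symmetric]) linarith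
qed

text \<open>If \<open>2 powr (k - 1) < norm (x - y) \<le> 2 powr k\<close>, then \<open>y\<close>
  lies in a neighbour of the scale-\<open>k\<close> cube of \<open>x\<close>, and that single term
  dominates the kernel. The factor in front is the loss over one dyadic step.\<close>

lemma riesz_potential_le_dyadic_sum:
  fixes f :: "real ^ 'n \<Rightarrow> real"
  assumes [measurable]: "f \<in> borel_measurable lebesgue" and a: "\<alpha> < real CARD('n)"
  shows "riesz_potential \<alpha> f x \<le> ennreal (2 powr (real CARD('n) - \<alpha>)) *
    (\<Sum>d\<in>unit_shifts. \<integral>\<^sup>+k. ennreal (2 powr (real_of_int k * (\<alpha> - real CARD('n)))) *
      (\<integral>\<^sup>+y. ennreal \<bar>f y\<bar> * indicator {y. dyadic_index k y = dyadic_index k x + d} y \<partial>lebesgue) \<partial>count_space UNIV)"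
proof -
  define c where "c = ennreal (2 powr (real CARD('n) - \<alpha>))"
  define K where "K = (\<lambda>k::int. ennreal (2 powr (real_of_int k * (\<alpha> - real CARD('n)))))"
  define I where "I = (\<lambda>k d y. indicator {y. dyadic_index k y = dyadic_index k x + d} y :: ennreal)"
  have [measurable]: "I k d \<in> borel_measurable lebesgue" for k d unfolding I_def by measurable
  have pt: "ennreal (\<bar>f y\<bar> / norm (x - y) powr (real CARD('n) - \<alpha>))
     \<le> c * (\<Sum>d\<in>unit_shifts. \<integral>\<^sup>+k. K k * (ennreal \<bar>f y\<bar> * I k d y) \<partial>count_space UNIV)" for y
  \<comment> \<open>At \<open>y = x\<close> division by zero gives the kernel the value 0, so this
    case is trivial.\<close>
  proof (cases "x = y")
    case False
    then obtain k where k: "2 powr (real_of_int k - 1) < norm (x - y)" "norm (x - y) \<le> 2 powr real_of_int k"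
      using dyadic_scale_exists[of "norm (x - y)"] by auto
    define d where "d = dyadic_index k y - dyadic_index k x"
    have d: "d \<in> unit_shifts" unfolding d_def by (rule dyadic_index_diff_unit) (rule k)
    have "1 / norm (x - y) powr (real CARD('n) - \<alpha>) \<le> 1 / (2 powr (real_of_int k - 1)) powr (real CARD('n) - \<alpha>)"
      using k a False by (intro divide_left_mono powr_mono2 mult_pos_pos) auto
    also have "\<dots> = 2 powr (real CARD('n) - \<alpha>) * 2 powr (real_of_int k * (\<alpha> - real CARD('n)))"
      by (simp add: powr_powr powr_minus_divide[symmetric] powr_add[symmetric]) (simp add: algebra_simps)
    finally have "\<bar>f y\<bar> * (1 / norm (x - y) powr (real CARD('n) - \<alpha>)) \<le>
        \<bar>f y\<bar> * (2 powr (real CARD('n) - \<alpha>) * 2 powr (real_of_int k * (\<alpha> - real CARD('n))))"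
      by (intro mult_left_mono) auto
    then have "ennreal (\<bar>f y\<bar> / norm (x - y) powr (real CARD('n) - \<alpha>)) \<le>
       ennreal (\<bar>f y\<bar> * (2 powr (real CARD('n) - \<alpha>) * 2 powr (real_of_int k * (\<alpha> - real CARD('n)))))"
      by (intro ennreal_leI) simp
    also have "\<dots> = c * (K k * (ennreal \<bar>f y\<bar> * I k d y))"
      by (simp add: c_def K_def I_def d_def ennreal_mult mult_ac)
    also have "\<dots> \<le> c * (\<integral>\<^sup>+k. K k * (ennreal \<bar>f y\<bar> * I k d y) \<partial>count_space UNIV)"
      by (intro mult_left_mono nn_integral_ge_point) auto
    also have "\<dots> \<le> c * (\<Sum>d\<in>unit_shifts. \<integral>\<^sup>+k. K k * (ennreal \<bar>f y\<bar> * I k d y) \<partial>count_space UNIV)"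
      using finite_unit_shifts d by (intro mult_left_mono member_le_sum) auto
    finally show ?thesis .
  qed simp
  have "riesz_potential \<alpha> f x
     \<le> (\<integral>\<^sup>+y. c * (\<Sum>d\<in>unit_shifts. \<integral>\<^sup>+k. K k * (ennreal \<bar>f y\<bar> * I k d y) \<partial>count_space UNIV) \<partial>lebesgue)"
    unfolding riesz_potential_def by (intro nn_integral_mono pt)
  also have "\<dots> = c * (\<Sum>d\<in>unit_shifts. \<integral>\<^sup>+y. \<integral>\<^sup>+k. K k * (ennreal \<bar>f y\<bar> * I k d y) \<partial>count_space UNIV \<partial>lebesgue)"
    by (simp add: nn_integral_cmult nn_integral_sum)
  also have "\<dots> = c * (\<Sum>d\<in>unit_shifts. \<integral>\<^sup>+k. \<integral>\<^sup>+y. K k * (ennreal \<bar>f y\<bar> * I k d y) \<partial>lebesgue \<partial>count_space UNIV)"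
    by (intro arg_cong2[where f = "(*)"] sum.cong refl nn_integral_count_space_nn_integral) auto
  also have "\<dots> = c * (\<Sum>d\<in>unit_shifts. \<integral>\<^sup>+k. K k * (\<integral>\<^sup>+y. ennreal \<bar>f y\<bar> * I k d y \<partial>lebesgue) \<partial>count_space UNIV)"
    by (simp add: nn_integral_cmult)
  finally show ?thesis unfolding c_def K_def I_def .
qed

lemma dyadic_cube_subset_ball:
  fixes y :: "real ^ 'n"
  shows "{z. dyadic_index k z = dyadic_index k y} \<subseteq> ball y (3 * real CARD('n) * 2 powr real_of_int k)"
proof
  fix z assume "z \<in> {z. dyadic_index k z = dyadic_index k y}"
  then have "dyadic_index k z - dyadic_index k y \<in> unit_shifts" by (simp add: zero_in_unit_shifts)
  then show "z \<in> ball y (3 * real CARD('n) * 2 powr real_of_int k)"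
    by (rule dyadic_neighbour_subset_ball)
qed

lemma dyadic_index_surj: "\<exists>y :: real ^ 'n. dyadic_index k y = m"
proof -
  have "{y :: real ^ 'n. dyadic_index k y = m} \<noteq> {}"
  proof
    assume "{y :: real ^ 'n. dyadic_index k y = m} = {}"
    then have "emeasure lebesgue {y :: real ^ 'n. dyadic_index k y = m} = 0" by (simp only: emeasure_empty)
    then show False unfolding emeasure_dyadic_cube
      using zero_less_power[of "(2 :: real) powr real_of_int k" "CARD('n)"] by (auto simp: ennreal_eq_0_iff not_le[symmetric])
  qed
  then show ?thesis by blast
qed

lemma emeasure_lborel_ball:
  fixes x :: "real ^ 'n"
  assumes "0 \<le> r"
  shows "emeasure lborel (ball x r) = ennreal (unit_ball_vol (real CARD('n)) * r ^ CARD('n))"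
  using assms emeasure_ball[of r x] by simp

section \<open>Masses of balls and cubes under a pair of dual weights\<close>

locale dual_weights =
  fixes \<sigma> u :: "real ^ 'n \<Rightarrow> real" and \<theta> K :: real
  assumes sigma_measurable [measurable]: "\<sigma> \<in> borel_measurable lebesgue"
    and u_measurable [measurable]: "u \<in> borel_measurable lebesgue"
    and sigma_pos: "0 < \<sigma> x" and u_pos: "0 < u x"
    and dual: "\<sigma> x powr \<theta> * u x powr (1 - \<theta>) = 1"
    and theta: "0 < \<theta>" "\<theta> < 1" and K_pos: "0 < K"
    and A_condition: "0 < r \<Longrightarrow> ennreal_powr (emeasure (density lebesgue \<sigma>) (ball x r)) \<theta> *
      ennreal_powr (emeasure (density lebesgue u) (ball x r)) (1 - \<theta>) \<le> ennreal (K * r ^ CARD('n))"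
begin

abbreviation "S \<equiv> density lebesgue (\<lambda>x. ennreal (\<sigma> x))"
abbreviation "U \<equiv> density lebesgue (\<lambda>x. ennreal (u x))"

text \<open>By this symmetry each fact about masses is proved for \<open>S\<close> alone and
  transferred to \<open>U\<close>.\<close>

lemma dual_weights_swap: "dual_weights u \<sigma> (1 - \<theta>) K"
  using sigma_pos u_pos dual theta K_pos A_condition
  by unfold_locales (auto simp: mult.commute)

text \<open>The reverse of \<open>A_condition\<close>, for arbitrary measurable sets: Hoelder's
  inequality applied to the constant \<open>1 = \<sigma>^\<theta> u^(1-\<theta>)\<close>.\<close>

lemma emeasure_le_dual:
  assumes [measurable]: "E \<in> sets lebesgue"
  shows "emeasure lebesgue E \<le> ennreal_powr (emeasure S E) \<theta> * ennreal_powr (emeasure U E) (1 - \<theta>)"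
proof -
  have "emeasure lebesgue E = (\<integral>\<^sup>+x. ennreal_powr (ennreal (\<sigma> x) * indicator E x) \<theta>
     * ennreal_powr (ennreal (u x) * indicator E x) (1 - \<theta>) \<partial>lebesgue)"
  proof -
    have "ennreal_powr (ennreal (\<sigma> x) * indicator E x) \<theta>
     * ennreal_powr (ennreal (u x) * indicator E x) (1 - \<theta>) = indicator E x" for x
      using dual[of x] sigma_pos[of x] u_pos[of x]
      by (auto split: split_indicator simp: ennreal_powr_ennreal less_imp_le ennreal_mult[symmetric])
    then show ?thesis by simp
  qed
  also have "\<dots> \<le> ennreal_powr (\<integral>\<^sup>+x. ennreal (\<sigma> x) * indicator E x \<partial>lebesgue) \<theta>
     * ennreal_powr (\<integral>\<^sup>+x. ennreal (u x) * indicator E x \<partial>lebesgue) (1 - \<theta>)"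
    using theta by (intro Hoelder_nn_integral) auto
  finally show ?thesis by (simp add: emeasure_density)
qed

lemma emeasure_S_pos:
  assumes "E \<in> sets lebesgue" "0 < emeasure lebesgue E"
  shows "0 < emeasure S E"
proof (rule ccontr)
  assume "\<not> 0 < emeasure S E"
  then have "emeasure lebesgue E \<le> 0" using emeasure_le_dual[OF assms(1)] by simp
  then show False using assms(2) by simp
qed

lemma emeasure_S_ball_finite: "emeasure S (ball x r) < top"
proof (cases "0 < r")
  case True
  interpret swap: dual_weights u \<sigma> "1 - \<theta>" K by (rule dual_weights_swap)
  \<comment> \<open>Since the other mass is positive, an infinite \<open>S\<close> mass would make
    the product in \<open>A_condition\<close> infinite.\<close>
  have "0 < emeasure U (ball x r)"
    using True by (intro swap.emeasure_S_pos) (auto simp: emeasure_lborel_ball ennreal_less_zero_iff)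
  then show ?thesis
    using A_condition[OF True, of x] theta
    by (auto simp: less_top[symmetric] ennreal_top_mult top_unique split: if_splits)
qed (simp add: not_less ball_empty)

text \<open>Bound the volume of \<open>E\<close> by \<open>emeasure_le_dual\<close>, enlarge the
  \<open>U\<close> factor to the whole ball and cancel it by \<open>A_condition\<close>. This is the
  A-infinity property of the weight in quantitative form; doubling and lacunarity are both
  instances.\<close>

lemma emeasure_compare:
  assumes r: "0 < r" and E: "E \<in> sets lebesgue" "E \<subseteq> ball x r" and v: "0 < v" "ennreal (v * r ^ CARD('n)) \<le> emeasure lebesgue E"
  shows "emeasure S (ball x r) \<le> ennreal ((K / v) powr (1 / \<theta>)) * emeasure S E"
proof -
  have "ennreal (v * r ^ CARD('n)) * ennreal_powr (emeasure S (ball x r)) \<theta>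
     \<le> (ennreal_powr (emeasure S E) \<theta> * ennreal_powr (emeasure U (ball x r)) (1 - \<theta>)) * ennreal_powr (emeasure S (ball x r)) \<theta>"
  proof (intro mult_right_mono)
    have "ennreal_powr (emeasure U E) (1 - \<theta>) \<le> ennreal_powr (emeasure U (ball x r)) (1 - \<theta>)"
      using theta E by (intro ennreal_powr_mono emeasure_mono) auto
    then show "ennreal (v * r ^ CARD('n)) \<le> ennreal_powr (emeasure S E) \<theta> * ennreal_powr (emeasure U (ball x r)) (1 - \<theta>)"
      by (intro order_trans[OF v(2)] order_trans[OF emeasure_le_dual[OF E(1)]] mult_left_mono) auto
  qed simp
  also have "\<dots> \<le> ennreal_powr (emeasure S E) \<theta> * ennreal (K * r ^ CARD('n))"
    using mult_left_mono[OF A_condition[OF r, of x], of "ennreal_powr (emeasure S E) \<theta>"] by (simp add: mult_ac)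
  finally have le: "ennreal (v * r ^ CARD('n)) * ennreal_powr (emeasure S (ball x r)) \<theta>
     \<le> ennreal_powr (emeasure S E) \<theta> * ennreal (K * r ^ CARD('n))" .
  have "ennreal_powr (emeasure S (ball x r)) \<theta> = ennreal (1 / (v * r ^ CARD('n))) * (ennreal (v * r ^ CARD('n)) * ennreal_powr (emeasure S (ball x r)) \<theta>)"
    using v r by (simp add: mult.assoc[symmetric] ennreal_mult[symmetric])
  also have "\<dots> \<le> ennreal (1 / (v * r ^ CARD('n))) * (ennreal_powr (emeasure S E) \<theta> * ennreal (K * r ^ CARD('n)))"
    by (intro mult_left_mono le) simp
  also have "\<dots> = (ennreal (1 / (v * r ^ CARD('n))) * ennreal (K * r ^ CARD('n))) * ennreal_powr (emeasure S E) \<theta>"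
    by (simp add: mult_ac)
  also have "ennreal (1 / (v * r ^ CARD('n))) * ennreal (K * r ^ CARD('n)) = ennreal (K / v)"
    using v r K_pos by (simp add: ennreal_mult[symmetric])
  also have "ennreal (K / v) * ennreal_powr (emeasure S E) \<theta> = ennreal_powr (ennreal ((K / v) powr (1 / \<theta>)) * emeasure S E) \<theta>"
    using v K_pos theta by (simp add: ennreal_powr_mult ennreal_powr_ennreal powr_powr)
  finally show ?thesis by (simp add: ennreal_powr_le_iff theta)
qed

lemma doubling:
  obtains D where "0 < D" "\<And>x r. 0 < r \<Longrightarrow> emeasure S (ball x (2 * r)) \<le> ennreal D * emeasure S (ball x r)"
proof
  \<comment> \<open>The comparison is made in the ball of radius \<open>2 * r\<close>, so
    \<open>v\<close> is the volume of the inner ball divided by \<open>(2 * r) ^ n\<close>.\<close>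
  define v where "v = unit_ball_vol (real CARD('n)) / 2 ^ CARD('n)"
  have v: "0 < v" by (simp add: v_def)
  show "0 < (K / v) powr (1 / \<theta>)" using K_pos v by simp
  fix x :: "real ^ 'n" and r :: real assume r: "0 < r"
  show "emeasure S (ball x (2 * r)) \<le> ennreal ((K / v) powr (1 / \<theta>)) * emeasure S (ball x r)"
    using r v by (intro emeasure_compare) (auto simp: emeasure_lborel_ball v_def power_mult_distrib)
qed

text \<open>A parent cube without one child keeps at least half its volume, hence at least the share
  \<open>1 / \<Lambda>\<close> of its mass, and the child has at most the rest.\<close>

lemma dyadic_cube_lacunary:
  obtains \<eta> where "\<eta> < 1" "\<And>k y. measure S {z. dyadic_index k z = dyadic_index k y}
      \<le> \<eta> * measure S {z. dyadic_index (k + 1) z = dyadic_index (k + 1) y}"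
proof
  define r0 where "r0 = 3 * real CARD('n)"
  have r0: "0 < r0" by (simp add: r0_def)
  \<comment> \<open>Makes \<open>v * r ^ n\<close> half the volume of the parent cube, where
    \<open>ball y r\<close> is the ball containing it.\<close>
  define v where "v = 1 / (2 * r0 ^ CARD('n))"
  define \<Lambda> where "\<Lambda> = (K / v) powr (1 / \<theta>)"
  have v: "0 < v" using r0 by (simp add: v_def)
  have L: "0 < \<Lambda>" using K_pos v by (simp add: \<Lambda>_def)
  show "1 - 1 / \<Lambda> < 1" using L by simp
  fix k :: int and y :: "real ^ 'n"
  define Q where "Q = {z. dyadic_index k z = dyadic_index k y}"
  define Q' where "Q' = {z. dyadic_index (k + 1) z = dyadic_index (k + 1) y}"
  define r where "r = r0 * 2 powr real_of_int (k + 1)"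
  have [measurable]: "Q \<in> sets lebesgue" "Q' \<in> sets lebesgue" by (auto simp: Q_def Q'_def)
  have QQ': "Q \<subseteq> Q'" using dyadic_index_scale_Suc unfolding Q_def Q'_def by blast
  have Q'B: "Q' \<subseteq> ball y r" unfolding Q'_def r_def r0_def by (rule dyadic_cube_subset_ball)
  have r: "0 < r" using r0 by (simp add: r_def)
  have fin: "emeasure S X < top" if "X \<subseteq> Q'" for X
    using that Q'B by (intro le_less_trans[OF emeasure_mono emeasure_S_ball_finite[of y r]]) auto
  have "emeasure S (ball y r) \<le> ennreal \<Lambda> * emeasure S (Q' - Q)"
    unfolding \<Lambda>_def
  proof (rule emeasure_compare[OF r _ _ v])
    have "emeasure lebesgue (Q' - Q) = emeasure lebesgue Q' - emeasure lebesgue Q"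
      using QQ' by (intro emeasure_Diff) (auto simp: Q_def emeasure_dyadic_cube)
    also have "\<dots> = ennreal ((2 powr real_of_int (k + 1)) ^ CARD('n) - (2 powr real_of_int k) ^ CARD('n))"
      by (simp add: Q_def Q'_def emeasure_dyadic_cube ennreal_minus)
    finally have e: "emeasure lebesgue (Q' - Q) = \<dots>" .
    have "2 * (2 powr real_of_int k) ^ CARD('n) \<le> (2 :: real) ^ CARD('n) * (2 powr real_of_int k) ^ CARD('n)"
      using self_le_power[of "2 :: real" "CARD('n)"] by (intro mult_right_mono) auto
    also have "\<dots> = (2 powr real_of_int (k + 1)) ^ CARD('n)"
      by (simp add: powr_add power_mult_distrib)
    finally have "2 * (2 powr real_of_int k) ^ CARD('n) \<le> (2 powr real_of_int (k + 1)) ^ CARD('n)" .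
    moreover have "v * r ^ CARD('n) = (2 powr real_of_int (k + 1)) ^ CARD('n) / 2"
      using r0 by (simp add: v_def r_def power_mult_distrib)
    ultimately show "ennreal (v * r ^ CARD('n)) \<le> emeasure lebesgue (Q' - Q)"
      unfolding e by (intro ennreal_leI) linarith
  qed (use Q'B in auto)
  moreover have "emeasure S Q' \<le> emeasure S (ball y r)"
    using Q'B by (intro emeasure_mono) auto
  ultimately have "emeasure S Q' \<le> ennreal \<Lambda> * emeasure S (Q' - Q)" by (rule order_trans[rotated])
  moreover have "emeasure S Q' = ennreal (measure S Q')" "emeasure S (Q' - Q) = ennreal (measure S (Q' - Q))"
    using fin[of Q'] fin[of "Q' - Q"] by (auto intro!: emeasure_eq_ennreal_measure)
  ultimately have "ennreal (measure S Q') \<le> ennreal (\<Lambda> * measure S (Q' - Q))"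
    using L by (simp add: ennreal_mult)
  then have "measure S Q' \<le> \<Lambda> * measure S (Q' - Q)" using L by (simp add: ennreal_le_iff)
  also have "measure S (Q' - Q) = measure S Q' - measure S Q"
    using QQ' fin[of Q'] by (intro measure_Diff) auto
  finally have "measure S Q \<le> (1 - 1 / \<Lambda>) * measure S Q'"
    using L by (simp add: field_simps)
  then show "measure S {z. dyadic_index k z = dyadic_index k y}
      \<le> (1 - 1 / \<Lambda>) * measure S {z. dyadic_index (k + 1) z = dyadic_index (k + 1) y}"
    unfolding Q_def Q'_def .
qed

lemma lacunary_cubes_S:
  obtains \<eta> where "lacunary_cubes S dyadic_index \<eta>"
proof -
  obtain \<eta> where eta: "\<eta> < 1" "\<And>k y. measure S {z. dyadic_index k z = dyadic_index k y}
      \<le> \<eta> * measure S {z. dyadic_index (k + 1) z = dyadic_index (k + 1) y}"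
    using dyadic_cube_lacunary by blast
  have fin: "emeasure S {y. dyadic_index k y = i} < top" for k and i :: "int ^ 'n"
  proof -
    obtain y where "dyadic_index k y = i" using dyadic_index_surj by blast
    then have "{y. dyadic_index k y = i} \<subseteq> ball y (3 * real CARD('n) * 2 powr real_of_int k)"
      using dyadic_cube_subset_ball[of k y] by simp
    then have "emeasure S {y. dyadic_index k y = i} \<le> emeasure S (ball y (3 * real CARD('n) * 2 powr real_of_int k))"
      by (rule emeasure_mono) simp
    then show ?thesis using emeasure_S_ball_finite by (rule le_less_trans)
  qed
  have pos: "0 < measure S {y. dyadic_index k y = i}" for k and i :: "int ^ 'n"
    using emeasure_S_pos[of "{y. dyadic_index k y = i}"] fin[of k i]
    by (simp add: emeasure_dyadic_cube[simplified] measure_def enn2real_positive_iff)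
  show ?thesis
    by (rule that[of \<eta>]) (unfold_locales; use eta fin pos in simp)
qed

text \<open>With \<open>\<beta> = (n - \<alpha>)/n\<close>, \<open>rel\<close> says
  \<open>\<theta>\<beta> = 1 - 1/p\<close> and \<open>(1-\<theta>)\<beta> = 1/q\<close>. So
  \<open>A_condition\<close> raised to \<open>\<beta>\<close> bounds the kernel
  \<open>2^(k(\<alpha>-n))\<close> by just the product of masses that \<open>bilinear\<close> asks
  for, and duality reduces the norm to such a form.\<close>

lemma riesz_potential_bounded_unit:
  fixes \<alpha> p q :: real
  assumes a: "\<alpha> < real CARD('n)" and p: "1 < p" "p < q"
    and rel: "\<theta> * ((real CARD('n) - \<alpha>) / real CARD('n)) = 1 - 1 / p"
      "(1 - \<theta>) * ((real CARD('n) - \<alpha>) / real CARD('n)) = 1 / q"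
  obtains C where "0 \<le> C" "\<And>f. f \<in> borel_measurable lebesgue \<Longrightarrow>
    (\<integral>\<^sup>+x. ennreal (\<bar>f x\<bar> powr p * \<sigma> x powr (1 - p)) \<partial>lebesgue) \<le> 1 \<Longrightarrow>
    (\<integral>\<^sup>+x. ennreal_powr (riesz_potential \<alpha> f x) q * ennreal (u x) \<partial>lebesgue) \<le> ennreal C"
proof -
  interpret swap: dual_weights u \<sigma> "1 - \<theta>" K by (rule dual_weights_swap)
  obtain \<eta> where "lacunary_cubes S dyadic_index \<eta>" by (rule lacunary_cubes_S)
  moreover obtain \<eta>' where "lacunary_cubes U dyadic_index \<eta>'" by (rule swap.lacunary_cubes_S)
  ultimately interpret lacunary_cubes_pair S U dyadic_index \<eta> \<eta>'
    unfolding lacunary_cubes_pair_def by blast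
  define N where "N = real CARD('n)"
  define \<beta> where "\<beta> = (N - \<alpha>) / N"
  have N: "0 < N" by (simp add: N_def)
  have \<beta>: "0 < \<beta>" "N * \<beta> = N - \<alpha>" using a N by (auto simp: \<beta>_def N_def)
  \<comment> \<open>Any value strictly between works: \<open>p < s\<close> serves the
    \<open>S\<close> averages, and \<open>s < q\<close>, that is \<open>q' < s'\<close>, serves the
    \<open>U\<close> averages.\<close>
  define s where "s = (p + q) / 2"
  define s' where "s' = s / (s - 1)"
  define q' where "q' = q / (q - 1)"
  have s12: "p < s" "s < q" using p by (auto simp: s_def)
  then have s: "p < s" "s < q" "1 / s + 1 / s' = 1" using p by (auto simp: s'_def field_simps)
  have q': "1 < q'" "q' < s'" "1 / q + 1 / q' = 1"
    using p s(1,2) by (auto simp: q'_def s'_def field_simps)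
  define r0 where "r0 = 3 * real CARD('n)"
  have r0: "0 < r0" by (simp add: r0_def)
  define kap where "kap = (\<lambda>k::int. 2 powr (real_of_int k * (\<alpha> - real CARD('n))))"
  define C0 where "C0 = (K * r0 ^ CARD('n)) powr \<beta>"
  have kernel: "kap k \<le> C0 * (S.cube_meas k (i + d) powr (1 / p - 1) * U.cube_meas k i powr (1 / q' - 1))"
    if d: "d \<in> unit_shifts" for k d and i :: "int ^ 'n"
  proof -
    \<comment> \<open>One ball about \<open>y\<close> contains both neighbouring cubes, so a single
      instance of \<open>A_condition\<close> controls the product of their masses.\<close>
    obtain y where y: "dyadic_index k y = i" using dyadic_index_surj by blast
    define r where "r = r0 * 2 powr real_of_int k"
    have r: "0 < r" using r0 by (simp add: r_def)
    have sub1: "{z. dyadic_index k z = i + d} \<subseteq> ball y r"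
      using dyadic_neighbour_subset_ball[of k _ y] y d by (auto simp: r_def r0_def)
    have sub2: "{z. dyadic_index k z = i} \<subseteq> ball y r"
      using dyadic_cube_subset_ball[of k y] y by (auto simp: r_def r0_def)
    define a where "a = S.cube_meas k (i + d)"
    define b where "b = U.cube_meas k i"
    have ab: "0 < a" "0 < b" unfolding a_def b_def by (rule S.cube_pos U.cube_pos)+
    have "ennreal_powr (emeasure S {z. dyadic_index k z = i + d}) \<theta>
        * ennreal_powr (emeasure U {z. dyadic_index k z = i}) (1 - \<theta>)
      \<le> ennreal_powr (emeasure S (ball y r)) \<theta> * ennreal_powr (emeasure U (ball y r)) (1 - \<theta>)"
      using theta sub1 sub2 by (intro mult_mono ennreal_powr_mono emeasure_mono) auto
    also have "\<dots> \<le> ennreal (K * r ^ CARD('n))" by (rule A_condition[OF r])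
    also have "emeasure S {z. dyadic_index k z = i + d} = ennreal a"
      using S.cube_finite[of k "i + d"] unfolding a_def by (intro emeasure_eq_ennreal_measure) auto
    also have "emeasure U {z. dyadic_index k z = i} = ennreal b"
      using U.cube_finite[of k i] unfolding b_def by (intro emeasure_eq_ennreal_measure) auto
    finally have "a powr \<theta> * b powr (1 - \<theta>) \<le> K * r ^ CARD('n)"
      using ab K_pos r by (simp add: ennreal_powr_ennreal ennreal_mult[symmetric])
    then have "(a powr \<theta> * b powr (1 - \<theta>)) powr \<beta> \<le> (K * r ^ CARD('n)) powr \<beta>"
      using \<beta> by (intro powr_mono2) auto
    also have "(a powr \<theta> * b powr (1 - \<theta>)) powr \<beta> = a powr (1 - 1 / p) * b powr (1 / q)"
      using rel unfolding \<beta>_def N_def by (simp add: powr_mult powr_powr)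
    also have "(K * r ^ CARD('n)) powr \<beta> = C0 * 2 powr (real_of_int k * (N - \<alpha>))"
    proof -
      have "r ^ CARD('n) = r0 ^ CARD('n) * 2 powr (real_of_int k * N)"
        using powr_realpow[of "2 powr real_of_int k" "CARD('n)"]
        by (simp add: r_def power_mult_distrib powr_powr N_def)
      then show ?thesis
        using K_pos r0 \<beta>(2) by (simp add: C0_def powr_mult powr_powr mult.assoc)
    qed
    finally have le: "a powr (1 - 1 / p) * b powr (1 / q) \<le> C0 * 2 powr (real_of_int k * (N - \<alpha>))" .
    have e: "1 / q' - 1 = - (1 / q)" "1 / p - 1 = - (1 - 1 / p)" "real_of_int k * (\<alpha> - N) = - (real_of_int k * (N - \<alpha>))"
      using q'(3) by (auto simp: algebra_simps)
    show ?thesis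
      using le ab unfolding a_def[symmetric] b_def[symmetric] kap_def N_def[symmetric] e
      by (simp only: powr_minus) (simp add: field_simps)
  qed
  define C1 where "C1 = 2 powr (real CARD('n) - \<alpha>) * (real (card (unit_shifts :: (int ^ 'n) set))
    * (C0 * (max 0 (S.embedding_const p s) + max 0 (U.embedding_const q' s'))))"
  have C0: "0 \<le> C0" by (simp add: C0_def)
  have C1: "0 \<le> C1" using C0 by (simp add: C1_def)
  show ?thesis
  proof (rule that[of "C1 powr q"])
    show "0 \<le> C1 powr q" by simp
    fix f :: "real ^ 'n \<Rightarrow> real"
    assume f [measurable]: "f \<in> borel_measurable lebesgue"
      and f1: "(\<integral>\<^sup>+x. ennreal (\<bar>f x\<bar> powr p * \<sigma> x powr (1 - p)) \<partial>lebesgue) \<le> 1"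
    \<comment> \<open>Dividing by \<open>\<sigma>\<close> turns Lebesgue integrals of
      \<open>f\<close> over cubes into \<open>S\<close> integrals of \<open>g\<close>, and the
      assumed integral into that of \<open>g x powr p\<close> against \<open>S\<close>.\<close>
    define g where "g = (\<lambda>x. \<bar>f x\<bar> / \<sigma> x)"
    have [measurable]: "g \<in> borel_measurable lebesgue" unfolding g_def by measurable
    have g0: "0 \<le> g x" for x using sigma_pos[of x] by (simp add: g_def)
    have sg: "ennreal (\<sigma> x) * ennreal (g x) = ennreal \<bar>f x\<bar>" for x
      using sigma_pos[of x] g0[of x] by (simp add: ennreal_mult[symmetric] g_def)
    have "(\<integral>\<^sup>+x. ennreal (g x powr p) \<partial>S) = (\<integral>\<^sup>+x. ennreal (\<sigma> x) * ennreal (g x powr p) \<partial>lebesgue)"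
      by (rule nn_integral_density) auto
    also have "\<dots> = (\<integral>\<^sup>+x. ennreal (\<bar>f x\<bar> powr p * \<sigma> x powr (1 - p)) \<partial>lebesgue)"
    proof (intro nn_integral_cong)
      fix x
      have "\<sigma> x * g x powr p = \<bar>f x\<bar> powr p * \<sigma> x powr (1 - p)"
        using sigma_pos[of x] by (simp add: g_def powr_divide powr_diff)
      then show "ennreal (\<sigma> x) * ennreal (g x powr p) = ennreal (\<bar>f x\<bar> powr p * \<sigma> x powr (1 - p))"
        using sigma_pos[of x] by (simp add: ennreal_mult[symmetric])
    qed
    finally have g1: "(\<integral>\<^sup>+x. ennreal (g x powr p) \<partial>S) \<le> 1" using f1 by simp
    have cube: "(\<integral>\<^sup>+y. ennreal \<bar>f y\<bar> * indicator {y. dyadic_index k y = i} y \<partial>lebesgue) = S.cube_int g k i" for k i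
      unfolding S.cube_int_def by (subst nn_integral_density) (auto simp: sg[symmetric] mult_ac)
    have "(\<integral>\<^sup>+x. ennreal_powr (riesz_potential \<alpha> f x) q \<partial>U) \<le> ennreal (C1 powr q)"
    proof (rule nn_integral_powr_le_by_duality[where E = "\<lambda>n. ball 0 (real n)" and q' = q'])
      show "riesz_potential \<alpha> f \<in> borel_measurable U" by measurable
      show "incseq (\<lambda>n. ball 0 (real n) :: (real ^ 'n) set)" by (auto simp: incseq_def)
      have "\<exists>n. norm x < real n" for x :: "real ^ 'n" by (rule reals_Archimedean2)
      then show "(\<Union>n. ball 0 (real n)) = space U" by auto
      show "emeasure U (ball 0 (real n)) < \<infinity>" for n using swap.emeasure_S_ball_finite[of 0 "real n"] by simp
      fix h :: "real ^ 'n \<Rightarrow> real"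
      assume h: "h \<in> borel_measurable U" "\<And>x. 0 \<le> h x" "(\<integral>\<^sup>+x. ennreal (h x powr q') \<partial>U) \<le> 1"
      then have [measurable]: "h \<in> borel_measurable lebesgue" by simp
      let ?T = "\<lambda>x. \<Sum>d\<in>unit_shifts. \<integral>\<^sup>+k. ennreal (kap k) * S.cube_int g k (dyadic_index k x + d) \<partial>count_space UNIV"
      have [measurable]: "(\<lambda>x. S.cube_int g k (dyadic_index k x + d)) \<in> borel_measurable lebesgue" for k d
      proof -
        have "dyadic_index k \<in> measurable (lebesgue :: (real ^ 'n) measure) (count_space UNIV)"
          by (subst measurable_count_space_eq_countable) (auto simp: vimage_def)
        then show ?thesis by (rule measurable_compose) simp
      qed
      have "(\<integral>\<^sup>+x. ennreal (h x) * riesz_potential \<alpha> f x \<partial>U)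
        \<le> (\<integral>\<^sup>+x. ennreal (2 powr (real CARD('n) - \<alpha>)) * (ennreal (h x) * ?T x) \<partial>U)"
      proof (intro nn_integral_mono)
        fix x
        have "riesz_potential \<alpha> f x \<le> ennreal (2 powr (real CARD('n) - \<alpha>)) * ?T x"
          using riesz_potential_le_dyadic_sum[OF f a, of x] unfolding cube kap_def .
        then have "ennreal (h x) * riesz_potential \<alpha> f x \<le> ennreal (h x) * (ennreal (2 powr (real CARD('n) - \<alpha>)) * ?T x)"
          by (intro mult_left_mono) auto
        then show "ennreal (h x) * riesz_potential \<alpha> f x
            \<le> ennreal (2 powr (real CARD('n) - \<alpha>)) * (ennreal (h x) * ?T x)"
          by (simp only: mult.left_commute)
      qed
      also have "\<dots> = ennreal (2 powr (real CARD('n) - \<alpha>)) * (\<integral>\<^sup>+x. ennreal (h x) * ?T x \<partial>U)"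
        by (rule nn_integral_cmult) measurable
      also have "\<dots> \<le> ennreal (2 powr (real CARD('n) - \<alpha>)) * ennreal (real (card (unit_shifts :: (int ^ 'n) set))
         * (C0 * (max 0 (S.embedding_const p s) + max 0 (U.embedding_const q' s'))))"
        using g0 g1 h p s q' kernel C0 finite_unit_shifts
        by (intro mult_left_mono bilinear) auto
      also have "\<dots> = ennreal C1" using C0 by (simp add: C1_def ennreal_mult[symmetric])
      finally show "(\<integral>\<^sup>+x. ennreal (h x) * riesz_potential \<alpha> f x \<partial>U) \<le> ennreal C1" .
    qed (use p q' C1 in auto)
    then show "(\<integral>\<^sup>+x. ennreal_powr (riesz_potential \<alpha> f x) q * ennreal (u x) \<partial>lebesgue) \<le> ennreal (C1 powr q)"
      by (subst (asm) nn_integral_density) (auto simp: mult.commute)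
  qed
qed

end

lemma riesz_potential_cong_AE:
  "(AE y in lebesgue. \<bar>f y\<bar> = \<bar>g y\<bar>) \<Longrightarrow> riesz_potential \<alpha> f x = riesz_potential \<alpha> g x"
  unfolding riesz_potential_def by (intro nn_integral_cong_AE) (auto elim: eventually_mono)

lemma riesz_potential_cmult:
  assumes [measurable]: "f \<in> borel_measurable lebesgue" and "0 \<le> c"
  shows "riesz_potential \<alpha> (\<lambda>y. c * f y) x = ennreal c * riesz_potential \<alpha> f x"
proof -
  have "riesz_potential \<alpha> (\<lambda>y. c * f y) x
     = (\<integral>\<^sup>+y. ennreal c * ennreal (\<bar>f y\<bar> / norm (x - y) powr (real CARD('a) - \<alpha>)) \<partial>lebesgue)"
    unfolding riesz_potential_def using assms(2)
    by (intro nn_integral_cong) (simp add: abs_mult ennreal_mult[symmetric])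
  also have "\<dots> = ennreal c * riesz_potential \<alpha> f x"
    unfolding riesz_potential_def by (rule nn_integral_cmult) measurable
  finally show ?thesis .
qed

section \<open>The class \<open>A_{p,q}\<close> as a condition on dual weights\<close>

locale fractional_weight =
  fixes \<alpha> p q :: real and w :: "real ^ 'n \<Rightarrow> real"
  assumes alpha: "0 < \<alpha>" "\<alpha> < real CARD('n)"
    and p: "1 < p" "p < real CARD('n) / \<alpha>"
    and q_eq: "1 / q = 1 / p - \<alpha> / real CARD('n)"
    and w_class: "w \<in> A_class p q"
begin

text \<open>Equal to \<open>1 + 1/q - 1/p\<close>, the power of the volume in
  \<open>A_class\<close>.\<close>

definition "\<beta> = (real CARD('n) - \<alpha>) / real CARD('n)"
text \<open>A positive representative of \<open>w\<close>, which is itself positive only almost everywhere.\<close>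

definition "w1 x = (if 0 < w x then w x else 1)"
definition "sig x = w1 x powr (- (p / (p - 1)))"
definition "u x = w1 x powr q"
text \<open>The power of the \<open>S\<close> mass once the \<open>A_class\<close> inequality is
  raised to \<open>1 / \<beta>\<close>; the power of the \<open>U\<close> mass is then
  \<open>1 - \<theta>\<close>.\<close>

definition "\<theta> = (1 - 1 / p) / \<beta>"

abbreviation "U \<equiv> density lebesgue (\<lambda>x. ennreal (u x))"
abbreviation "S \<equiv> density lebesgue (\<lambda>x. ennreal (sig x))"

lemma w_measurable [measurable]: "w \<in> borel_measurable lebesgue"
  using w_class by (simp add: A_class_def weight_def)

lemma w1_measurable [measurable]: "w1 \<in> borel_measurable lebesgue"
  unfolding w1_def by measurable

lemma w1_pos: "0 < w1 x" by (simp add: w1_def)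

lemma w_eq_w1: "AE x in lebesgue. w x = w1 x \<and> 0 < w x"
  using w_class by (auto simp: A_class_def weight_def w1_def elim: eventually_mono)

lemma sig_measurable [measurable]: "sig \<in> borel_measurable lebesgue"
  and u_measurable [measurable]: "u \<in> borel_measurable lebesgue"
  unfolding sig_def u_def by measurable

lemma p_less_q: "p < q" and q_gt_1: "1 < q"
proof -
  have "\<alpha> / real CARD('n) < 1 / p" using p alpha by (simp add: field_simps)
  then have q: "0 < q" using q_eq by (metis diff_gt_0_iff_gt zero_less_divide_1_iff)
  have "1 / q < 1 / p" using q_eq alpha by simp
  then show "p < q" using q p by (simp add: field_simps)
  then show "1 < q" using p by simp
qed

lemma beta_pos: "0 < \<beta>"
  using alpha by (simp add: \<beta>_def)

lemma beta_eq: "\<beta> = 1 + 1 / q - 1 / p" "\<beta> = 1 - 1 / p + 1 / q" "\<beta> * real CARD('n) = real CARD('n) - \<alpha>"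
  unfolding q_eq \<beta>_def by (auto simp: field_simps)

lemma theta: "0 < \<theta>" "\<theta> < 1" "1 - \<theta> = (1 / q) / \<beta>" "\<theta> * \<beta> = 1 - 1 / p" "(1 - \<theta>) * \<beta> = 1 / q"
proof -
  show "0 < \<theta>" using p beta_pos by (simp add: \<theta>_def)
  show 1: "\<theta> * \<beta> = 1 - 1 / p" using beta_pos by (simp add: \<theta>_def)
  show 2: "(1 - \<theta>) * \<beta> = 1 / q" using 1 beta_eq(2) left_diff_distrib[of 1 \<theta> \<beta>] by linarith
  show 3: "1 - \<theta> = (1 / q) / \<beta>" unfolding 2[symmetric] using beta_pos by simp
  have "0 < 1 - \<theta>" unfolding 3 using beta_pos q_gt_1 by simp
  then show "\<theta> < 1" by simp
qed

lemma Lnorm_w: 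
  assumes [measurable]: "A \<in> sets lebesgue"
  shows "Lnorm q A w = ennreal_powr (emeasure U A) (1 / q)"
proof -
  have "(\<integral>\<^sup>+y\<in>A. ennreal (\<bar>w y\<bar> powr q * 1) \<partial>lebesgue) = (\<integral>\<^sup>+y. ennreal (u y) * indicator A y \<partial>lebesgue)"
    using w_eq_w1 by (intro nn_integral_cong_AE) (auto elim!: eventually_mono simp: u_def abs_of_pos[OF w1_pos])
  then show ?thesis by (simp add: wnorm_def emeasure_density)
qed

lemma Lnorm_inverse_w: 
  assumes [measurable]: "A \<in> sets lebesgue"
  shows "Lnorm (p / (p - 1)) A (\<lambda>y. inverse (w y)) = ennreal_powr (emeasure S A) (1 - 1 / p)"
proof -
  have "(\<integral>\<^sup>+y\<in>A. ennreal (\<bar>inverse (w y)\<bar> powr (p / (p - 1)) * 1) \<partial>lebesgue)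
      = (\<integral>\<^sup>+y. ennreal (sig y) * indicator A y \<partial>lebesgue)"
    using w_eq_w1
  proof (intro nn_integral_cong_AE, elim eventually_mono)
    fix y assume y: "w y = w1 y \<and> 0 < w y"
    then have "\<bar>inverse (w y)\<bar> powr (p / (p - 1)) = sig y"
      by (simp add: sig_def powr_minus inverse_powr)
    then show "ennreal (\<bar>inverse (w y)\<bar> powr (p / (p - 1)) * 1) * indicator A y = ennreal (sig y) * indicator A y"
      by simp
  qed
  moreover have "1 / (p / (p - 1)) = 1 - 1 / p" using p by (simp add: field_simps)
  ultimately show ?thesis by (simp add: wnorm_def emeasure_density)
qed

lemma A_condition_measures:
  obtains c where "0 < c" "\<And>x r. 0 < r \<Longrightarrow> ennreal_powr (emeasure U (ball x r)) (1 / q)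
    * ennreal_powr (emeasure S (ball x r)) (1 - 1 / p) \<le> ennreal (c * r powr (real CARD('n) - \<alpha>))"
proof -
  obtain c where c: "1 < c" "\<And>x r. 0 < r \<Longrightarrow>
        Lnorm q (ball x r) w * Lnorm (p / (p - 1)) (ball x r) (\<lambda>y. inverse (w y))
          \<le> ennreal (c * measure lebesgue (ball x r) powr (1 + 1 / q - 1 / p))"
    using w_class unfolding A_class_def by blast
  define v where "v = unit_ball_vol (real CARD('n))"
  have v: "0 < v" by (simp add: v_def)
  show ?thesis
  proof (rule that[of "c * v powr \<beta>"])
    show "0 < c * v powr \<beta>" using c(1) v by simp
    fix x :: "real ^ 'n" and r :: real assume r: "0 < r"
    have "measure lebesgue (ball x r) = v * r powr (real CARD('n))"
      using r v by (simp add: measure_def emeasure_lborel_ball v_def powr_realpow)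
    then have "measure lebesgue (ball x r) powr \<beta> = v powr \<beta> * r powr (real CARD('n) - \<alpha>)"
      using v r beta_eq(3) by (simp add: powr_mult powr_powr mult.commute)
    then show "ennreal_powr (emeasure U (ball x r)) (1 / q)
        * ennreal_powr (emeasure S (ball x r)) (1 - 1 / p) \<le> ennreal (c * v powr \<beta> * r powr (real CARD('n) - \<alpha>))"
      using c(2)[OF r, of x] unfolding beta_eq(1)[symmetric] by (simp add: Lnorm_w Lnorm_inverse_w mult.assoc)
  qed
qed

text \<open>Raising to \<open>1 / \<beta>\<close> leaves the volume to the first power. The weights
  are dual because \<open>p' (1 - 1/p) = 1 = q (1/q)\<close>: \<open>w1\<close> enters
  \<open>sig^\<theta>\<close> with exponent \<open>-1/\<beta>\<close> and
  \<open>u^(1-\<theta>)\<close> with \<open>1/\<beta>\<close>.\<close>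

lemma dual_weights_sig_u:
  obtains K where "dual_weights sig u \<theta> K"
proof -
  obtain c where c: "0 < c" "\<And>x r. 0 < r \<Longrightarrow> ennreal_powr (emeasure U (ball x r)) (1 / q)
    * ennreal_powr (emeasure S (ball x r)) (1 - 1 / p) \<le> ennreal (c * r powr (real CARD('n) - \<alpha>))"
    using A_condition_measures by blast
  show ?thesis
  proof (rule that[of "c powr (1 / \<beta>)"], unfold_locales)
    fix x :: "real ^ 'n"
    show "0 < sig x" "0 < u x" using w1_pos[of x] by (auto simp: sig_def u_def)
    have "- (p / (p - 1)) * \<theta> + q * (1 - \<theta>) = 0"
    proof -
      have "p / (p - 1) * (1 - 1 / p) = 1" using p(1) by (simp add: field_simps)
      then have "- (p / (p - 1)) * \<theta> = - 1 / \<beta>"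
        unfolding \<theta>_def by (simp only: times_divide_eq_right minus_mult_left[symmetric])
      moreover have "q * (1 - \<theta>) = 1 / \<beta>" using q_gt_1 by (simp add: theta(3))
      ultimately show ?thesis by simp
    qed
    moreover have "sig x powr \<theta> * u x powr (1 - \<theta>) = w1 x powr (- (p / (p - 1)) * \<theta> + q * (1 - \<theta>))"
      by (simp only: sig_def u_def powr_powr powr_add)
    ultimately show "sig x powr \<theta> * u x powr (1 - \<theta>) = 1" using w1_pos[of x] by simp
    fix r :: real assume r: "0 < r"
    have e: "(real CARD('n) - \<alpha>) * (1 / \<beta>) = real CARD('n)" "(1 / q) * (1 / \<beta>) = 1 - \<theta>" "(1 - 1 / p) * (1 / \<beta>) = \<theta>"
      using beta_pos theta(3) by (auto simp: beta_eq(3)[symmetric]) (simp add: \<theta>_def)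
    have "ennreal_powr (ennreal_powr (emeasure U (ball x r)) (1 / q)
        * ennreal_powr (emeasure S (ball x r)) (1 - 1 / p)) (1 / \<beta>)
       \<le> ennreal_powr (ennreal (c * r powr (real CARD('n) - \<alpha>))) (1 / \<beta>)"
      using beta_pos by (intro ennreal_powr_mono c(2) r) auto
    also have "ennreal_powr (ennreal_powr (emeasure U (ball x r)) (1 / q)
        * ennreal_powr (emeasure S (ball x r)) (1 - 1 / p)) (1 / \<beta>)
       = ennreal_powr (emeasure S (ball x r)) \<theta> * ennreal_powr (emeasure U (ball x r)) (1 - \<theta>)"
      by (simp only: ennreal_powr_mult ennreal_powr_powr e mult.commute)
    also have "ennreal_powr (ennreal (c * r powr (real CARD('n) - \<alpha>))) (1 / \<beta>)
       = ennreal (c powr (1 / \<beta>) * r ^ CARD('n))"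
      using c(1) r e(1) by (simp add: ennreal_powr_ennreal powr_mult powr_powr powr_realpow)
    finally show "ennreal_powr (emeasure S (ball x r)) \<theta> * ennreal_powr (emeasure U (ball x r)) (1 - \<theta>)
        \<le> ennreal (c powr (1 / \<beta>) * r ^ CARD('n))" .
  qed (use theta c(1) in auto)
qed

lemma Lnorm_ball:
  assumes "0 < r"
  shows "0 < Lnorm q (ball x r) w" "Lnorm q (ball x r) w < top"
proof -
  obtain K where "dual_weights sig u \<theta> K" by (rule dual_weights_sig_u)
  then interpret dw: dual_weights sig u \<theta> K .
  interpret swap: dual_weights u sig "1 - \<theta>" K by (rule dw.dual_weights_swap)
  have "0 < emeasure U (ball x r)"
    using assms by (intro swap.emeasure_S_pos) (auto simp: emeasure_lborel_ball ennreal_less_zero_iff)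
  then show "0 < Lnorm q (ball x r) w" by (simp add: Lnorm_w zero_less_iff_neq_zero)
  show "Lnorm q (ball x r) w < top"
    using swap.emeasure_S_ball_finite[of x r] by (simp add: Lnorm_w)
qed

lemma Lnorm_doubling:
  obtains D where "0 < D" "\<And>x r. 0 < r \<Longrightarrow> Lnorm q (ball x (2 * r)) w \<le> ennreal D * Lnorm q (ball x r) w"
proof -
  obtain K where "dual_weights sig u \<theta> K" by (rule dual_weights_sig_u)
  then interpret dw: dual_weights sig u \<theta> K .
  interpret swap: dual_weights u sig "1 - \<theta>" K by (rule dw.dual_weights_swap)
  obtain D where D: "0 < D" "\<And>x r. 0 < r \<Longrightarrow> emeasure U (ball x (2 * r)) \<le> ennreal D * emeasure U (ball x r)"
    using swap.doubling by blast
  show ?thesis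
  proof (rule that[of "D powr (1 / q)"])
    show "0 < D powr (1 / q)" using D by simp
    fix x :: "real ^ 'n" and r :: real assume "0 < r"
    then have "ennreal_powr (emeasure U (ball x (2 * r))) (1 / q) \<le> ennreal_powr (ennreal D * emeasure U (ball x r)) (1 / q)"
      using q_gt_1 by (intro ennreal_powr_mono D) auto
    then show "Lnorm q (ball x (2 * r)) w \<le> ennreal (D powr (1 / q)) * Lnorm q (ball x r) w"
      using D by (simp add: Lnorm_w ennreal_powr_mult ennreal_powr_ennreal)
  qed
qed

section \<open>Weighted norm inequality and integrals over balls\<close>

definition fnorm :: "(real ^ 'n \<Rightarrow> real) \<Rightarrow> (real ^ 'n) set \<Rightarrow> ennreal" where
  "fnorm f A = wnorm p (\<lambda>x. w x powr p) A f"

text \<open>The norm of the potential in \<open>L^q(w^q)\<close>. \<open>wnorm\<close> takes real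
  functions only, and here the potential may still be infinite.\<close>

definition potential_norm :: "(real ^ 'n \<Rightarrow> real) \<Rightarrow> (real ^ 'n) set \<Rightarrow> ennreal" where
  "potential_norm f A = ennreal_powr (\<integral>\<^sup>+x. ennreal_powr (riesz_potential \<alpha> f x) q * ennreal (u x) * indicator A x \<partial>lebesgue) (1 / q)"

lemma fnorm_eq:
  "fnorm f A = ennreal_powr (\<integral>\<^sup>+x. ennreal (\<bar>f x\<bar> powr p * w1 x powr p) * indicator A x \<partial>lebesgue) (1 / p)"
  unfolding fnorm_def wnorm_def using w_eq_w1
  by (intro arg_cong2[where f = ennreal_powr] nn_integral_cong_AE) (auto elim: eventually_mono)

lemma fnorm_mono: "A \<subseteq> B \<Longrightarrow> fnorm f A \<le> fnorm f B"
  unfolding fnorm_eq using p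
  by (intro ennreal_powr_mono nn_integral_mono) (auto split: split_indicator)

lemma riesz_potential_bounded:
  obtains C where "0 < C"
    "\<And>f. f \<in> borel_measurable lebesgue \<Longrightarrow> potential_norm f UNIV \<le> ennreal C * fnorm f UNIV"
proof -
  obtain K where "dual_weights sig u \<theta> K" by (rule dual_weights_sig_u)
  then interpret dw: dual_weights sig u \<theta> K .
  obtain C where C: "0 \<le> C" "\<And>f. f \<in> borel_measurable lebesgue \<Longrightarrow>
    (\<integral>\<^sup>+x. ennreal (\<bar>f x\<bar> powr p * sig x powr (1 - p)) \<partial>lebesgue) \<le> 1 \<Longrightarrow>
    (\<integral>\<^sup>+x. ennreal_powr (riesz_potential \<alpha> f x) q * ennreal (u x) \<partial>lebesgue) \<le> ennreal C"
    using dw.riesz_potential_bounded_unit[OF alpha(2) p(1) p_less_q] theta(4,5) unfolding \<beta>_def by blast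
  have sig_w1: "sig x powr (1 - p) = w1 x powr p" for x
  proof -
    have "- (p / (p - 1)) * (1 - p) = p" using p by (simp add: field_simps)
    then show ?thesis by (simp only: sig_def powr_powr)
  qed
  \<comment> \<open>The summand 1 makes \<open>C'\<close> positive, so that the bound stays infinite
    when the norm of \<open>f\<close> is.\<close>
  define C' where "C' = (C + 1) powr (1 / q)"
  show ?thesis
  proof (rule that[of C'])
    show "0 < C'" using C(1) by (simp add: C'_def)
    fix f :: "real ^ 'n \<Rightarrow> real"
    assume f [measurable]: "f \<in> borel_measurable lebesgue"
    consider (zero) "fnorm f UNIV = 0" | (top) "fnorm f UNIV = top" | (real) b where "fnorm f UNIV = ennreal b" "0 < b"
      by (cases "fnorm f UNIV") (auto simp: less_le)
    then show "potential_norm f UNIV \<le> ennreal C' * fnorm f UNIV"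
    proof cases
      case zero
      then have "AE x in lebesgue. ennreal (\<bar>f x\<bar> powr p * w1 x powr p) = 0"
        by (simp add: fnorm_eq nn_integral_0_iff_AE)
      then have "AE x in lebesgue. \<bar>f x\<bar> = \<bar>0\<bar>"
        using w1_pos by (auto elim!: eventually_mono simp: ennreal_eq_0_iff mult_le_0_iff powr_gt_zero less_le)
      then have "riesz_potential \<alpha> f x = riesz_potential \<alpha> (\<lambda>_. 0) x" for x
        by (rule riesz_potential_cong_AE)
      then show ?thesis by (simp add: potential_norm_def riesz_potential_def)
    next
      case top
      then show ?thesis using \<open>0 < C'\<close> by (simp add: ennreal_mult_top)
    next
      case (real b)
      define g where "g = (\<lambda>x. (1 / b) * f x)"
      have [measurable]: "g \<in> borel_measurable lebesgue" unfolding g_def by measurable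
      have I: "(\<integral>\<^sup>+x. ennreal (\<bar>f x\<bar> powr p * w1 x powr p) \<partial>lebesgue) = ennreal (b powr p)"
      proof -
        have "ennreal_powr (fnorm f UNIV) p = (\<integral>\<^sup>+x. ennreal (\<bar>f x\<bar> powr p * w1 x powr p) \<partial>lebesgue)"
          using p by (simp add: fnorm_eq ennreal_powr_powr)
        then show ?thesis using real by (simp add: ennreal_powr_ennreal)
      qed
      have "(\<integral>\<^sup>+x. ennreal (\<bar>g x\<bar> powr p * sig x powr (1 - p)) \<partial>lebesgue)
         = (\<integral>\<^sup>+x. ennreal ((1 / b) powr p) * ennreal (\<bar>f x\<bar> powr p * w1 x powr p) \<partial>lebesgue)"
        using real unfolding sig_w1 g_def abs_mult
        by (intro nn_integral_cong) (simp add: powr_mult ennreal_mult[symmetric] powr_divide)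
      also have "\<dots> = ennreal ((1 / b) powr p) * ennreal (b powr p)"
        by (subst nn_integral_cmult) (auto simp: I)
      also have "\<dots> = 1" using real by (simp add: ennreal_mult[symmetric] powr_divide)
      finally have "(\<integral>\<^sup>+x. ennreal_powr (riesz_potential \<alpha> g x) q * ennreal (u x) \<partial>lebesgue) \<le> ennreal C"
        by (intro C) auto
      also have "\<dots> \<le> ennreal (C + 1)" by (intro ennreal_leI) simp
      finally have gC: "(\<integral>\<^sup>+x. ennreal_powr (riesz_potential \<alpha> g x) q * ennreal (u x) \<partial>lebesgue) \<le> ennreal (C + 1)" .
      have fg: "f = (\<lambda>x. b * g x)" using real by (auto simp: g_def)
      have "potential_norm f UNIV = ennreal_powr (\<integral>\<^sup>+x. ennreal (b powr q) *
         (ennreal_powr (riesz_potential \<alpha> g x) q * ennreal (u x)) \<partial>lebesgue) (1 / q)"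
        unfolding potential_norm_def fg using real
        by (simp add: riesz_potential_cmult ennreal_powr_mult ennreal_powr_ennreal mult_ac)
      also have "\<dots> = ennreal_powr (ennreal (b powr q) * (\<integral>\<^sup>+x.
         ennreal_powr (riesz_potential \<alpha> g x) q * ennreal (u x) \<partial>lebesgue)) (1 / q)"
        by (subst nn_integral_cmult) auto
      also have "\<dots> \<le> ennreal_powr (ennreal (b powr q) * ennreal (C + 1)) (1 / q)"
        using q_gt_1 by (intro ennreal_powr_mono mult_left_mono gC) auto
      also have "\<dots> = ennreal C' * fnorm f UNIV"
      proof -
        have "ennreal_powr (ennreal (C + 1)) (1 / q) = ennreal C'"
          unfolding C'_def using C(1) by (intro ennreal_powr_ennreal) simp
        then show ?thesis
          using real q_gt_1 by (simp only: ennreal_powr_mult) (simp add: ennreal_powr_ennreal powr_powr mult.commute)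
      qed
      finally show ?thesis .
    qed
  qed
qed

text \<open>Hoelder's inequality for \<open>|f| w\<close> and \<open>1/w\<close> produces the
  \<open>S\<close> mass of the ball, which the \<open>A_class\<close> condition trades for
  \<open>r^(n-\<alpha>)\<close> over the norm of \<open>w\<close>. That power of \<open>r\<close>
  later cancels the kernel on dyadic annuli.\<close>

lemma nn_integral_ball_le:
  obtains C where "0 < C"
    "\<And>f x r. f \<in> borel_measurable lebesgue \<Longrightarrow> 0 < r \<Longrightarrow>
      (\<integral>\<^sup>+y. ennreal \<bar>f y\<bar> * indicator (ball x r) y \<partial>lebesgue)
      \<le> ennreal (C * r powr (real CARD('n) - \<alpha>)) * (fnorm f (ball x r) / Lnorm q (ball x r) w)"
proof -
  obtain c where c: "0 < c" "\<And>x r. 0 < r \<Longrightarrow> ennreal_powr (emeasure U (ball x r)) (1 / q)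
    * ennreal_powr (emeasure S (ball x r)) (1 - 1 / p) \<le> ennreal (c * r powr (real CARD('n) - \<alpha>))"
    using A_condition_measures by blast
  show ?thesis
  proof (rule that[OF c(1)])
    fix f :: "real ^ 'n \<Rightarrow> real" and x :: "real ^ 'n" and r :: real
    assume [measurable]: "f \<in> borel_measurable lebesgue" and r: "0 < r"
    let ?B = "ball x r"
    have "(\<integral>\<^sup>+y. ennreal \<bar>f y\<bar> * indicator ?B y \<partial>lebesgue)
      = (\<integral>\<^sup>+y. ennreal_powr (ennreal (\<bar>f y\<bar> powr p * w1 y powr p) * indicator ?B y) (1 / p)
         * ennreal_powr (ennreal (sig y) * indicator ?B y) (1 - 1 / p) \<partial>lebesgue)"
    proof (intro nn_integral_cong)
      fix y
      have "(\<bar>f y\<bar> powr p * w1 y powr p) powr (1 / p) * sig y powr (1 - 1 / p) = \<bar>f y\<bar>"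
      proof -
        have "- (p / (p - 1)) * (1 - 1 / p) = - 1" using p by (simp add: field_simps)
        then have "sig y powr (1 - 1 / p) = w1 y powr (- 1)" by (simp only: sig_def powr_powr)
        then show ?thesis
          using p w1_pos[of y] by (simp add: powr_mult powr_powr powr_minus field_simps)
      qed
      then show "ennreal \<bar>f y\<bar> * indicator ?B y = ennreal_powr (ennreal (\<bar>f y\<bar> powr p * w1 y powr p) * indicator ?B y) (1 / p)
         * ennreal_powr (ennreal (sig y) * indicator ?B y) (1 - 1 / p)"
        by (auto split: split_indicator simp: ennreal_powr_ennreal ennreal_mult[symmetric] sig_def)
    qed
    also have "\<dots> \<le> fnorm f ?B * ennreal_powr (emeasure S ?B) (1 - 1 / p)"
    proof -
      have [measurable]: "?B \<in> sets lebesgue" by simp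
      have S: "emeasure S ?B = (\<integral>\<^sup>+y. ennreal (sig y) * indicator ?B y \<partial>lebesgue)"
        by (rule emeasure_density) measurable
      show ?thesis
        unfolding fnorm_eq S
      proof (rule Hoelder_nn_integral)
        show "0 < 1 / p" "1 / p < 1" using p(1) by auto
      qed measurable
    qed
    finally have le: "(\<integral>\<^sup>+y. ennreal \<bar>f y\<bar> * indicator ?B y \<partial>lebesgue)
       \<le> fnorm f ?B * ennreal_powr (emeasure S ?B) (1 - 1 / p)" .
    obtain n where n: "Lnorm q ?B w = ennreal n" "0 < n"
      using Lnorm_ball[OF r, of x] by (cases "Lnorm q ?B w") auto
    have n': "ennreal n * ennreal (1 / n) = 1" using n by (simp add: ennreal_mult[symmetric])
    have "fnorm f ?B * ennreal_powr (emeasure S ?B) (1 - 1 / p)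
       = fnorm f ?B * ennreal (1 / n) * (ennreal n * ennreal_powr (emeasure S ?B) (1 - 1 / p))"
    proof -
      have "fnorm f ?B * ennreal (1 / n) * (ennreal n * ennreal_powr (emeasure S ?B) (1 - 1 / p))
         = (ennreal n * ennreal (1 / n)) * (fnorm f ?B * ennreal_powr (emeasure S ?B) (1 - 1 / p))"
        by (simp only: mult_ac)
      then show ?thesis by (simp only: n' mult_1)
    qed
    also have "\<dots> \<le> fnorm f ?B * ennreal (1 / n) * ennreal (c * r powr (real CARD('n) - \<alpha>))"
      using c(2)[OF r, of x] n(1) by (intro mult_left_mono) (auto simp: Lnorm_w)
    finally show "(\<integral>\<^sup>+y. ennreal \<bar>f y\<bar> * indicator ?B y \<partial>lebesgue)
      \<le> ennreal (c * r powr (real CARD('n) - \<alpha>)) * (fnorm f ?B / Lnorm q ?B w)"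
      using le n by (simp add: divide_ennreal_def inverse_ennreal mult_ac inverse_eq_divide)
  qed
qed

end

section \<open>Local estimate\<close>

lemma ennreal_le_mult_of_divide_le:
  fixes a c :: ennreal
  assumes "a / ennreal b \<le> c" "0 < b"
  shows "a \<le> c * ennreal b"
proof -
  have "a = a * (ennreal (1 / b) * ennreal b)"
    using assms(2) by (simp add: ennreal_mult[symmetric])
  also have "\<dots> = a / ennreal b * ennreal b"
    using assms(2) by (simp add: divide_ennreal_def inverse_ennreal inverse_eq_divide mult.assoc)
  also have "\<dots> \<le> c * ennreal b"
    using assms(1) by (intro mult_right_mono) auto
  finally show ?thesis .
qed

lemma ennreal_divide_le_of_le_mult:
  fixes a c :: ennreal
  assumes "a \<le> c * ennreal b" "0 < b"
  shows "a / ennreal b \<le> c"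
  using assms by (intro divide_le_posI_ennreal) (auto simp: mult.commute)

lemma ennreal_tendsto_0I:
  fixes f :: "'a \<Rightarrow> ennreal"
  assumes "\<And>e :: real. 0 < e \<Longrightarrow> eventually (\<lambda>x. f x \<le> ennreal e) F"
  shows "(f \<longlongrightarrow> 0) F"
proof (rule order_tendstoI)
  fix a :: ennreal assume "0 < a"
  then obtain b where b: "0 < b" "b < a" using dense by blast
  then obtain e where e: "b = ennreal e" "0 < e"
    by (cases b) (auto simp: ennreal_less_zero_iff top.extremum_strict)
  from assms[OF e(2)] show "eventually (\<lambda>x. f x < a) F"
    using b e by (auto elim!: eventually_mono intro: le_less_trans)
qed simp

lemma dyadic_annulus_exists:
  fixes d r :: real
  assumes "0 < r" "r \<le> d"
  obtains j :: nat where "2 ^ j * r \<le> d" "d < 2 ^ (j + 1) * r"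
proof -
  obtain n0 :: nat where n0: "d / r < 2 ^ n0" using real_arch_pow[of 2 "d / r"] by auto
  define n where "n = (LEAST n :: nat. d / r < 2 ^ n)"
  have n: "d / r < 2 ^ n" unfolding n_def by (rule LeastI[of _ n0]) (rule n0)
  have "n \<noteq> 0" using n assms by (cases "n = 0") (auto simp: field_simps)
  then obtain j where j: "n = Suc j" by (cases n) auto
  have "\<not> d / r < 2 ^ j" using not_less_Least[of j "\<lambda>n. d / r < 2 ^ n"] j n_def by auto
  then show ?thesis using that[of j] n j assms by (simp add: field_simps)
qed

text \<open>For \<open>y\<close> outside \<open>ball x (2 * r)\<close> the distance to
  \<open>x'\<close> is at least half that to \<open>x\<close>, hence the \<open>/ 2\<close>. The
  annuli are enlarged to balls because norms over balls are what is controlled later.\<close>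

lemma riesz_potential_far:
  fixes f :: "real ^ 'n \<Rightarrow> real"
  assumes [measurable]: "f \<in> borel_measurable lebesgue" and a: "\<alpha> < real CARD('n)"
    and r: "0 < r" and x': "x' \<in> ball x r" and zero: "\<And>y. y \<in> ball x (2 * r) \<Longrightarrow> f y = 0"
  shows "riesz_potential \<alpha> f x' \<le> (\<Sum>j. ennreal (1 / (2 ^ j * r / 2) powr (real CARD('n) - \<alpha>)) *
    (\<integral>\<^sup>+y. ennreal \<bar>f y\<bar> * indicator (ball x (2 ^ (j + 1) * r)) y \<partial>lebesgue))"
proof -
  let ?c = "\<lambda>j. ennreal (1 / (2 ^ j * r / 2) powr (real CARD('n) - \<alpha>))"
  let ?t = "\<lambda>j y. ?c j * (ennreal \<bar>f y\<bar> * indicator (ball x (2 ^ (j + 1) * r)) y)"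
  have [measurable]: "ball x s \<in> sets lebesgue" for s by simp
  have m0: "(\<lambda>y. ennreal \<bar>f y\<bar> * indicator (ball x s) y) \<in> borel_measurable lebesgue" for s
    by measurable
  then have m: "?t j \<in> borel_measurable lebesgue" for j
    by (rule borel_measurable_times_ennreal[OF borel_measurable_const])
  have "riesz_potential \<alpha> f x' \<le> (\<integral>\<^sup>+y. (\<Sum>j. ?t j y) \<partial>lebesgue)"
    unfolding riesz_potential_def
  proof (intro nn_integral_mono)
    fix y
    show "ennreal (\<bar>f y\<bar> / norm (x' - y) powr (real CARD('n) - \<alpha>)) \<le> (\<Sum>j. ?t j y)"
    proof (cases "y \<in> ball x (2 * r)")
      case False
      then have d: "2 * r \<le> dist x y" by simp
      then have "r \<le> dist x y" using r by simp
      then obtain j where j: "2 ^ j * r \<le> dist x y" "dist x y < 2 ^ (j + 1) * r"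
        using dyadic_annulus_exists r by blast
      have "dist x y \<le> dist x x' + dist x' y" by (rule dist_triangle)
      then have "2 ^ j * r / 2 \<le> norm (x' - y)"
        using j(1) d x' by (simp add: dist_norm)
      then have "\<bar>f y\<bar> / norm (x' - y) powr (real CARD('n) - \<alpha>) \<le> \<bar>f y\<bar> / (2 ^ j * r / 2) powr (real CARD('n) - \<alpha>)"
      proof (intro divide_left_mono powr_mono2 mult_pos_pos)
        have "0 < 2 ^ j * r / 2" using r by simp
        then show "0 < (2 ^ j * r / 2) powr (real CARD('n) - \<alpha>)" "0 \<le> 2 ^ j * r / 2"
          "0 < norm (x' - y) powr (real CARD('n) - \<alpha>)"
          using \<open>2 ^ j * r / 2 \<le> norm (x' - y)\<close> by (simp_all only: powr_gt_zero)
      qed (use a \<open>2 ^ j * r / 2 \<le> norm (x' - y)\<close> in auto)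
      then have "ennreal (\<bar>f y\<bar> / norm (x' - y) powr (real CARD('n) - \<alpha>)) \<le> ?t j y"
        using j(2) by (simp add: ennreal_mult[symmetric] ennreal_leI)
      also have "\<dots> \<le> (\<Sum>j. ?t j y)"
        using sum_le_suminf[of "\<lambda>j. ?t j y" "{j}"] by simp
      finally show ?thesis .
    qed (simp add: zero)
  qed
  also have "\<dots> = (\<Sum>j. \<integral>\<^sup>+y. ?t j y \<partial>lebesgue)"
    by (rule nn_integral_suminf) (rule m)
  also have "\<dots> = (\<Sum>j. ?c j * (\<integral>\<^sup>+y. ennreal \<bar>f y\<bar> * indicator (ball x (2 ^ (j + 1) * r)) y \<partial>lebesgue))"
    by (intro arg_cong[where f = suminf] ext nn_integral_cmult m0)
  finally show ?thesis .
qed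

context fractional_weight
begin

definition ratio :: "(real ^ 'n \<Rightarrow> real) \<Rightarrow> real ^ 'n \<Rightarrow> real \<Rightarrow> ennreal" where
  "ratio f x t = fnorm f (ball x t) / Lnorm q (ball x t) w"

lemma Lnorm_ball_real:
  assumes "0 < r" obtains n where "Lnorm q (ball x r) w = ennreal n" "0 < n"
  using Lnorm_ball[OF assms, of x] by (cases "Lnorm q (ball x r) w") auto

lemma Lnorm_mono: "r \<le> t \<Longrightarrow> Lnorm q (ball x r) w \<le> Lnorm q (ball x t) w"
  using q_gt_1 by (simp add: Lnorm_w) (intro ennreal_powr_mono emeasure_mono subset_ball, auto)

lemma ratio_mult_Lnorm: "0 < t \<Longrightarrow> ratio f x t * Lnorm q (ball x t) w = fnorm f (ball x t)"
proof -
  assume "0 < t"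
  then obtain n where n: "Lnorm q (ball x t) w = ennreal n" "0 < n" by (rule Lnorm_ball_real)
  then show ?thesis
    by (simp add: ratio_def divide_ennreal_def inverse_ennreal mult.assoc ennreal_mult[symmetric])
qed

text \<open>The near part obeys the weighted inequality on the whole space; doubling moves the norm
  of \<open>w\<close> to the smaller ball, and the result is part of the term \<open>j = 0\<close>.
  The far part is at most a constant on the ball, so its norm is at most that constant times the
  norm of \<open>w\<close>.\<close>

lemma potential_norm_ball_le:
  obtains C where "0 < C" "\<And>f x r. f \<in> borel_measurable lebesgue \<Longrightarrow> 0 < r \<Longrightarrow>
    potential_norm f (ball x r) \<le> ennreal C * (Lnorm q (ball x r) w * (\<Sum>j. ratio f x (2 ^ (j + 1) * r)))"
proof -
  obtain C1 where C1: "0 < C1"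
    "\<And>f. f \<in> borel_measurable lebesgue \<Longrightarrow> potential_norm f UNIV \<le> ennreal C1 * fnorm f UNIV"
    using riesz_potential_bounded by blast
  obtain C2 where C2: "0 < C2"
    "\<And>f x r. f \<in> borel_measurable lebesgue \<Longrightarrow> 0 < r \<Longrightarrow>
      (\<integral>\<^sup>+y. ennreal \<bar>f y\<bar> * indicator (ball x r) y \<partial>lebesgue)
      \<le> ennreal (C2 * r powr (real CARD('n) - \<alpha>)) * (fnorm f (ball x r) / Lnorm q (ball x r) w)"
    using nn_integral_ball_le by blast
  obtain D where D: "0 < D" "\<And>x r. 0 < r \<Longrightarrow> Lnorm q (ball x (2 * r)) w \<le> ennreal D * Lnorm q (ball x r) w"
    using Lnorm_doubling by blast
  \<comment> \<open>The kernel is evaluated at \<open>2 ^ j * r / 2\<close>, a quarter of the radius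
    \<open>2 ^ (j + 1) * r\<close> of the ball in the same term.\<close>
  define C3 where "C3 = C2 * 4 powr (real CARD('n) - \<alpha>)"
  define C4 where "C4 = C1 * D + C3"
  define C where "C = (2 powr q * 2) powr (1 / q) * C4"
  have C3: "0 < C3" using C2 by (simp add: C3_def)
  have "0 < C1 * D" using C1(1) D(1) by simp
  then have C4: "0 < C4" "C1 * D \<le> C4" "C3 \<le> C4" using C3 by (auto simp: C4_def)
  show ?thesis
  proof (rule that[of C])
    show "0 < C" using C4 by (simp add: C_def)
    fix f :: "real ^ 'n \<Rightarrow> real" and x :: "real ^ 'n" and r :: real
    assume f [measurable]: "f \<in> borel_measurable lebesgue" and r: "0 < r"
    define B where "B = ball x r"
    have [measurable]: "B \<in> sets lebesgue" "ball x (2 * r) \<in> sets lebesgue" by (auto simp: B_def)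
    define \<Sigma> where "\<Sigma> = (\<Sum>j. ratio f x (2 ^ (j + 1) * r))"
    define L where "L = Lnorm q B w"
    define X where "X = ennreal C4 * (L * \<Sigma>)"
    define f1 where "f1 = (\<lambda>y. f y * indicator (ball x (2 * r)) y)"
    define f2 where "f2 = (\<lambda>y. f y * indicator (- ball x (2 * r)) y)"
    have [measurable]: "f1 \<in> borel_measurable lebesgue" "f2 \<in> borel_measurable lebesgue"
      unfolding f1_def f2_def by measurable
    have split: "riesz_potential \<alpha> f y = riesz_potential \<alpha> f1 y + riesz_potential \<alpha> f2 y" for y
    proof -
      have "riesz_potential \<alpha> f y = (\<integral>\<^sup>+z. ennreal (\<bar>f1 z\<bar> / norm (y - z) powr (real CARD('n) - \<alpha>))
         + ennreal (\<bar>f2 z\<bar> / norm (y - z) powr (real CARD('n) - \<alpha>)) \<partial>lebesgue)"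
        unfolding riesz_potential_def by (intro nn_integral_cong) (auto simp: f1_def f2_def split: split_indicator)
      then show ?thesis unfolding riesz_potential_def by (simp add: nn_integral_add)
    qed
    have near: "(\<integral>\<^sup>+y. ennreal_powr (riesz_potential \<alpha> f1 y) q * ennreal (u y) * indicator B y \<partial>lebesgue) \<le> ennreal_powr X q"
    proof -
      have "fnorm f1 UNIV = fnorm f (ball x (2 * r))"
        unfolding fnorm_eq f1_def using p
        by (intro arg_cong2[where f = ennreal_powr] nn_integral_cong) (auto split: split_indicator)
      also have "\<dots> = ratio f x (2 * r) * Lnorm q (ball x (2 * r)) w"
        using r by (simp add: ratio_mult_Lnorm)
      also have "\<dots> \<le> \<Sigma> * (ennreal D * L)"
      proof (intro mult_mono)
        show "ratio f x (2 * r) \<le> \<Sigma>"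
          using sum_le_suminf[of "\<lambda>j. ratio f x (2 ^ (j + 1) * r)" "{0}"] by (simp add: \<Sigma>_def)
        show "Lnorm q (ball x (2 * r)) w \<le> ennreal D * L" unfolding L_def B_def by (rule D(2)[OF r])
      qed auto
      finally have F: "fnorm f1 UNIV \<le> \<Sigma> * (ennreal D * L)" .
      have "potential_norm f1 UNIV \<le> ennreal C1 * fnorm f1 UNIV" by (rule C1) measurable
      also have "\<dots> \<le> ennreal C1 * (\<Sigma> * (ennreal D * L))" by (intro mult_left_mono F) simp
      also have "\<dots> = ennreal (C1 * D) * (L * \<Sigma>)" using C1 D by (simp add: ennreal_mult mult_ac)
      also have "\<dots> \<le> X" unfolding X_def by (intro mult_right_mono ennreal_leI C4) simp
      finally have "ennreal_powr (potential_norm f1 UNIV) q \<le> ennreal_powr X q"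
        using q_gt_1 by (intro ennreal_powr_mono) auto
      moreover have "ennreal_powr (potential_norm f1 UNIV) q = (\<integral>\<^sup>+y. ennreal_powr (riesz_potential \<alpha> f1 y) q * ennreal (u y) \<partial>lebesgue)"
        using q_gt_1 by (simp add: potential_norm_def ennreal_powr_powr)
      moreover have "(\<integral>\<^sup>+y. ennreal_powr (riesz_potential \<alpha> f1 y) q * ennreal (u y) * indicator B y \<partial>lebesgue)
         \<le> (\<integral>\<^sup>+y. ennreal_powr (riesz_potential \<alpha> f1 y) q * ennreal (u y) \<partial>lebesgue)"
        by (intro nn_integral_mono) (auto split: split_indicator)
      ultimately show ?thesis by simp
    qed
    have far: "(\<integral>\<^sup>+y. ennreal_powr (riesz_potential \<alpha> f2 y) q * ennreal (u y) * indicator B y \<partial>lebesgue) \<le> ennreal_powr X q"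
    proof -
      have pt: "riesz_potential \<alpha> f2 y \<le> ennreal C4 * \<Sigma>" if y: "y \<in> B" for y
      proof -
        have "riesz_potential \<alpha> f2 y \<le> (\<Sum>j. ennreal (1 / (2 ^ j * r / 2) powr (real CARD('n) - \<alpha>)) *
            (\<integral>\<^sup>+z. ennreal \<bar>f2 z\<bar> * indicator (ball x (2 ^ (j + 1) * r)) z \<partial>lebesgue))"
          using y r alpha(2) by (intro riesz_potential_far) (auto simp: f2_def B_def)
        also have "\<dots> \<le> (\<Sum>j. ennreal C3 * ratio f x (2 ^ (j + 1) * r))"
        proof (intro suminf_le)
          fix j
          define R where "R = 2 ^ (j + 1) * r"
          have R: "0 < R" using r by (simp add: R_def)
          have "(\<integral>\<^sup>+z. ennreal \<bar>f2 z\<bar> * indicator (ball x R) z \<partial>lebesgue)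
             \<le> (\<integral>\<^sup>+z. ennreal \<bar>f z\<bar> * indicator (ball x R) z \<partial>lebesgue)"
            by (intro nn_integral_mono) (auto simp: f2_def split: split_indicator)
          also have "\<dots> \<le> ennreal (C2 * R powr (real CARD('n) - \<alpha>)) * ratio f x R"
            unfolding ratio_def by (rule C2(2)[OF f R])
          finally have "ennreal (1 / (R / 4) powr (real CARD('n) - \<alpha>)) * (\<integral>\<^sup>+z. ennreal \<bar>f2 z\<bar> * indicator (ball x R) z \<partial>lebesgue)
            \<le> ennreal (1 / (R / 4) powr (real CARD('n) - \<alpha>)) * (ennreal (C2 * R powr (real CARD('n) - \<alpha>)) * ratio f x R)"
            by (intro mult_left_mono) auto
          also have "\<dots> = ennreal C3 * ratio f x R"
          proof -
            have "1 / (R / 4) powr (real CARD('n) - \<alpha>) * (C2 * R powr (real CARD('n) - \<alpha>)) = C3"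
              using R by (simp add: C3_def powr_divide)
            then show ?thesis
              using C2(1) by (simp add: mult.assoc[symmetric] ennreal_mult[symmetric])
          qed
          finally show "ennreal (1 / (2 ^ j * r / 2) powr (real CARD('n) - \<alpha>)) *
            (\<integral>\<^sup>+z. ennreal \<bar>f2 z\<bar> * indicator (ball x (2 ^ (j + 1) * r)) z \<partial>lebesgue)
            \<le> ennreal C3 * ratio f x (2 ^ (j + 1) * r)"
            by (simp add: R_def mult_ac)
        qed auto
        also have "\<dots> = ennreal C3 * \<Sigma>" by (simp add: \<Sigma>_def)
        also have "\<dots> \<le> ennreal C4 * \<Sigma>" by (intro mult_right_mono ennreal_leI C4) simp
        finally show ?thesis .
      qed
      have "(\<integral>\<^sup>+y. ennreal_powr (riesz_potential \<alpha> f2 y) q * ennreal (u y) * indicator B y \<partial>lebesgue)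
         \<le> (\<integral>\<^sup>+y. ennreal_powr (ennreal C4 * \<Sigma>) q * (ennreal (u y) * indicator B y) \<partial>lebesgue)"
        using pt q_gt_1 by (intro nn_integral_mono)
          (auto split: split_indicator intro!: mult_right_mono ennreal_powr_mono)
      also have "\<dots> = ennreal_powr (ennreal C4 * \<Sigma>) q * emeasure U B"
        by (simp add: nn_integral_cmult emeasure_density)
      also have "emeasure U B = ennreal_powr L q"
        using q_gt_1 by (simp add: L_def Lnorm_w ennreal_powr_powr)
      also have "ennreal_powr (ennreal C4 * \<Sigma>) q * ennreal_powr L q = ennreal_powr X q"
        by (simp add: X_def ennreal_powr_mult mult_ac)
      finally show ?thesis .
    qed
    have "(\<integral>\<^sup>+y. ennreal_powr (riesz_potential \<alpha> f y) q * ennreal (u y) * indicator B y \<partial>lebesgue)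
       \<le> (\<integral>\<^sup>+y. ennreal (2 powr q) * (ennreal_powr (riesz_potential \<alpha> f1 y) q * ennreal (u y) * indicator B y
          + ennreal_powr (riesz_potential \<alpha> f2 y) q * ennreal (u y) * indicator B y) \<partial>lebesgue)"
    proof (intro nn_integral_mono)
      fix y
      have "ennreal_powr (riesz_potential \<alpha> f y) q
         \<le> ennreal (2 powr q) * (ennreal_powr (riesz_potential \<alpha> f1 y) q + ennreal_powr (riesz_potential \<alpha> f2 y) q)"
        unfolding split using q_gt_1 by (intro ennreal_powr_add_le) auto
      then have "ennreal_powr (riesz_potential \<alpha> f y) q * (ennreal (u y) * indicator B y)
         \<le> ennreal (2 powr q) * (ennreal_powr (riesz_potential \<alpha> f1 y) q + ennreal_powr (riesz_potential \<alpha> f2 y) q)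
           * (ennreal (u y) * indicator B y)"
        by (intro mult_right_mono) auto
      then show "ennreal_powr (riesz_potential \<alpha> f y) q * ennreal (u y) * indicator B y
        \<le> ennreal (2 powr q) * (ennreal_powr (riesz_potential \<alpha> f1 y) q * ennreal (u y) * indicator B y
          + ennreal_powr (riesz_potential \<alpha> f2 y) q * ennreal (u y) * indicator B y)"
        by (simp add: algebra_simps)
    qed
    also have "\<dots> = ennreal (2 powr q) * ((\<integral>\<^sup>+y. ennreal_powr (riesz_potential \<alpha> f1 y) q * ennreal (u y) * indicator B y \<partial>lebesgue)
          + (\<integral>\<^sup>+y. ennreal_powr (riesz_potential \<alpha> f2 y) q * ennreal (u y) * indicator B y \<partial>lebesgue))"
      by (simp add: nn_integral_cmult nn_integral_add)
    also have "\<dots> \<le> ennreal (2 powr q) * (ennreal_powr X q + ennreal_powr X q)"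
      by (intro mult_left_mono add_mono near far) auto
    also have "\<dots> = ennreal (2 powr q * 2) * ennreal_powr X q"
      by (simp add: ennreal_mult mult_2[symmetric] mult_ac)
    finally have "potential_norm f B \<le> ennreal_powr (ennreal (2 powr q * 2) * ennreal_powr X q) (1 / q)"
      unfolding potential_norm_def using q_gt_1 by (intro ennreal_powr_mono) auto
    also have "\<dots> = ennreal ((2 powr q * 2) powr (1 / q)) * X"
      using q_gt_1 by (simp only: ennreal_powr_mult ennreal_powr_powr)
        (simp add: ennreal_powr_ennreal del: ennreal_mult)
    also have "\<dots> = ennreal C * (L * \<Sigma>)"
      using C4 by (simp add: X_def C_def ennreal_mult mult.assoc)
    finally show "potential_norm f (ball x r) \<le> ennreal C * (Lnorm q (ball x r) w * (\<Sum>j. ratio f x (2 ^ (j + 1) * r)))"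
      unfolding L_def \<Sigma>_def B_def .
  qed
qed

text \<open>For \<open>t\<close> in \<open>{R<..2 * R}\<close> with
  \<open>R = 2 ^ (j + 1) * r\<close>, monotonicity for \<open>f\<close> and doubling for
  \<open>w\<close> bound \<open>ratio f x R / (2 * R)\<close> by \<open>D * M\<close> times the
  integrand; the interval has length \<open>R\<close>, whence the 2. The set \<open>A\<close> and
  the lower limit \<open>\<rho>\<close> permit a separate constant \<open>M\<close> for a part of
  the scales.\<close>

lemma sum_ratio_le:
  fixes A :: "nat set"
  assumes D: "0 < D" "\<And>x r. 0 < r \<Longrightarrow> Lnorm q (ball x (2 * r)) w \<le> ennreal D * Lnorm q (ball x r) w"
    and r: "0 < r" and M: "0 \<le> M" and rho: "\<And>j. j \<in> A \<Longrightarrow> \<rho> \<le> 2 ^ (j + 1) * r"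
    and fM: "\<And>j t. j \<in> A \<Longrightarrow> 2 ^ (j + 1) * r < t \<Longrightarrow> t \<le> 2 ^ (j + 2) * r \<Longrightarrow>
      fnorm f (ball x t) \<le> ennreal M * ennreal (\<Phi> t)"
    and \<Phi>: "\<And>t. 0 \<le> \<Phi> t"
  shows "(\<Sum>j. ratio f x (2 ^ (j + 1) * r) * indicator A j) \<le> ennreal (2 * D * M) *
    (\<integral>\<^sup>+t\<in>{\<rho><..}. ennreal (\<Phi> t) / Lnorm q (ball x t) w / ennreal t \<partial>lebesgue)"
proof -
  define R where "R = (\<lambda>j::nat. 2 ^ (j + 1) * r)"
  have R: "0 < R j" for j using r by (simp add: R_def)
  have R_mono: "2 * R i \<le> R j" if "i < j" for i j
  proof -
    have "(2::real) ^ (i + 2) \<le> 2 ^ (j + 1)" using that by (intro power_increasing) auto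
    then have "2 ^ (i + 2) * r \<le> 2 ^ (j + 1) * r" using r by (intro mult_right_mono) auto
    then show ?thesis by (simp add: R_def)
  qed
  define a where "a = (\<lambda>j. ratio f x (R j) * indicator A j * ennreal (1 / (2 * R j)))"
  define I where "I = (\<lambda>j. {R j<..2 * R j})"
  define h where "h = (\<lambda>t. ennreal (\<Phi> t) / Lnorm q (ball x t) w / ennreal t * indicator {\<rho><..} t)"
  have le: "a j \<le> ennreal (D * M) * h t" if t: "t \<in> I j" for j t
  proof (cases "j \<in> A")
    case True
    have t': "R j < t" "t \<le> 2 * R j" "0 < t" using t R[of j] by (auto simp: I_def)
    obtain n where n: "Lnorm q (ball x (R j)) w = ennreal n" "0 < n" using Lnorm_ball_real[OF R] by blast
    obtain m where m: "Lnorm q (ball x t) w = ennreal m" "0 < m" using Lnorm_ball_real[OF t'(3)] by blast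
    have "Lnorm q (ball x t) w \<le> Lnorm q (ball x (2 * R j)) w" using t' by (intro Lnorm_mono) auto
    also have "\<dots> \<le> ennreal D * Lnorm q (ball x (R j)) w" by (rule D(2)[OF R])
    finally have mn: "m \<le> D * n" using n m D by (simp add: ennreal_mult[symmetric])
    have "fnorm f (ball x (R j)) \<le> fnorm f (ball x t)" using t' by (intro fnorm_mono subset_ball) auto
    also have "\<dots> \<le> ennreal M * ennreal (\<Phi> t)" using True t' by (intro fM) (auto simp: R_def)
    finally have F: "fnorm f (ball x (R j)) \<le> ennreal (M * \<Phi> t)" using M \<Phi> by (simp add: ennreal_mult)
    have "a j = fnorm f (ball x (R j)) * ennreal (1 / n * (1 / (2 * R j)))"
      using True n R[of j] by (simp add: a_def ratio_def divide_ennreal_def inverse_ennreal inverse_eq_divide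
          ennreal_mult[symmetric] mult.assoc)
    also have "\<dots> \<le> ennreal (M * \<Phi> t) * ennreal (1 / n * (1 / (2 * R j)))" by (intro mult_right_mono F) simp
    also have "\<dots> = ennreal (M * \<Phi> t * (1 / n * (1 / (2 * R j))))"
      using M \<Phi> n R[of j] by (simp add: ennreal_mult[symmetric])
    also have "\<dots> \<le> ennreal (D * M * (\<Phi> t / m / t))"
    proof (intro ennreal_leI)
      have "1 / n \<le> D / m" using mn n m by (simp add: field_simps)
      moreover have "1 / (2 * R j) \<le> 1 / t" using t' R[of j] by (simp add: field_simps)
      ultimately have "1 / n * (1 / (2 * R j)) \<le> D / m * (1 / t)"
        using D m R[of j] by (intro mult_mono) auto
      then have "M * \<Phi> t * (1 / n * (1 / (2 * R j))) \<le> M * \<Phi> t * (D / m * (1 / t))"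
        using M \<Phi> by (intro mult_left_mono) auto
      then show "M * \<Phi> t * (1 / n * (1 / (2 * R j))) \<le> D * M * (\<Phi> t / m / t)" by (simp add: mult_ac)
    qed
    also have "\<dots> = ennreal (D * M) * ennreal (\<Phi> t / m / t)"
      using D M m t' \<Phi>[of t] by (intro ennreal_mult) auto
    also have "ennreal (\<Phi> t / m / t) = h t"
      using rho[OF True] t' m \<Phi>[of t] by (simp add: h_def R_def divide_ennreal)
    finally show ?thesis .
  qed (simp add: a_def)
  \<comment> \<open>A measurable step function between the sum and the integral, because
    \<open>\<Phi>\<close> need not be measurable.\<close>
  define s where "s = (\<lambda>t. \<Sum>j. a j * indicator (I j) t)"
  have [measurable]: "I j \<in> sets lebesgue" for j by (simp add: I_def)
  have [measurable]: "s \<in> borel_measurable lebesgue" unfolding s_def by measurable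
  have s_le: "s t \<le> ennreal (D * M) * h t" for t
  proof (cases "\<exists>j. t \<in> I j")
    case True
    then obtain j where j: "t \<in> I j" by blast
    have uniq: "i = j" if i: "t \<in> I i" for i
    proof (rule ccontr)
      assume "i \<noteq> j"
      then have "2 * R i \<le> R j \<or> 2 * R j \<le> R i" using R_mono by (meson linorder_neqE_nat)
      then show False using i j unfolding I_def greaterThanAtMost_iff by linarith
    qed
    have "(\<lambda>i. a i * indicator (I i) t) = (\<lambda>i. if i = j then a i else 0)"
    proof
      fix i show "a i * indicator (I i) t = (if i = j then a i else 0)"
        using j uniq[of i] by (cases "t \<in> I i") auto
    qed
    then have "s t = a j" unfolding s_def using sums_unique[OF sums_single[of j a]] by simp
    then show ?thesis using le[OF j] by simp
  qed (simp add: s_def)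
  have "(\<integral>\<^sup>+t. s t \<partial>lebesgue) = (\<Sum>j. a j * ennreal (R j))"
  proof -
    have "(\<integral>\<^sup>+t. s t \<partial>lebesgue) = (\<Sum>j. \<integral>\<^sup>+t. a j * indicator (I j) t \<partial>lebesgue)"
      unfolding s_def by (rule nn_integral_suminf) measurable
    also have "\<dots> = (\<Sum>j. a j * ennreal (R j))"
    proof (intro arg_cong[where f = suminf] ext)
      fix j
      have "emeasure lebesgue (I j) = ennreal (R j)"
        using R[of j] by (simp add: I_def)
      then show "(\<integral>\<^sup>+t. a j * indicator (I j) t \<partial>lebesgue) = a j * ennreal (R j)"
        by (subst nn_integral_cmult_indicator) auto
    qed
    finally show ?thesis .
  qed
  also have "\<dots> = (\<Sum>j. ennreal (1 / 2) * (ratio f x (R j) * indicator A j))"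
  proof (intro arg_cong[where f = suminf] ext)
    fix j
    have "ennreal (1 / (2 * R j)) * ennreal (R j) = ennreal (1 / 2)"
      using R[of j] by (simp add: ennreal_mult[symmetric])
    moreover have "a j * ennreal (R j) = ennreal (1 / (2 * R j)) * ennreal (R j) * (ratio f x (R j) * indicator A j)"
      by (simp only: a_def mult_ac)
    ultimately show "a j * ennreal (R j) = ennreal (1 / 2) * (ratio f x (R j) * indicator A j)" by simp
  qed
  also have "\<dots> = ennreal (1 / 2) * (\<Sum>j. ratio f x (R j) * indicator A j)"
    by (rule ennreal_suminf_cmult)
  finally have eq: "(\<integral>\<^sup>+t. s t \<partial>lebesgue) = ennreal (1 / 2) * (\<Sum>j. ratio f x (R j) * indicator A j)" .
  have "ennreal 2 * (\<integral>\<^sup>+t. s t \<partial>lebesgue) = ennreal 2 * ennreal (1 / 2) * (\<Sum>j. ratio f x (R j) * indicator A j)"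
    unfolding eq by (simp only: mult.assoc)
  also have "ennreal 2 * ennreal (1 / 2) = 1" by (subst ennreal_mult[symmetric]) auto
  finally have "(\<Sum>j. ratio f x (R j) * indicator A j) = ennreal 2 * (\<integral>\<^sup>+t. s t \<partial>lebesgue)" by simp
  also have "\<dots> \<le> ennreal 2 * (ennreal (D * M) * (\<integral>\<^sup>+t. h t \<partial>lebesgue))"
    using D M s_le by (intro mult_left_mono nn_integral_le_cmult_nonmeasurable) auto
  also have "\<dots> = ennreal (2 * D * M) * (\<integral>\<^sup>+t. h t \<partial>lebesgue)"
  proof -
    have "ennreal (2 * D * M) = ennreal 2 * ennreal (D * M)"
      using D M by (subst ennreal_mult[symmetric]) (auto simp: mult.assoc)
    then show ?thesis by (simp only: mult.assoc)
  qed
  finally show ?thesis unfolding R_def h_def .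
qed

end

section \<open>Boundedness on vanishing Morrey spaces\<close>

lemma frac_maximal_ennreal_le_riesz_potential:
  fixes f :: "real ^ 'n \<Rightarrow> real"
  assumes [measurable]: "f \<in> borel_measurable lebesgue" and a: "\<alpha> < real CARD('n)"
  shows "frac_maximal_ennreal \<alpha> f x \<le> riesz_potential \<alpha> f x"
  unfolding frac_maximal_ennreal_def
proof (rule SUP_least)
  fix r :: real assume r: "r \<in> {0<..}"
  have [measurable]: "ball x r \<in> sets lebesgue" by simp
  \<comment> \<open>At \<open>y = x\<close> the kernel has its default value 0 while the left side
    may be positive; the point is a null set.\<close>
  have "AE y in lebesgue. y \<notin> {x}" by (rule AE_not_in) simp
  then have "AE y in lebesgue. ennreal (1 / r powr (real CARD('n) - \<alpha>)) * (ennreal \<bar>f y\<bar> * indicator (ball x r) y)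
      \<le> ennreal (\<bar>f y\<bar> / norm (x - y) powr (real CARD('n) - \<alpha>))"
  proof (rule eventually_mono)
    fix y assume y: "y \<notin> {x}"
    show "ennreal (1 / r powr (real CARD('n) - \<alpha>)) * (ennreal \<bar>f y\<bar> * indicator (ball x r) y)
      \<le> ennreal (\<bar>f y\<bar> / norm (x - y) powr (real CARD('n) - \<alpha>))"
    proof (cases "y \<in> ball x r")
      case True
      then have "\<bar>f y\<bar> / r powr (real CARD('n) - \<alpha>) \<le> \<bar>f y\<bar> / norm (x - y) powr (real CARD('n) - \<alpha>)"
        using y r a by (intro divide_left_mono powr_mono2 mult_pos_pos) (auto simp: dist_norm)
      then show ?thesis using True by (simp add: ennreal_mult[symmetric] ennreal_leI)
    qed simp
  qed
  then have "(\<integral>\<^sup>+y. ennreal (1 / r powr (real CARD('n) - \<alpha>)) * (ennreal \<bar>f y\<bar> * indicator (ball x r) y) \<partial>lebesgue)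
    \<le> riesz_potential \<alpha> f x"
    unfolding riesz_potential_def by (rule nn_integral_mono_AE)
  then show "ennreal (1 / r powr (real CARD('n) - \<alpha>)) * (\<integral>\<^sup>+y\<in>ball x r. ennreal \<bar>f y\<bar> \<partial>lebesgue)
    \<le> riesz_potential \<alpha> f x"
    by (subst (asm) nn_integral_cmult) auto
qed

text \<open>Smaller concentric balls exhaust the mass of \<open>ball x r\<close>, so one of them
  already exceeds the level, and it lies in \<open>ball z r\<close> for every nearby
  \<open>z\<close>. This lower semicontinuity gives measurability despite the uncountable
  supremum.\<close>

lemma open_frac_maximal_superlevel:
  fixes f :: "real ^ 'n \<Rightarrow> real"
  assumes [measurable]: "f \<in> borel_measurable lebesgue"
  shows "open {x. a < frac_maximal_ennreal \<alpha> f x}"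
proof (rule openI)
  fix x assume "x \<in> {x. a < frac_maximal_ennreal \<alpha> f x}"
  define \<mu> where "\<mu> = density lebesgue (\<lambda>y. ennreal \<bar>f y\<bar>)"
  have mu: "(\<integral>\<^sup>+y\<in>ball z s. ennreal \<bar>f y\<bar> \<partial>lebesgue) = emeasure \<mu> (ball z s)" for z s
    unfolding \<mu>_def by (subst emeasure_density) auto
  from \<open>x \<in> {x. a < frac_maximal_ennreal \<alpha> f x}\<close> obtain r where r: "0 < r"
    "a < ennreal (1 / r powr (real CARD('n) - \<alpha>)) * emeasure \<mu> (ball x r)"
    unfolding frac_maximal_ennreal_def mu by (auto simp: less_SUP_iff)
  define B where "B = (\<lambda>n. ball x (r - r / real (Suc n)))"
  have "emeasure \<mu> (ball x r) = (SUP n. emeasure \<mu> (B n))"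
  proof -
    have inc: "incseq B"
      using r unfolding B_def incseq_def by (auto intro!: subset_ball divide_left_mono)
    have "ball x r = (\<Union>n. B n)"
    proof
      show "ball x r \<subseteq> (\<Union>n. B n)"
      proof
        fix y assume "y \<in> ball x r"
        then have "0 < (r - dist x y) / r" using r by simp
        then obtain n where "inverse (real (Suc n)) < (r - dist x y) / r"
          using reals_Archimedean by blast
        then have "r / real (Suc n) < r - dist x y" using r by (simp add: field_simps)
        then show "y \<in> (\<Union>n. B n)" by (auto simp: B_def intro!: exI[of _ n])
      qed
      show "(\<Union>n. B n) \<subseteq> ball x r"
        using r by (auto simp: B_def elim!: less_le_trans)
    qed
    then show ?thesis using inc by (simp add: SUP_emeasure_incseq \<mu>_def B_def image_subset_iff)
  qed
  then have "a < (SUP n. ennreal (1 / r powr (real CARD('n) - \<alpha>)) * emeasure \<mu> (B n))"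
    using r by (simp add: SUP_mult_left_ennreal)
  then obtain n where n: "a < ennreal (1 / r powr (real CARD('n) - \<alpha>)) * emeasure \<mu> (B n)"
    by (auto simp: less_SUP_iff)
  show "\<exists>e>0. ball x e \<subseteq> {x. a < frac_maximal_ennreal \<alpha> f x}"
  proof (intro exI conjI subsetI)
    show "0 < r / real (Suc n)" using r by simp
    fix z assume z: "z \<in> ball x (r / real (Suc n))"
    have "B n \<subseteq> ball z r"
    proof
      fix y assume y: "y \<in> B n"
      have "dist z y \<le> dist z x + dist x y" by (rule dist_triangle)
      then show "y \<in> ball z r" using y z by (simp add: B_def dist_commute)
    qed
    then have "emeasure \<mu> (B n) \<le> emeasure \<mu> (ball z r)"
      by (rule emeasure_mono) (simp add: \<mu>_def)
    then have "a < ennreal (1 / r powr (real CARD('n) - \<alpha>)) * emeasure \<mu> (ball z r)"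
      by (intro less_le_trans[OF n] mult_left_mono) auto
    also have "\<dots> \<le> frac_maximal_ennreal \<alpha> f z"
      unfolding frac_maximal_ennreal_def mu using r by (intro SUP_upper) auto
    finally show "z \<in> {x. a < frac_maximal_ennreal \<alpha> f x}" by simp
  qed
qed

lemma frac_maximal_measurable:
  fixes f :: "real ^ 'n \<Rightarrow> real"
  assumes "f \<in> borel_measurable lebesgue"
  shows "frac_maximal \<alpha> f \<in> borel_measurable lebesgue"
proof -
  have "frac_maximal_ennreal \<alpha> f \<in> borel_measurable lborel"
    using open_frac_maximal_superlevel[OF assms] by (intro borel_measurableI_greater) auto
  then have "(\<lambda>x. enn2real (frac_maximal_ennreal \<alpha> f x)) \<in> borel_measurable lborel" by measurable
  then show ?thesis
    unfolding frac_maximal_def[abs_def] by (rule measurable_completion)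
qed

lemma frac_integral_measurable:
  fixes f :: "real ^ 'n \<Rightarrow> real"
  assumes f [measurable]: "f \<in> borel_measurable lebesgue"
  shows "frac_integral \<alpha> f \<in> borel_measurable lebesgue"
proof -
  obtain f' where [measurable]: "f' \<in> borel_measurable lborel" and ff': "AE x in lborel. f x = f' x"
    using completion_ex_borel_measurable_real[OF f] by blast
  have [measurable]: "f' \<in> borel_measurable lebesgue" by (rule measurable_completion) measurable
  have "frac_integral \<alpha> f = (\<lambda>x. \<integral>y. f' y / norm (x - y) powr (real CARD('n) - \<alpha>) \<partial>lborel)"
  proof
    fix x
    have "frac_integral \<alpha> f x = (\<integral>y. f' y / norm (x - y) powr (real CARD('n) - \<alpha>) \<partial>lebesgue)"
      unfolding frac_integral_def
    proof (rule integral_cong_AE)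
      show "AE y in lebesgue. f y / norm (x - y) powr (real CARD('n) - \<alpha>) = f' y / norm (x - y) powr (real CARD('n) - \<alpha>)"
        using AE_completion[OF ff'] by (auto elim: eventually_mono)
    qed measurable
    also have "\<dots> = (\<integral>y. f' y / norm (x - y) powr (real CARD('n) - \<alpha>) \<partial>lborel)"
      by (rule integral_completion) measurable
    finally show "frac_integral \<alpha> f x = \<dots>" .
  qed
  also have "\<dots> \<in> borel_measurable lborel" by measurable
  finally show ?thesis by (rule measurable_completion)
qed

text \<open>Without convergence \<open>frac_integral\<close> is 0 by default, so domination holds at
  every point.\<close>

lemma frac_integral_le_riesz_potential: "ennreal \<bar>frac_integral \<alpha> f x\<bar> \<le> riesz_potential \<alpha> f x"
proof (cases "frac_integral_converges \<alpha> f x")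
  case True
  then show ?thesis
    unfolding frac_integral_def frac_integral_converges_def riesz_potential_def
    using integral_norm_bound_ennreal[of lebesgue "\<lambda>y. f y / norm (x - y) powr (real CARD('a) - \<alpha>)"]
    by simp
next
  case False
  then show ?thesis
    by (simp add: frac_integral_def frac_integral_converges_def not_integrable_integral_eq)
qed

lemma frac_integral_convergesI:
  assumes [measurable]: "f \<in> borel_measurable lebesgue" and "riesz_potential \<alpha> f x < top"
  shows "frac_integral_converges \<alpha> f x"
  using assms(2) unfolding frac_integral_converges_def riesz_potential_def
  by (intro integrableI_bounded) auto

section \<open>Tail integrals and the vanishing property\<close>

locale dominated_morrey = fractional_weight \<alpha> p q w
  for \<alpha> p q :: real and w :: "real ^ 'n \<Rightarrow> real" +
  fixes P :: "(real ^ 'n) set" and \<phi> \<psi> :: "real ^ 'n \<Rightarrow> real \<Rightarrow> real"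
  assumes phi: "\<phi> \<in> B_class P (\<lambda>x. w x powr p)"
    and psi: "\<psi> \<in> B_class P (\<lambda>x. w x powr q)"
    and tail_finite: "\<And>\<delta>. 0 < \<delta> \<Longrightarrow> (\<integral>\<^sup>+t\<in>{\<delta><..}. (SUP x\<in>P. ennreal (\<phi> x t powr (1 / p)) / Lnorm q (ball x t) w)
                  / ennreal t \<partial>lebesgue) < \<infinity>"
    and tail_le: "\<exists>c\<^sub>0::real. \<forall>x\<in>P. \<forall>r>0.
           (\<integral>\<^sup>+t\<in>{r<..}. ennreal (\<phi> x t powr (1 / p)) / Lnorm q (ball x t) w / ennreal t \<partial>lebesgue)
             \<le> ennreal c\<^sub>0 * (ennreal (\<psi> x r powr (1 / q)) / Lnorm q (ball x r) w)"
begin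

text \<open>All Morrey bounds concern balls centred in \<open>P\<close>; one such centre gives local
  integrability and convergence almost everywhere, since the balls about it exhaust the
  space.\<close>

lemma P_nonempty: "P \<noteq> {}"
  using phi by (auto simp: B_class_def)

lemma phi_pos: "x \<in> P \<Longrightarrow> 0 < t \<Longrightarrow> 0 < \<phi> x t powr (1 / p)"
  and psi_pos: "x \<in> P \<Longrightarrow> 0 < t \<Longrightarrow> 0 < \<psi> x t powr (1 / q)"
  using phi psi by (force simp: B_class_def)+

abbreviation "phi_tail x r \<equiv> \<integral>\<^sup>+t\<in>{r<..}. ennreal (\<phi> x t powr (1 / p)) / Lnorm q (ball x t) w / ennreal t \<partial>lebesgue"

lemma fnorm_le:
  assumes "x \<in> P" "0 < t" "morrey_quot p \<phi> (\<lambda>x. w x powr p) f x t \<le> ennreal M"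
  shows "fnorm f (ball x t) \<le> ennreal M * ennreal (\<phi> x t powr (1 / p))"
  using assms(3) unfolding morrey_quot_def fnorm_def[symmetric]
  by (rule ennreal_le_mult_of_divide_le) (rule phi_pos[OF assms(1,2)])

lemma morrey_quot_le_norm:
  assumes "x \<in> P" "0 < t"
  shows "morrey_quot s g v f x t \<le> morrey_norm P s g v f"
  unfolding morrey_norm_def using assms by (intro SUP_upper2[of x] SUP_upper2[of t]) auto

lemma wnorm_le_potential_norm:
  assumes [measurable]: "A \<in> sets lebesgue" and Tf: "\<And>x. ennreal \<bar>Tf x\<bar> \<le> riesz_potential \<alpha> f x"
  shows "wnorm q (\<lambda>x. w x powr q) A Tf \<le> potential_norm f A"
proof -
  have "(\<integral>\<^sup>+y\<in>A. ennreal (\<bar>Tf y\<bar> powr q * w y powr q) \<partial>lebesgue)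
     \<le> (\<integral>\<^sup>+x. ennreal_powr (riesz_potential \<alpha> f x) q * ennreal (u x) * indicator A x \<partial>lebesgue)"
    using w_eq_w1
  proof (intro nn_integral_mono_AE, elim eventually_mono)
    fix y assume y: "w y = w1 y \<and> 0 < w y"
    have "ennreal (\<bar>Tf y\<bar> powr q) = ennreal_powr (ennreal \<bar>Tf y\<bar>) q" by (simp add: ennreal_powr_ennreal)
    also have "\<dots> \<le> ennreal_powr (riesz_potential \<alpha> f y) q"
      using q_gt_1 by (intro ennreal_powr_mono Tf) auto
    finally show "ennreal (\<bar>Tf y\<bar> powr q * w y powr q) * indicator A y
      \<le> ennreal_powr (riesz_potential \<alpha> f y) q * ennreal (u y) * indicator A y"
      using y by (auto simp: ennreal_mult u_def intro!: mult_right_mono)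
  qed
  then show ?thesis
    unfolding wnorm_def potential_norm_def using q_gt_1 by (intro ennreal_powr_mono) auto
qed

text \<open>The first bound serves the vanishing condition: small scales carry
  \<open>\<epsilon>\<close>, the others carry \<open>M\<close> but only the tail from
  \<open>\<delta> / 2\<close>. The second serves the norm inequality.\<close>

lemma split_estimate:
  obtains K where "0 < K"
    "\<And>f x r M \<epsilon> \<delta>. f \<in> borel_measurable lebesgue \<Longrightarrow> x \<in> P \<Longrightarrow> 0 < r \<Longrightarrow> 0 \<le> M \<Longrightarrow> 0 \<le> \<epsilon> \<Longrightarrow>
      (\<And>t. 0 < t \<Longrightarrow> fnorm f (ball x t) \<le> ennreal M * ennreal (\<phi> x t powr (1 / p))) \<Longrightarrow>
      (\<And>t. 0 < t \<Longrightarrow> t < \<delta> \<Longrightarrow> fnorm f (ball x t) \<le> ennreal \<epsilon> * ennreal (\<phi> x t powr (1 / p))) \<Longrightarrow>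
      potential_norm f (ball x r) \<le> Lnorm q (ball x r) w *
        (ennreal (K * \<epsilon>) * phi_tail x r + ennreal (K * M) * phi_tail x (\<delta> / 2))"
    "\<And>f x r M. f \<in> borel_measurable lebesgue \<Longrightarrow> x \<in> P \<Longrightarrow> 0 < r \<Longrightarrow> 0 \<le> M \<Longrightarrow>
      (\<And>t. 0 < t \<Longrightarrow> fnorm f (ball x t) \<le> ennreal M * ennreal (\<phi> x t powr (1 / p))) \<Longrightarrow>
      potential_norm f (ball x r) \<le> Lnorm q (ball x r) w * (ennreal (K * M) * phi_tail x r)"
proof -
  obtain D where D: "0 < D" "\<And>x r. 0 < r \<Longrightarrow> Lnorm q (ball x (2 * r)) w \<le> ennreal D * Lnorm q (ball x r) w"
    using Lnorm_doubling by blast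
  obtain C where C: "0 < C" "\<And>f x r. f \<in> borel_measurable lebesgue \<Longrightarrow> 0 < r \<Longrightarrow>
    potential_norm f (ball x r) \<le> ennreal C * (Lnorm q (ball x r) w * (\<Sum>j. ratio f x (2 ^ (j + 1) * r)))"
    using potential_norm_ball_le by blast
  have merge: "ennreal C * (ennreal (2 * D * m) * X) = ennreal (C * (2 * D) * m) * X" if "0 \<le> m" for m X
  proof -
    have "ennreal (C * (2 * D) * m) = ennreal C * ennreal (2 * D * m)"
      using that C(1) D(1) by (subst ennreal_mult[symmetric]) (auto simp: mult.assoc)
    then show ?thesis by (simp only: mult.assoc)
  qed
  show ?thesis
  proof (rule that[of "C * (2 * D)"])
    show "0 < C * (2 * D)" using C(1) D(1) by simp
  next
    fix f :: "real ^ 'n \<Rightarrow> real" and x :: "real ^ 'n" and r M \<epsilon> \<delta> :: real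
    assume f: "f \<in> borel_measurable lebesgue" and x: "x \<in> P" and r: "0 < r" and M: "0 \<le> M" and e: "0 \<le> \<epsilon>"
      and fM: "\<And>t. 0 < t \<Longrightarrow> fnorm f (ball x t) \<le> ennreal M * ennreal (\<phi> x t powr (1 / p))"
      and fe: "\<And>t. 0 < t \<Longrightarrow> t < \<delta> \<Longrightarrow> fnorm f (ball x t) \<le> ennreal \<epsilon> * ennreal (\<phi> x t powr (1 / p))"
    \<comment> \<open>The bound on \<open>f\<close> is used for radii up to
      \<open>2 ^ (j + 2) * r\<close>, hence the exponent. For the other scales
      \<open>2 ^ (j + 1) * r\<close> is at least \<open>\<delta> / 2\<close>, the origin of the
      halved cut.\<close>
    define A where "A = {j::nat. 2 ^ (j + 2) * r < \<delta>}"
    have pos: "0 < t" if "2 ^ (j + 1) * r < t" for j :: nat and t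
      by (rule less_trans[OF _ that]) (use r in simp)
    have "(\<Sum>j. ratio f x (2 ^ (j + 1) * r))
      = (\<Sum>j. ratio f x (2 ^ (j + 1) * r) * indicator A j + ratio f x (2 ^ (j + 1) * r) * indicator (- A) j)"
      by (intro arg_cong[where f = suminf] ext) (auto split: split_indicator)
    also have "\<dots> = (\<Sum>j. ratio f x (2 ^ (j + 1) * r) * indicator A j) + (\<Sum>j. ratio f x (2 ^ (j + 1) * r) * indicator (- A) j)"
      by (rule suminf_add[symmetric]) auto
    also have "\<dots> \<le> ennreal (2 * D * \<epsilon>) * phi_tail x r + ennreal (2 * D * M) * phi_tail x (\<delta> / 2)"
    proof (rule add_mono)
      show "(\<Sum>j. ratio f x (2 ^ (j + 1) * r) * indicator A j) \<le> ennreal (2 * D * \<epsilon>) * phi_tail x r"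
      proof (rule sum_ratio_le[OF D r e])
        fix j :: nat
        have "1 * r \<le> 2 ^ (j + 1) * r" using r by (intro mult_right_mono one_le_power) auto
        then show "r \<le> 2 ^ (j + 1) * r" by simp
        fix t assume "j \<in> A" "2 ^ (j + 1) * r < t" "t \<le> 2 ^ (j + 2) * r"
        then show "fnorm f (ball x t) \<le> ennreal \<epsilon> * ennreal (\<phi> x t powr (1 / p))"
          using pos by (intro fe) (auto simp: A_def)
      qed auto
      show "(\<Sum>j. ratio f x (2 ^ (j + 1) * r) * indicator (- A) j) \<le> ennreal (2 * D * M) * phi_tail x (\<delta> / 2)"
      proof (rule sum_ratio_le[OF D r M])
        fix j :: nat assume "j \<in> - A"
        then show "\<delta> / 2 \<le> 2 ^ (j + 1) * r" by (simp add: A_def not_less)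
      next
        fix j :: nat and t assume "2 ^ (j + 1) * r < t"
        then show "fnorm f (ball x t) \<le> ennreal M * ennreal (\<phi> x t powr (1 / p))"
          by (intro fM pos)
      qed auto
    qed
    finally have le: "(\<Sum>j. ratio f x (2 ^ (j + 1) * r)) \<le> \<dots>" .
    have "potential_norm f (ball x r) \<le> ennreal C * (Lnorm q (ball x r) w * (\<Sum>j. ratio f x (2 ^ (j + 1) * r)))"
      by (rule C(2)[OF f r])
    also have "\<dots> \<le> ennreal C * (Lnorm q (ball x r) w * (ennreal (2 * D * \<epsilon>) * phi_tail x r + ennreal (2 * D * M) * phi_tail x (\<delta> / 2)))"
      by (intro mult_left_mono le) auto
    also have "\<dots> = Lnorm q (ball x r) w * (ennreal C * (ennreal (2 * D * \<epsilon>) * phi_tail x r) + ennreal C * (ennreal (2 * D * M) * phi_tail x (\<delta> / 2)))"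
      by (simp only: distrib_left mult.left_commute)
    finally show "potential_norm f (ball x r) \<le> Lnorm q (ball x r) w *
        (ennreal (C * (2 * D) * \<epsilon>) * phi_tail x r + ennreal (C * (2 * D) * M) * phi_tail x (\<delta> / 2))"
      unfolding merge[OF e] merge[OF M] .
  next
    fix f :: "real ^ 'n \<Rightarrow> real" and x :: "real ^ 'n" and r M :: real
    assume f: "f \<in> borel_measurable lebesgue" and x: "x \<in> P" and r: "0 < r" and M: "0 \<le> M"
      and fM: "\<And>t. 0 < t \<Longrightarrow> fnorm f (ball x t) \<le> ennreal M * ennreal (\<phi> x t powr (1 / p))"
    have "(\<Sum>j. ratio f x (2 ^ (j + 1) * r) * indicator UNIV j) \<le> ennreal (2 * D * M) * phi_tail x r"
    proof (rule sum_ratio_le[OF D r M])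
      fix j :: nat
      have "1 * r \<le> 2 ^ (j + 1) * r" using r by (intro mult_right_mono one_le_power) auto
      then show "r \<le> 2 ^ (j + 1) * r" by simp
      fix t assume "2 ^ (j + 1) * r < t"
      then have "0 < t" by (rule less_trans[rotated]) (use r in simp)
      then show "fnorm f (ball x t) \<le> ennreal M * ennreal (\<phi> x t powr (1 / p))" by (rule fM)
    qed auto
    then have le: "(\<Sum>j. ratio f x (2 ^ (j + 1) * r)) \<le> ennreal (2 * D * M) * phi_tail x r" by simp
    have "potential_norm f (ball x r) \<le> ennreal C * (Lnorm q (ball x r) w * (\<Sum>j. ratio f x (2 ^ (j + 1) * r)))"
      by (rule C(2)[OF f r])
    also have "\<dots> \<le> ennreal C * (Lnorm q (ball x r) w * (ennreal (2 * D * M) * phi_tail x r))"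
      by (intro mult_left_mono le) auto
    also have "\<dots> = Lnorm q (ball x r) w * (ennreal C * (ennreal (2 * D * M) * phi_tail x r))"
      by (simp only: mult.left_commute)
    finally show "potential_norm f (ball x r) \<le> Lnorm q (ball x r) w * (ennreal (C * (2 * D) * M) * phi_tail x r)"
      unfolding merge[OF M] .
  qed
qed

lemma tail_bound:
  obtains c where "0 \<le> c" "\<And>x r a. x \<in> P \<Longrightarrow> 0 < r \<Longrightarrow> 0 \<le> a \<Longrightarrow>
    Lnorm q (ball x r) w * (ennreal a * phi_tail x r) \<le> ennreal (a * c) * ennreal (\<psi> x r powr (1 / q))"
proof -
  obtain c0 :: real where c0: "\<And>x r :: real. x \<in> P \<Longrightarrow> 0 < r \<Longrightarrow>
     phi_tail x r \<le> ennreal c0 * (ennreal (\<psi> x r powr (1 / q)) / Lnorm q (ball x r) w)"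
    using tail_le by blast
  show ?thesis
  \<comment> \<open>\<open>c0\<close> may be negative, in which case \<open>ennreal c0\<close> is
    0.\<close>
  proof (rule that[of "max c0 0"])
    fix x :: "real ^ 'n" and r a :: real assume x: "x \<in> P" and r: "0 < r" and a: "0 \<le> a"
    obtain n where n: "Lnorm q (ball x r) w = ennreal n" "0 < n" using Lnorm_ball_real[OF r] by blast
    have "phi_tail x r \<le> ennreal (max c0 0) * (ennreal (\<psi> x r powr (1 / q)) / Lnorm q (ball x r) w)"
      by (rule order_trans[OF c0[OF x r]]) (intro mult_right_mono ennreal_leI, auto)
    also have "\<dots> = ennreal (max c0 0 * (\<psi> x r powr (1 / q) / n))"
      using n by (simp add: divide_ennreal ennreal_mult[symmetric])
    finally have "Lnorm q (ball x r) w * (ennreal a * phi_tail x r)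
      \<le> ennreal n * (ennreal a * ennreal (max c0 0 * (\<psi> x r powr (1 / q) / n)))"
      unfolding n(1) by (intro mult_left_mono) auto
    also have "\<dots> = ennreal (n * (a * (max c0 0 * (\<psi> x r powr (1 / q) / n))))"
      using n a by (simp only: ennreal_mult[symmetric] mult_nonneg_nonneg less_imp_le divide_nonneg_nonneg powr_ge_zero max.cobounded2)
    also have "n * (a * (max c0 0 * (\<psi> x r powr (1 / q) / n))) = a * max c0 0 * \<psi> x r powr (1 / q)"
      using n by simp
    also have "ennreal (a * max c0 0 * \<psi> x r powr (1 / q)) = ennreal (a * max c0 0) * ennreal (\<psi> x r powr (1 / q))"
      using a by (intro ennreal_mult) auto
    finally show "Lnorm q (ball x r) w * (ennreal a * phi_tail x r)
      \<le> ennreal (a * max c0 0) * ennreal (\<psi> x r powr (1 / q))" .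
  qed simp
qed

text \<open>Takes the \<open>q\<close>-th root of the limit condition in \<open>B_class\<close>. The
  resulting small factor beats the far tail, which does not shrink with \<open>r\<close>.\<close>

lemma Lnorm_over_psi:
  assumes "x \<in> P" "0 < r" "Lnorm 1 (ball x r) (\<lambda>x. w x powr q) / ennreal (\<psi> x r) \<le> ennreal e" "0 \<le> e"
  shows "Lnorm q (ball x r) w \<le> ennreal (e powr (1 / q)) * ennreal (\<psi> x r powr (1 / q))"
proof -
  have psi0: "0 < \<psi> x r" using psi assms by (auto simp: B_class_def)
  have "emeasure U (ball x r) = Lnorm 1 (ball x r) (\<lambda>x. w x powr q)"
  proof -
    have "emeasure U (ball x r) = (\<integral>\<^sup>+y. ennreal (u y) * indicator (ball x r) y \<partial>lebesgue)"
      by (rule emeasure_density) auto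
    also have "\<dots> = (\<integral>\<^sup>+y\<in>ball x r. ennreal (\<bar>w y powr q\<bar> powr 1 * 1) \<partial>lebesgue)"
      using w_eq_w1 by (intro nn_integral_cong_AE) (auto elim!: eventually_mono simp: u_def)
    finally show ?thesis by (simp add: wnorm_def)
  qed
  also have "\<dots> \<le> ennreal e * ennreal (\<psi> x r)"
    by (rule ennreal_le_mult_of_divide_le[OF assms(3) psi0])
  finally have "Lnorm q (ball x r) w \<le> ennreal_powr (ennreal e * ennreal (\<psi> x r)) (1 / q)"
    using q_gt_1 by (simp add: Lnorm_w ennreal_powr_mono)
  then show ?thesis using assms(4) psi0 by (simp add: ennreal_powr_mult ennreal_powr_ennreal)
qed

text \<open>With the supremum inside the integral one number bounds the tails of all centres, as the
  uniform limit requires.\<close>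

lemma phi_tail_le_sup:
  assumes "x \<in> P"
  shows "phi_tail x r \<le> (\<integral>\<^sup>+t\<in>{r<..}. (SUP x\<in>P. ennreal (\<phi> x t powr (1 / p)) / Lnorm q (ball x t) w) / ennreal t \<partial>lebesgue)"
  using assms by (intro nn_integral_mono mult_right_mono divide_right_mono_ennreal SUP_upper) auto

text \<open>Every estimate is made for the potential; \<open>T\<close> inherits it by domination,
  and \<open>Dm\<close> holds wherever the potential is finite.\<close>

lemma bounded_vanishing_morreyI:
  assumes T_meas: "\<And>f. f \<in> borel_measurable lebesgue \<Longrightarrow> T f \<in> borel_measurable lebesgue"
    and T_le: "\<And>f x. f \<in> borel_measurable lebesgue \<Longrightarrow> ennreal \<bar>T f x\<bar> \<le> riesz_potential \<alpha> f x"
    and T_fin: "\<And>f x. f \<in> borel_measurable lebesgue \<Longrightarrow> riesz_potential \<alpha> f x < top \<Longrightarrow> Dm f x"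
  shows "bounded_vanishing_morrey Dm T P p \<phi> (\<lambda>x. w x powr p) q \<psi> (\<lambda>x. w x powr q)"
proof -
  obtain c where c: "0 \<le> c" "\<And>x r a. x \<in> P \<Longrightarrow> 0 < r \<Longrightarrow> 0 \<le> a \<Longrightarrow>
    Lnorm q (ball x r) w * (ennreal a * phi_tail x r) \<le> ennreal (a * c) * ennreal (\<psi> x r powr (1 / q))"
    using tail_bound by blast
  obtain K where K: "0 < K"
    and split: "\<And>f x r M \<epsilon> \<delta>. f \<in> borel_measurable lebesgue \<Longrightarrow> x \<in> P \<Longrightarrow> 0 < r \<Longrightarrow> 0 \<le> M \<Longrightarrow> 0 \<le> \<epsilon> \<Longrightarrow>
      (\<And>t. 0 < t \<Longrightarrow> fnorm f (ball x t) \<le> ennreal M * ennreal (\<phi> x t powr (1 / p))) \<Longrightarrow>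
      (\<And>t. 0 < t \<Longrightarrow> t < \<delta> \<Longrightarrow> fnorm f (ball x t) \<le> ennreal \<epsilon> * ennreal (\<phi> x t powr (1 / p))) \<Longrightarrow>
      potential_norm f (ball x r) \<le> Lnorm q (ball x r) w *
        (ennreal (K * \<epsilon>) * phi_tail x r + ennreal (K * M) * phi_tail x (\<delta> / 2))"
    and whole: "\<And>f x r M. f \<in> borel_measurable lebesgue \<Longrightarrow> x \<in> P \<Longrightarrow> 0 < r \<Longrightarrow> 0 \<le> M \<Longrightarrow>
      (\<And>t. 0 < t \<Longrightarrow> fnorm f (ball x t) \<le> ennreal M * ennreal (\<phi> x t powr (1 / p))) \<Longrightarrow>
      potential_norm f (ball x r) \<le> Lnorm q (ball x r) w * (ennreal (K * M) * phi_tail x r)"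
    by (rule split_estimate) blast
  let ?VP = "vanishing_morrey P p \<phi> (\<lambda>x. w x powr p)"
  let ?VQ = "vanishing_morrey P q \<psi> (\<lambda>x. w x powr q)"
  have "(AE x in lebesgue. Dm f x) \<and> T f \<in> ?VQ \<and>
     morrey_norm P q \<psi> (\<lambda>x. w x powr q) (T f) \<le> ennreal (K * c) * morrey_norm P p \<phi> (\<lambda>x. w x powr p) f"
    if f: "f \<in> ?VP" for f
  proof -
    have fm [measurable]: "f \<in> borel_measurable lebesgue"
      and fN: "morrey_norm P p \<phi> (\<lambda>x. w x powr p) f < top"
      and fv: "((\<lambda>r. SUP x\<in>P. morrey_quot p \<phi> (\<lambda>x. w x powr p) f x r) \<longlongrightarrow> 0) (at_right 0)"
      using f by (auto simp: vanishing_morrey_def L_loc_def)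
    have [measurable]: "T f \<in> borel_measurable lebesgue" by (rule T_meas) (rule fm)
    have [measurable]: "ball x r \<in> sets lebesgue" for x :: "real ^ 'n" and r by simp
    obtain M where M: "morrey_norm P p \<phi> (\<lambda>x. w x powr p) f = ennreal M" "0 \<le> M"
      using fN by (cases "morrey_norm P p \<phi> (\<lambda>x. w x powr p) f") auto
    have fM: "fnorm f (ball x t) \<le> ennreal M * ennreal (\<phi> x t powr (1 / p))" if "x \<in> P" "0 < t" for x t
      using morrey_quot_le_norm[OF that] M(1) by (intro fnorm_le that) metis
    have pot: "potential_norm f (ball x r) \<le> ennreal (K * M * c) * ennreal (\<psi> x r powr (1 / q))"
      if "x \<in> P" "0 < r" for x r
    proof -
      have "potential_norm f (ball x r) \<le> Lnorm q (ball x r) w * (ennreal (K * M) * phi_tail x r)"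
        by (rule whole[OF fm that M(2)]) (rule fM[OF that(1)])
      also have "\<dots> \<le> ennreal (K * M * c) * ennreal (\<psi> x r powr (1 / q))"
        using K M by (intro c that) auto
      finally show ?thesis .
    qed
    have wT: "wnorm q (\<lambda>x. w x powr q) (ball x r) (T f) \<le> potential_norm f (ball x r)" for x r
      by (intro wnorm_le_potential_norm T_le fm) simp
    have quot: "morrey_quot q \<psi> (\<lambda>x. w x powr q) (T f) x r \<le> ennreal (K * M * c)" if "x \<in> P" "0 < r" for x r
      unfolding morrey_quot_def
      by (intro ennreal_divide_le_of_le_mult psi_pos that order_trans[OF wT pot])
    obtain x0 where x0: "x0 \<in> P" using P_nonempty by blast
    have pot_fin: "potential_norm f (ball x0 r) < top" if "0 < r" for r
      using pot[OF x0 that] by (rule le_less_trans) (simp add: ennreal_mult_less_top)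
    have norm: "morrey_norm P q \<psi> (\<lambda>x. w x powr q) (T f) \<le> ennreal (K * c) * morrey_norm P p \<phi> (\<lambda>x. w x powr p) f"
    proof -
      have "morrey_norm P q \<psi> (\<lambda>x. w x powr q) (T f) \<le> ennreal (K * M * c)"
        unfolding morrey_norm_def by (intro SUP_least quot) auto
      also have "\<dots> = ennreal (K * c) * ennreal M"
        using K M c(1) by (subst ennreal_mult[symmetric]) (auto simp: mult_ac)
      finally show ?thesis using M by simp
    qed
    have Tloc: "T f \<in> L_loc q (\<lambda>x. w x powr q)"
      unfolding L_loc_def
    proof (intro CollectI conjI allI impI)
      fix A :: "(real ^ 'n) set" assume "compact A"
      then obtain R where R: "0 < R" "A \<subseteq> ball x0 R"
        using bounded_subset_ballD[OF compact_imp_bounded] by blast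
      have "wnorm q (\<lambda>x. w x powr q) A (T f) \<le> wnorm q (\<lambda>x. w x powr q) (ball x0 R) (T f)"
        unfolding wnorm_def using R q_gt_1
        by (intro ennreal_powr_mono nn_integral_mono) (auto split: split_indicator)
      also have "\<dots> < top" by (rule le_less_trans[OF wT pot_fin[OF R(1)]])
      finally show "wnorm q (\<lambda>x. w x powr q) A (T f) < \<infinity>" by simp
    qed measurable
    have AE_fin: "AE x in lebesgue. Dm f x"
    proof -
      \<comment> \<open>As \<open>u\<close> is positive, a finite integral over a ball forces the
        potential to be finite almost everywhere in it; countably many balls cover the
        space.\<close>
      have "AE x in lebesgue. x \<in> ball x0 (real (Suc n)) \<longrightarrow> riesz_potential \<alpha> f x < top" for n
      proof -
        have "(\<integral>\<^sup>+x. ennreal_powr (riesz_potential \<alpha> f x) q * ennreal (u x) * indicator (ball x0 (real (Suc n))) x \<partial>lebesgue) \<noteq> \<infinity>"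
          using pot_fin[of "real (Suc n)"] by (simp add: potential_norm_def)
        then have "AE x in lebesgue. ennreal_powr (riesz_potential \<alpha> f x) q * ennreal (u x) * indicator (ball x0 (real (Suc n))) x \<noteq> \<infinity>"
          by (intro nn_integral_PInf_AE) measurable
        then show ?thesis
        proof (rule eventually_mono, intro impI)
          fix x assume *: "ennreal_powr (riesz_potential \<alpha> f x) q * ennreal (u x) * indicator (ball x0 (real (Suc n))) x \<noteq> \<infinity>"
            and x: "x \<in> ball x0 (real (Suc n))"
          have "0 < ennreal (u x)" using w1_pos[of x] by (simp add: u_def ennreal_less_zero_iff)
          then show "riesz_potential \<alpha> f x < top"
            using * x by (auto simp: less_top[symmetric] ennreal_top_mult)
        qed
      qed
      then have "AE x in lebesgue. \<forall>n. x \<in> ball x0 (real (Suc n)) \<longrightarrow> riesz_potential \<alpha> f x < top"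
        by (subst AE_all_countable) blast
      then show ?thesis
      proof (rule eventually_mono)
        fix x assume *: "\<forall>n. x \<in> ball x0 (real (Suc n)) \<longrightarrow> riesz_potential \<alpha> f x < top"
        obtain n where "dist x0 x < real n" using reals_Archimedean2 by blast
        then have "x \<in> ball x0 (real (Suc n))" by simp
        then show "Dm f x" using * by (intro T_fin fm) blast
      qed
    qed
    have vanish: "((\<lambda>r. SUP x\<in>P. morrey_quot q \<psi> (\<lambda>x. w x powr q) (T f) x r) \<longlongrightarrow> 0) (at_right 0)"
    proof (rule ennreal_tendsto_0I)
      fix e :: real assume e: "0 < e"
      \<comment> \<open>Makes the small scales contribute at most \<open>e / 2\<close>; the summand
        1 keeps the denominator positive when \<open>c = 0\<close>.\<close>
      define \<epsilon> where "\<epsilon> = e / (2 * (K * c + 1))"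
      have "0 \<le> K * c" using K c(1) by simp
      then have eps: "0 < \<epsilon>" "K * \<epsilon> * c \<le> e / 2"
        using e by (auto simp: \<epsilon>_def field_simps)
      have "eventually (\<lambda>r. (SUP x\<in>P. morrey_quot p \<phi> (\<lambda>x. w x powr p) f x r) < ennreal \<epsilon>) (at_right 0)"
        using fv eps(1) by (intro order_tendstoD) (auto simp: ennreal_less_zero_iff)
      then obtain \<delta> where \<delta>: "0 < \<delta>"
        "\<And>t. 0 < t \<Longrightarrow> t < \<delta> \<Longrightarrow> (SUP x\<in>P. morrey_quot p \<phi> (\<lambda>x. w x powr p) f x t) < ennreal \<epsilon>"
        unfolding eventually_at_right_field by blast
      have fe: "fnorm f (ball x t) \<le> ennreal \<epsilon> * ennreal (\<phi> x t powr (1 / p))" if "x \<in> P" "0 < t" "t < \<delta>" for x t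
        by (rule fnorm_le[OF that(1,2)])
          (rule order_trans[OF SUP_upper[OF that(1)] less_imp_le[OF \<delta>(2)[OF that(2,3)]]])
      have "(\<integral>\<^sup>+t\<in>{\<delta> / 2<..}. (SUP x\<in>P. ennreal (\<phi> x t powr (1 / p)) / Lnorm q (ball x t) w) / ennreal t \<partial>lebesgue) < \<infinity>"
        using \<delta>(1) by (intro tail_finite) simp
      then obtain k where k: "0 \<le> k" "(\<integral>\<^sup>+t\<in>{\<delta> / 2<..}. (SUP x\<in>P. ennreal (\<phi> x t powr (1 / p)) / Lnorm q (ball x t) w) / ennreal t \<partial>lebesgue) = ennreal k"
        by (auto simp: less_top_ennreal)
      \<comment> \<open>\<open>\<delta>\<close> is fixed before \<open>r\<close> tends to 0, so the
        far tail is bounded by the constant \<open>k\<close>. The power \<open>q\<close> offsets the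
        root in \<open>Lnorm_over_psi\<close>, which leaves at most \<open>e / 2\<close> for the
        large scales.\<close>
      define \<kappa> where "\<kappa> = (e / (2 * (K * M * k + 1))) powr q"
      have KMk: "0 \<le> K * M * k" using K M k by simp
      then have kap: "0 < \<kappa>" "\<kappa> powr (1 / q) * (K * M * k) \<le> e / 2"
        using e q_gt_1 by (auto simp: \<kappa>_def powr_powr field_simps)
      have "eventually (\<lambda>r. (SUP x\<in>P. Lnorm 1 (ball x r) (\<lambda>x. w x powr q) / ennreal (\<psi> x r)) < ennreal \<kappa>) (at_right 0)"
        using psi kap(1) by (intro order_tendstoD) (auto simp: ennreal_less_zero_iff B_class_def)
      moreover have "eventually (\<lambda>r::real. 0 < r) (at_right 0)" by (rule eventually_at_right_less)
      ultimately show "eventually (\<lambda>r. (SUP x\<in>P. morrey_quot q \<psi> (\<lambda>x. w x powr q) (T f) x r) \<le> ennreal e) (at_right 0)"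
      proof eventually_elim
        case (elim r)
        show ?case
        proof (rule SUP_least)
          fix x assume x: "x \<in> P"
          have "Lnorm 1 (ball x r) (\<lambda>x. w x powr q) / ennreal (\<psi> x r)
            \<le> (SUP x\<in>P. Lnorm 1 (ball x r) (\<lambda>x. w x powr q) / ennreal (\<psi> x r))"
            using x by (rule SUP_upper)
          also have "\<dots> \<le> ennreal \<kappa>" using elim(1) by (rule less_imp_le)
          finally have L: "Lnorm q (ball x r) w \<le> ennreal (\<kappa> powr (1 / q)) * ennreal (\<psi> x r powr (1 / q))"
            using kap(1) by (intro Lnorm_over_psi x elim(2)) auto
          have tail: "phi_tail x (\<delta> / 2) \<le> ennreal k"
            using phi_tail_le_sup[OF x, of "\<delta> / 2"] k(2) by simp
          have "potential_norm f (ball x r) \<le> Lnorm q (ball x r) w *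
              (ennreal (K * \<epsilon>) * phi_tail x r + ennreal (K * M) * phi_tail x (\<delta> / 2))"
            by (rule split[OF fm x elim(2) M(2)]) (use eps(1) fM[OF x] fe[OF x] in auto)
          also have "\<dots> = Lnorm q (ball x r) w * (ennreal (K * \<epsilon>) * phi_tail x r)
              + Lnorm q (ball x r) w * (ennreal (K * M) * phi_tail x (\<delta> / 2))"
            by (rule distrib_left)
          also have "\<dots> \<le> ennreal (K * \<epsilon> * c) * ennreal (\<psi> x r powr (1 / q))
              + (ennreal (\<kappa> powr (1 / q)) * ennreal (\<psi> x r powr (1 / q))) * (ennreal (K * M) * ennreal k)"
            using K eps(1) by (intro add_mono c x elim(2) mult_mono L mult_left_mono tail) auto
          also have "(ennreal (\<kappa> powr (1 / q)) * ennreal (\<psi> x r powr (1 / q))) * (ennreal (K * M) * ennreal k)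
             = ennreal (\<kappa> powr (1 / q) * (K * M * k)) * ennreal (\<psi> x r powr (1 / q))"
            using K M k by (simp add: ennreal_mult mult_ac)
          also have "ennreal (K * \<epsilon> * c) * ennreal (\<psi> x r powr (1 / q))
             + ennreal (\<kappa> powr (1 / q) * (K * M * k)) * ennreal (\<psi> x r powr (1 / q))
             \<le> ennreal (e / 2) * ennreal (\<psi> x r powr (1 / q)) + ennreal (e / 2) * ennreal (\<psi> x r powr (1 / q))"
            using eps(2) kap(2) by (intro add_mono mult_right_mono ennreal_leI) auto
          also have "\<dots> = (ennreal (e / 2) + ennreal (e / 2)) * ennreal (\<psi> x r powr (1 / q))"
            by (rule distrib_right[symmetric])
          also have "ennreal (e / 2) + ennreal (e / 2) = ennreal e"
            using e by (subst ennreal_plus[symmetric]) auto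
          finally have "potential_norm f (ball x r) \<le> ennreal e * ennreal (\<psi> x r powr (1 / q))" .
          then show "morrey_quot q \<psi> (\<lambda>x. w x powr q) (T f) x r \<le> ennreal e"
            unfolding morrey_quot_def
            by (intro ennreal_divide_le_of_le_mult psi_pos x elim(2) order_trans[OF wT])
        qed
      qed
    qed
    have "morrey_norm P q \<psi> (\<lambda>x. w x powr q) (T f) < \<infinity>"
      using le_less_trans[OF norm] M by (simp add: ennreal_mult_less_top)
    then show ?thesis using AE_fin norm Tloc vanish by (simp add: vanishing_morrey_def)
  qed
  then show ?thesis unfolding bounded_vanishing_morrey_def by blast
qed

end

theorem theorem3p1:
  fixes \<alpha> p q :: real
    and P :: "(real ^ 'n) set"
    and w :: "real ^ 'n \<Rightarrow> real"
    and \<phi> \<psi> :: "real ^ 'n \<Rightarrow> real \<Rightarrow> real"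
  assumes "0 < \<alpha>" and "\<alpha> < real CARD('n)"
    and "1 < p" and "p < real CARD('n) / \<alpha>"
    and "1 / q = 1 / p - \<alpha> / real CARD('n)"
    and "w \<in> A_class p q"
    and "\<phi> \<in> B_class P (\<lambda>x. w x powr p)"
    and "\<psi> \<in> B_class P (\<lambda>x. w x powr q)"
    and "\<forall>\<delta>>0. (\<integral>\<^sup>+t\<in>{\<delta><..}. (SUP x\<in>P. ennreal (\<phi> x t powr (1 / p)) / Lnorm q (ball x t) w)
                  / ennreal t \<partial>lebesgue) < \<infinity>"
    and "\<exists>c\<^sub>0::real. \<forall>x\<in>P. \<forall>r>0.
           (\<integral>\<^sup>+t\<in>{r<..}. ennreal (\<phi> x t powr (1 / p)) / Lnorm q (ball x t) w / ennreal t \<partial>lebesgue)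
             \<le> ennreal c\<^sub>0 * (ennreal (\<psi> x r powr (1 / q)) / Lnorm q (ball x r) w)"
  shows "bounded_vanishing_morrey (frac_maximal_finite \<alpha>) (frac_maximal \<alpha>) P
           p \<phi> (\<lambda>x. w x powr p) q \<psi> (\<lambda>x. w x powr q)
       \<and> bounded_vanishing_morrey (frac_integral_converges \<alpha>) (frac_integral \<alpha>) P
           p \<phi> (\<lambda>x. w x powr p) q \<psi> (\<lambda>x. w x powr q)"
proof -
  interpret dominated_morrey \<alpha> p q w P \<phi> \<psi>
    using assms by unfold_locales auto
  show ?thesis
  proof (intro conjI bounded_vanishing_morreyI)
    fix f :: "real ^ 'n \<Rightarrow> real" and x :: "real ^ 'n"
    assume f: "f \<in> borel_measurable lebesgue"
    have le: "frac_maximal_ennreal \<alpha> f x \<le> riesz_potential \<alpha> f x"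
      by (rule frac_maximal_ennreal_le_riesz_potential[OF f assms(2)])
    \<comment> \<open>Where the supremum is infinite, \<open>enn2real\<close> returns 0 and the
      bound is trivial; finiteness almost everywhere is tracked by
      \<open>frac_maximal_finite\<close>.\<close>
    show "ennreal \<bar>frac_maximal \<alpha> f x\<bar> \<le> riesz_potential \<alpha> f x"
    proof (cases "frac_maximal_ennreal \<alpha> f x = top")
      case False
      then have "ennreal \<bar>frac_maximal \<alpha> f x\<bar> = frac_maximal_ennreal \<alpha> f x"
        by (simp add: frac_maximal_def less_top)
      then show ?thesis using le by simp
    qed (simp add: frac_maximal_def)
    show "frac_maximal_finite \<alpha> f x" if "riesz_potential \<alpha> f x < top"
      using le_less_trans[OF le that] by (simp add: frac_maximal_finite_def)
  qed (auto intro: frac_maximal_measurable frac_integral_measurable frac_integral_le_riesz_potential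
      frac_integral_convergesI)
qed

end
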